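(* Let $m\geq 3$ be an integer and let $I_2(m)$ be the germ $(\mathbb{C}^2,0)$, with coordinates $(t_1,t_2)$, equipped with the multiplication $\circ$ on its tangent bundle with unit field $\partial_1$ and $\partial_2\circ\partial_2=t_2^{m-2}\partial_1$. Let $$C_1=\mathrm{Id}_2,\quad C_2=\begin{pmatrix}0&t_2^{m-2}\\1&0\end{pmatrix},\quad E=\begin{pmatrix}0&1\\0&0\end{pmatrix}.$$ Consider (holomorphic or formal) $(T)$-structures of the form $$(\ast)\qquad A_1=C_1,\quad A_2=C_2+zfE .$$ (i) Any holomorphic $(T)$-structure over $I_2(m)$ is (holomorphically) gauge isomorphic to a $(T)$-structure of the form $(\ast)$ with $f\in\mathbb{C}\{t,z\}$ holomorphic. (ii) Any formal $(T)$-structure over $I_2(m)$ is formally gauge isomorphic to a formal $(T)$-structure of the form $(\ast)$ with $f\in\mathbb{C}\{t,z]]$. (iii) Any holomorphic or formal $(T)$-structure over $I_2(m)$ is formally gauge isomorphic to a formal $(T)$-structure of the form $(\ast)$ where $f=0$ if $m=3$, and $f\in\mathbb{C}[[z]][t_2]_{\leq m-4}$ if $m\geq 4$. With respect to formal gauge isomorphisms, the function $f$ is unique, i.e. two formal $(T)$-structures of the form $(\ast)$ with functions $f,\tilde f$ both of this type are formally gauge isomorphic only if $f=\tilde f$.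
   Context: Rings: $t=(t_1,t_2)$; $\mathbb{C}\{t\}$ and $\mathbb{C}\{t,z\}$ are rings of convergent power series. $\mathbb{C}\{t,z]]$ is the ring of formal power series $\sum_{n\geq 0}a_n z^n$ with all $a_n=a_n(t)$ holomorphic on the same neighbourhood of $0$ (the neighbourhood depends on the series but not on $n$). $\mathbb{C}[[z]][t_2]_{\leq k}$ is the space of power series $\sum_{n\ge 0} a_nz^n$ where each $a_n$ is a polynomial in $t_2$ of degree at most $k$. For a matrix $A$ with entries in these rings write $A=\sum_{n\geq0}A(n)z^n$ with $A(n)$ depending only on $t$. $(T)$-structures: a $(T)$-structure over a complex manifold $M$ is a holomorphic vector bundle $H\to\mathbb{C}\times M$ with a map $\nabla:\mathcal{O}(H)\to\frac1z\mathcal{O}_{\mathbb{C}\times M}\cdot\Omega^1_M\otimes\mathcal{O}(H)$ whose restriction to $H|_{\{z\}\times M}$ is a flat connection for every $z\in\mathbb{C}^*$. Over the germ $M=(\mathbb{C}^2,0)$ the bundle $H$ (a germ along $(0,0)\in\mathbb{C}\times\mathbb{C}^2$) is assumed trivial; in the rank 2 case, in a trivialization $\underline{s}=(s_1,s_2)$, one has $\nabla\underline{s}=\underline{s}\cdot\frac1z(A_1dt_1+A_2dt_2)$ with $A_1,A_2\in M_{2\times2}(\mathbb{C}\{t,z\})$, and flatness means $z\partial_1A_2-z\partial_2A_1+[A_1,A_2]=0$. So a $(T)$-structure is given by such a pair $(A_1,A_2)$. A formal $(T)$-structure is given by a pair $(A_1,A_2)$ of matrices with entries in $\mathbb{C}\{t,z]]$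 satisfying the same equation. Unfolding condition and induced multiplication: on $K=H|_{\{0\}\times M}$ one has the Higgs field $C_{\partial_i}=A_i(0)$ (these commute). The (formal) $(T)$-structure satisfies the unfolding condition if there is a section $\zeta\in\mathcal{O}(K)$ such that $X\mapsto C_X\zeta$ is an isomorphism $TM\to K$. It then induces a well-defined multiplication on $TM$ by $C_{X\circ Y}\zeta=C_XC_Y\zeta$, whose unit field $e$ is determined by $C_e\zeta=\zeta$. A (formal) $(T)$-structure "over $I_2(m)$" means a (formal) $(T)$-structure over $(\mathbb{C}^2,0)$ which satisfies the unfolding condition and induces the multiplication and unit field of $I_2(m)$. Gauge isomorphisms: $(A_1,A_2)$ and $(\tilde A_1,\tilde A_2)$ are (holomorphically) gauge isomorphic, respectively formally gauge isomorphic, if there is a matrix $T$ with entries in $\mathbb{C}\{t,z\}$, respectively $\mathbb{C}\{t,z]]$, with $T(0)$ invertible, such that $z\partial_iT+A_iT-T\tilde A_i=0$ for $i=1,2$. *)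

theory Defs
  imports "HOL-Analysis.Analysis" "HOL-Computational_Algebra.Computational_Algebra"
begin

text \<open>
  A power series in \<open>t = (t1, t2)\<close> has type \<open>complex fps fps\<close>: the coefficient of
  \<open>t1^i * t2^j\<close> in \<open>a\<close> is \<open>fps_nth (fps_nth a i) j\<close>. A power series in \<open>(t, z)\<close> has type
  \<open>complex fps fps fps\<close>: \<open>fps_nth f n\<close> is the coefficient \<open>a_n(t)\<close> of \<open>z^n\<close>.
  Germs of holomorphic functions at the origin are represented by their Taylor series, so
  the rings below are subrings of these types.
\<close>

type_synonym tser = "complex fps fps"
type_synonym tzser = "complex fps fps fps"

text \<open>Absolute convergence on the polydisc of radius \<open>r\<close> (\<^const>\<open>summable_on\<close> is unconditional).\<close>

definition converges_t :: "real \<Rightarrow> tser \<Rightarrow> bool" where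
  "converges_t r a \<longleftrightarrow> (\<forall>t1 t2. norm t1 < r \<and> norm t2 < r \<longrightarrow>
     (\<lambda>(i, j). fps_nth (fps_nth a i) j * t1 ^ i * t2 ^ j) summable_on UNIV)"

definition converges_tz :: "real \<Rightarrow> tzser \<Rightarrow> bool" where
  "converges_tz r f \<longleftrightarrow> (\<forall>t1 t2 z. norm t1 < r \<and> norm t2 < r \<and> norm z < r \<longrightarrow>
     (\<lambda>(n, i, j). fps_nth (fps_nth (fps_nth f n) i) j * z ^ n * t1 ^ i * t2 ^ j)
       summable_on UNIV)"

text \<open>The rings \<open>\<complex>{t}\<close>, \<open>\<complex>{t,z}\<close> and \<open>\<complex>{t,z]]\<close>. In the last one the polydisc does not
  depend on the power of \<open>z\<close>.\<close>

definition Ct :: "tser set" where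
  "Ct = {a. \<exists>r>0. converges_t r a}"

definition Ctz :: "tzser set" where
  "Ctz = {f. \<exists>r>0. converges_tz r f}"

definition Ct_formal_z :: "tzser set" where
  "Ct_formal_z = {f. \<exists>r>0. \<forall>n. converges_t r (fps_nth f n)}"

text \<open>The space \<open>\<complex>[[z]][t2]\<close> in degree at most \<open>k\<close> in \<open>t2\<close>.\<close>

definition Cz_poly_t2 :: "nat \<Rightarrow> tzser set" where
  "Cz_poly_t2 k = {f. \<forall>n. \<exists>p :: complex poly. degree p \<le> k \<and>
     fps_nth f n = fps_const (fps_of_poly p)}"

definition t2 :: tser where
  "t2 = fps_const fps_X"

definition d1 :: "tzser \<Rightarrow> tzser" where
  "d1 f = Abs_fps (\<lambda>n. fps_deriv (fps_nth f n))"

definition d2 :: "tzser \<Rightarrow> tzser" where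
  "d2 f = Abs_fps (\<lambda>n. Abs_fps (\<lambda>i. fps_deriv (fps_nth (fps_nth f n) i)))"

definition vec_over :: "'a set \<Rightarrow> ('a ^ 2) set" where
  "vec_over R = {v. \<forall>i. v $ i \<in> R}"

definition mat_over :: "'a set \<Rightarrow> ('a ^ 2 ^ 2) set" where
  "mat_over R = {M. \<forall>i j. M $ i $ j \<in> R}"

definition at_z0 :: "tzser ^ 2 ^ 2 \<Rightarrow> tser ^ 2 ^ 2" where
  "at_z0 A = map_matrix (\<lambda>f. fps_nth f 0) A"

text \<open>The operators \<open>z \<partial>_1\<close> and \<open>z \<partial>_2\<close> on matrices; here \<^const>\<open>fps_X\<close> is \<open>z\<close>.\<close>

definition zd1 :: "tzser ^ 2 ^ 2 \<Rightarrow> tzser ^ 2 ^ 2" where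
  "zd1 A = map_matrix (\<lambda>f. fps_X * d1 f) A"

definition zd2 :: "tzser ^ 2 ^ 2 \<Rightarrow> tzser ^ 2 ^ 2" where
  "zd2 A = map_matrix (\<lambda>f. fps_X * d2 f) A"

text \<open>A holomorphic \<open>(T)\<close>-structure is the case \<open>R = Ctz\<close>, a formal one \<open>R = Ct_formal_z\<close>.\<close>

definition T_structure :: "tzser set \<Rightarrow> tzser ^ 2 ^ 2 \<Rightarrow> tzser ^ 2 ^ 2 \<Rightarrow> bool" where
  "T_structure R A1 A2 \<longleftrightarrow> A1 \<in> mat_over R \<and> A2 \<in> mat_over R \<and>
     zd1 A2 - zd2 A1 + (A1 ** A2 - A2 ** A1) = 0"

text \<open>The Higgs field \<open>C_X \<zeta>\<close> for \<open>X = X1 \<partial>_1 + X2 \<partial>_2\<close>, with vector fields and sections of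
  \<open>K\<close> given by their component vectors.\<close>

definition higgs :: "tzser ^ 2 ^ 2 \<Rightarrow> tzser ^ 2 ^ 2 \<Rightarrow> tser ^ 2 \<Rightarrow> tser ^ 2 \<Rightarrow> tser ^ 2" where
  "higgs A1 A2 X \<zeta> = (X $ 1) *s (at_z0 A1 *v \<zeta>) + (X $ 2) *s (at_z0 A2 *v \<zeta>)"

text \<open>The isomorphism of bundle germs is bijectivity on germs of holomorphic sections.\<close>

definition unfolding_section :: "tzser ^ 2 ^ 2 \<Rightarrow> tzser ^ 2 ^ 2 \<Rightarrow> tser ^ 2 \<Rightarrow> bool" where
  "unfolding_section A1 A2 \<zeta> \<longleftrightarrow> \<zeta> \<in> vec_over Ct \<and>
     bij_betw (\<lambda>X. higgs A1 A2 X \<zeta>) (vec_over Ct) (vec_over Ct)"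

text \<open>The multiplication of \<open>I_2(m)\<close>: the bilinear extension of \<open>\<partial>_1 \<circ> X = X \<circ> \<partial>_1 = X\<close> and
  \<open>\<partial>_2 \<circ> \<partial>_2 = t2^(m-2) \<partial>_1\<close>.\<close>

definition I2_mult :: "nat \<Rightarrow> tser ^ 2 \<Rightarrow> tser ^ 2 \<Rightarrow> tser ^ 2" where
  "I2_mult m X Y = vector [X $ 1 * Y $ 1 + t2 ^ (m - 2) * (X $ 2 * Y $ 2),
                           X $ 1 * Y $ 2 + X $ 2 * Y $ 1]"

definition I2_unit :: "tser ^ 2" where
  "I2_unit = vector [1, 0]"

text \<open>For an unfolding section \<open>\<zeta>\<close> the equations \<open>C_{X \<circ> Y} \<zeta> = C_X C_Y \<zeta>\<close> and \<open>C_e \<zeta> = \<zeta>\<close>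
  determine \<open>X \<circ> Y\<close> and \<open>e\<close>; they are required to be those of \<open>I_2(m)\<close>.\<close>

definition T_structure_over_I2 ::
    "tzser set \<Rightarrow> nat \<Rightarrow> tzser ^ 2 ^ 2 \<Rightarrow> tzser ^ 2 ^ 2 \<Rightarrow> bool" where
  "T_structure_over_I2 R m A1 A2 \<longleftrightarrow> T_structure R A1 A2 \<and>
     (\<exists>\<zeta>. unfolding_section A1 A2 \<zeta> \<and>
        (\<forall>X \<in> vec_over Ct. \<forall>Y \<in> vec_over Ct.
           higgs A1 A2 (I2_mult m X Y) \<zeta> = higgs A1 A2 X (higgs A1 A2 Y \<zeta>)) \<and>
        higgs A1 A2 I2_unit \<zeta> = \<zeta>)"

text \<open>Invertibility of \<open>T(0)\<close> is meant over \<open>\<complex>{t}\<close>.\<close>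

definition gauge_isomorphic :: "tzser set \<Rightarrow> tzser ^ 2 ^ 2 \<Rightarrow> tzser ^ 2 ^ 2 \<Rightarrow>
    tzser ^ 2 ^ 2 \<Rightarrow> tzser ^ 2 ^ 2 \<Rightarrow> bool" where
  "gauge_isomorphic R A1 A2 B1 B2 \<longleftrightarrow> (\<exists>T \<in> mat_over R.
     (\<exists>S \<in> mat_over Ct. at_z0 T ** S = mat 1 \<and> S ** at_z0 T = mat 1) \<and>
     zd1 T + A1 ** T - T ** B1 = 0 \<and> zd2 T + A2 ** T - T ** B2 = 0)"

definition C1 :: "tzser ^ 2 ^ 2" where
  "C1 = mat 1"

definition C2 :: "nat \<Rightarrow> tzser ^ 2 ^ 2" where
  "C2 m = vector [vector [0, fps_const (t2 ^ (m - 2))],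
                  vector [1, 0]]"

definition E :: "tzser ^ 2 ^ 2" where
  "E = vector [vector [0, 1],
               vector [0, 0]]"

definition form_A2 :: "nat \<Rightarrow> tzser \<Rightarrow> tzser ^ 2 ^ 2" where
  "form_A2 m f = C2 m + map_matrix (\<lambda>e. fps_X * f * e) E"

definition formal_normal_forms :: "nat \<Rightarrow> tzser set" where
  "formal_normal_forms m = (if m = 3 then {0} else Cz_poly_t2 (m - 4))"

end

theory Submission
  imports Defs
begin

text \<open>
  After the unfolding condition has forced \<open>A1(0) = 1\<close>, the linear system
  \<open>\<partial>\<^sub>1 T = - ((A1 - 1) / z) T\<close> provides a gauge with \<open>A1 = 1\<close>; flatness then makes \<open>A2\<close>
  independent of \<open>t1\<close>, and the initial value at \<open>t1 = 0\<close> is chosen so that \<open>A2(0) = C2\<close>.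
  A basis \<open>(v, z\<nabla>\<^sub>2 v)\<close> with \<open>v = g e\<^sub>1\<close> brings \<open>A2\<close> to companion form, and
  \<open>g\<close> is determined by a scalar linear equation that kills the last diagonal entry. This yields
  the form with \<open>f\<close>, over both rings at once.

  Two forms \<open>f\<close>, \<open>g\<close> are related by \<open>v = x e\<^sub>1 + y e\<^sub>2\<close> exactly if
  \<open>z x'' + a' y + 2 a y' + (f - g) x = 0\<close> and \<open>2 x' + (f - g) y + z y'' = 0\<close> with
  \<open>a = t2\<^bsup>m-2\<^esup> + z f\<close>. At order \<open>z\<^sup>n\<close> the first equation, taken modulo \<open>t2\<^bsup>m-3\<^esup>\<close>, determines
  \<open>g\<^sub>n\<close> modulo \<open>t2\<^bsup>m-3\<^esup>\<close>; the rest is a regular singular system for \<open>(x\<^sub>n, y\<^sub>n)\<close> which is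
  the same for all \<open>n\<close> up to the right-hand side, so that all solutions converge on a common disc.
\<close>

text \<open>The obstacle is the ring \<open>Ct_formal_z\<close>: no single norm describes it, yet
  its polydisc must not shrink with the power of \<open>z\<close>. It is therefore written as a
  union of weighted algebras, and estimates that shrink only the radius in \<open>t\<close> then
  serve both rings. Equations are solved formally first; convergence is a bound proved afterwards.
  The number \<open>m - 3\<close> comes from the part of \<open>a' y + 2 a y'\<close> at
  \<open>z = 0\<close>, which is \<open>t2^(m-3) ((m-2) y + 2 t2 y')\<close>. The bracket multiplies
  \<open>t2^j\<close> by \<open>2 j + m - 2\<close>, never zero, and so is bijective on power
  series. Multiples of \<open>t2^(m-3)\<close> can thus be gauged away, which leaves degree at most
  \<open>m - 4\<close>. In this last reduction the equation at order \<open>n\<close> contains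
  second derivatives of order \<open>n - 1\<close>. Differentiation is unbounded for a norm of fixed
  radius but keeps the radius of convergence, so the invariant carried along is a lower bound on
  that radius. It says nothing about growth in \<open>n\<close>, and the resulting gauge is only
  formal in \<open>z\<close>, even for holomorphic input.\<close>

no_notation fps_nth (infixl "$" 75)

text \<open>Well-founded recursion in the form of a fixpoint theorem, so that recursive objects can
  be built inside proofs: solutions of linear equations, of the regular singular system, and
  sequences of gauge coefficients.\<close>

lemma causal_fixpoint_ex:
  fixes F :: "('i \<Rightarrow> 'b) \<Rightarrow> 'i \<Rightarrow> 'b" and \<delta> :: "'i \<Rightarrow> nat"
  assumes "\<And>x y i. (\<And>j. \<delta> j < \<delta> i \<Longrightarrow> x j = y j) \<Longrightarrow> F x i = F y i"
  shows "\<exists>x. F x = x"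
proof -
  have "adm_wf (Wellfounded.measure \<delta>) F"
    unfolding adm_wf_def using assms by (metis in_measure)
  from wfrec_fixpoint[OF wf_measure this] show ?thesis by metis
qed

section \<open>Truncated norms\<close>

text \<open>Truncation kills series of high order, so definiteness cannot be expected.\<close>

definition submult_seminorm :: "('a::comm_ring_1 \<Rightarrow> real) \<Rightarrow> bool" where
  "submult_seminorm p \<longleftrightarrow> p 0 = 0 \<and> (\<forall>a. p a \<ge> 0) \<and> (\<forall>a. p (- a) = p a) \<and>
     (\<forall>a b. p (a + b) \<le> p a + p b) \<and> (\<forall>a b. p (a * b) \<le> p a * p b)"

lemma submult_seminormD:
  assumes "submult_seminorm p"
  shows "p 0 = 0" "p a \<ge> 0" "p (- a) = p a" "p (a + b) \<le> p a + p b" "p (a * b) \<le> p a * p b"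
  using assms by (auto simp: submult_seminorm_def)

lemma submult_seminorm_sum:
  assumes "submult_seminorm p"
  shows "p (\<Sum>i\<in>A. f i) \<le> (\<Sum>i\<in>A. p (f i))"
proof (induction A rule: infinite_finite_induct)
  case (insert x A)
  then show ?case using submult_seminormD(4)[OF assms, of "f x" "sum f A"] by auto
qed (auto simp: submult_seminormD[OF assms])

text \<open>Submultiplicativity passes to the weighted sums of coefficient norms. The bound by 1
  puts a product of weights below each factor, which yields common refinements.\<close>

definition weight :: "(nat \<Rightarrow> real) \<Rightarrow> bool" where
  "weight w \<longleftrightarrow> w 0 = 1 \<and> (\<forall>n. 0 < w n \<and> w n \<le> 1) \<and> (\<forall>n k. w (n + k) \<le> w n * w k)"

lemma weightD:
  assumes "weight w"
  shows "w 0 = 1" "0 < w n" "0 \<le> w n" "w n \<le> 1" "w (n + k) \<le> w n * w k"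
  using assms by (auto simp: weight_def less_imp_le)

lemma weight_power: "0 < r \<Longrightarrow> r \<le> 1 \<Longrightarrow> weight (\<lambda>n. r ^ n)"
  by (auto simp: weight_def power_le_one power_add)

lemma weight_mult:
  assumes "weight v" "weight w"
  shows "weight (\<lambda>n. v n * w n)"
  unfolding weight_def
proof (intro conjI allI)
  fix n k :: nat
  have "v (n + k) * w (n + k) \<le> (v n * v k) * (w n * w k)"
    by (intro mult_mono) (auto simp: weightD[OF assms(1)] weightD[OF assms(2)])
  then show "v (n + k) * w (n + k) \<le> v n * w n * (v k * w k)" by (simp add: ac_simps)
qed (auto simp: weightD[OF assms(1)] weightD[OF assms(2)] mult_le_one)

text \<open>Truncation at \<open>N\<close> keeps the weighted norm submultiplicative, because the coefficients of a
  product up to \<open>N\<close> only involve coefficients up to \<open>N\<close>. Convergence becomes a bound uniform in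
  \<open>N\<close>, and all sums are finite.\<close>

definition fps_trunc_norm :: "nat \<Rightarrow> (nat \<Rightarrow> real) \<Rightarrow> ('a::zero \<Rightarrow> real) \<Rightarrow> 'a fps \<Rightarrow> real" where
  "fps_trunc_norm N w p f = (\<Sum>n\<le>N. w n * p (fps_nth f n))"

lemma sum_truncated_convolution_le:
  fixes a b :: "nat \<Rightarrow> real"
  assumes "\<And>n. a n \<ge> 0" "\<And>n. b n \<ge> 0"
  shows "(\<Sum>n\<le>N. \<Sum>i\<le>n. a i * b (n - i)) \<le> (\<Sum>n\<le>N. a n) * (\<Sum>n\<le>N. b n)"
proof -
  have "(\<Sum>n\<le>N. \<Sum>i\<le>n. a i * b (n - i)) = (\<Sum>(i, j)\<in>{(i, j). i + j \<le> N}. a i * b j)"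
    by (rule sum.triangle_reindex_eq[symmetric])
  also have "\<dots> \<le> (\<Sum>(i, j)\<in>{..N} \<times> {..N}. a i * b j)"
    by (rule sum_mono2) (auto simp: assms)
  also have "\<dots> = (\<Sum>n\<le>N. a n) * (\<Sum>n\<le>N. b n)"
    by (simp add: sum_product sum.cartesian_product)
  finally show ?thesis .
qed

lemma submult_seminorm_fps_trunc_norm:
  assumes p: "submult_seminorm p" and w: "weight w"
  shows "submult_seminorm (fps_trunc_norm N w p)"
  unfolding submult_seminorm_def
proof (intro conjI allI)
  note P = submult_seminormD[OF p] and W = weightD[OF w]
  fix f g
  show "fps_trunc_norm N w p 0 = 0" "fps_trunc_norm N w p (- f) = fps_trunc_norm N w p f"
    by (auto simp: fps_trunc_norm_def P)
  show "0 \<le> fps_trunc_norm N w p f"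
    by (auto simp: fps_trunc_norm_def P W intro!: sum_nonneg mult_nonneg_nonneg)
  show "fps_trunc_norm N w p (f + g) \<le> fps_trunc_norm N w p f + fps_trunc_norm N w p g"
    unfolding fps_trunc_norm_def sum.distrib[symmetric]
    by (rule sum_mono) (auto simp: P W distrib_left[symmetric] intro!: mult_left_mono)
  have "w n * p (fps_nth (f * g) n)
      \<le> (\<Sum>i\<le>n. (w i * p (fps_nth f i)) * (w (n - i) * p (fps_nth g (n - i))))" for n
  proof -
    have "p (fps_nth (f * g) n) \<le> (\<Sum>i\<le>n. p (fps_nth f i * fps_nth g (n - i)))"
      unfolding fps_mult_nth atLeast0AtMost by (rule submult_seminorm_sum[OF p])
    then have "w n * p (fps_nth (f * g) n)
        \<le> (\<Sum>i\<le>n. w n * p (fps_nth f i * fps_nth g (n - i)))"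
      using W(3)[of n] by (simp add: sum_distrib_left[symmetric] mult_left_mono)
    also have "\<dots> \<le> (\<Sum>i\<le>n. (w i * w (n - i)) * (p (fps_nth f i) * p (fps_nth g (n - i))))"
    proof (rule sum_mono)
      fix i assume "i \<in> {..n}"
      then have "w n \<le> w i * w (n - i)" using W(5)[of i "n - i"] by auto
      then show "w n * p (fps_nth f i * fps_nth g (n - i))
          \<le> (w i * w (n - i)) * (p (fps_nth f i) * p (fps_nth g (n - i)))"
        by (rule mult_mono) (auto simp: P W)
    qed
    finally show ?thesis by (simp add: ac_simps)
  qed
  then have "fps_trunc_norm N w p (f * g)
      \<le> (\<Sum>n\<le>N. \<Sum>i\<le>n. (w i * p (fps_nth f i)) * (w (n - i) * p (fps_nth g (n - i))))"
    unfolding fps_trunc_norm_def by (rule sum_mono)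
  also have "\<dots> \<le> fps_trunc_norm N w p f * fps_trunc_norm N w p g"
    unfolding fps_trunc_norm_def by (rule sum_truncated_convolution_le) (auto simp: P W)
  finally show "fps_trunc_norm N w p (f * g) \<le> fps_trunc_norm N w p f * fps_trunc_norm N w p g" .
qed

lemma submult_seminorm_norm: "submult_seminorm (norm :: complex \<Rightarrow> real)"
  by (auto simp: submult_seminorm_def norm_triangle_ineq norm_mult)

lemma fps_trunc_norm_mono:
  assumes "\<And>n. n \<le> N \<Longrightarrow> w n * p (fps_nth f n) \<le> c * (v n * q (fps_nth g n))"
  shows "fps_trunc_norm N w p f \<le> c * fps_trunc_norm N v q g"
  unfolding fps_trunc_norm_def sum_distrib_left by (rule sum_mono) (simp add: assms)

text \<open>The gain of a factor \<open>r\<close> under integration: each coefficient moves up one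
  degree, and division by the exponent does not enlarge it.\<close>

lemma fps_trunc_norm_shift_le:
  assumes p: "p 0 = 0" "\<And>a. p a \<ge> 0" and r: "0 \<le> r"
    and "fps_nth g 0 = 0" "\<And>n. p (fps_nth g (Suc n)) \<le> p (fps_nth f n)"
  shows "fps_trunc_norm N (\<lambda>n. r ^ n) p g \<le> r * fps_trunc_norm N (\<lambda>n. r ^ n) p f"
proof (cases N)
  case 0
  then show ?thesis using assms by (auto simp: fps_trunc_norm_def)
next
  case (Suc M)
  have "fps_trunc_norm N (\<lambda>n. r ^ n) p g = (\<Sum>n\<le>M. r ^ Suc n * p (fps_nth g (Suc n)))"
    using assms unfolding fps_trunc_norm_def Suc sum.atMost_Suc_shift by simp
  also have "\<dots> \<le> (\<Sum>n\<le>M. r ^ Suc n * p (fps_nth f n))"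
    using assms by (intro sum_mono mult_left_mono) auto
  also have "\<dots> = r * (\<Sum>n\<le>M. r ^ n * p (fps_nth f n))"
    by (simp add: sum_distrib_left ac_simps)
  also have "\<dots> \<le> r * fps_trunc_norm N (\<lambda>n. r ^ n) p f"
    unfolding fps_trunc_norm_def using p r Suc by (intro mult_left_mono sum_mono2) auto
  finally show ?thesis .
qed

section \<open>Weighted boundedness of series in \<open>t\<close> and \<open>z\<close>\<close>

definition tz_norm :: "nat \<Rightarrow> (nat \<Rightarrow> real) \<Rightarrow> real \<Rightarrow> tzser \<Rightarrow> real" where
  "tz_norm N w r = fps_trunc_norm N w
     (fps_trunc_norm N (\<lambda>i. r ^ i) (fps_trunc_norm N (\<lambda>j. r ^ j) norm))"

lemma tz_norm_seminorm:
  assumes "weight w" "0 < r" "r \<le> 1"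
  shows "submult_seminorm (tz_norm N w r)"
  unfolding tz_norm_def
  by (intro submult_seminorm_fps_trunc_norm submult_seminorm_norm weight_power assms)

definition tz_coeff :: "tzser \<Rightarrow> nat \<times> nat \<times> nat \<Rightarrow> complex" where
  "tz_coeff f = (\<lambda>(n, i, j). fps_nth (fps_nth (fps_nth f n) i) j)"

definition tz_weight :: "(nat \<Rightarrow> real) \<Rightarrow> real \<Rightarrow> nat \<times> nat \<times> nat \<Rightarrow> real" where
  "tz_weight w r = (\<lambda>(n, i, j). w n * r ^ i * r ^ j)"

lemma tz_norm_conv_sum:
  "tz_norm N w r f = (\<Sum>x\<in>{..N} \<times> {..N} \<times> {..N}. tz_weight w r x * norm (tz_coeff f x))"
  by (simp add: tz_norm_def fps_trunc_norm_def tz_weight_def tz_coeff_def sum_distrib_left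
      sum.cartesian_product' mult.assoc)

lemma tz_eqI: "(\<And>x. tz_coeff f x = tz_coeff g x) \<Longrightarrow> f = g"
  by (auto simp: tz_coeff_def fps_eq_iff)

definition tz_bounded :: "(nat \<Rightarrow> real) \<Rightarrow> real \<Rightarrow> tzser \<Rightarrow> bool" where
  "tz_bounded w r f \<longleftrightarrow> (\<exists>C. \<forall>N. tz_norm N w r f \<le> C)"

text \<open>Every finite set of exponents lies in a cube, so both kinds of sums have the same
  bounds. Finite sets, unlike cubes, are stable under injective reindexing.\<close>

lemma tz_bounded_iff_finite_sums:
  assumes "weight w" "0 < r"
  shows "tz_bounded w r f \<longleftrightarrow>
    (\<exists>C. \<forall>F. finite F \<longrightarrow> (\<Sum>x\<in>F. tz_weight w r x * norm (tz_coeff f x)) \<le> C)"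
proof
  have nn: "0 \<le> tz_weight w r x * norm (tz_coeff f x)" for x
    using assms by (auto simp: tz_weight_def weightD split: prod.splits)
  assume "tz_bounded w r f"
  then obtain C where C: "\<And>N. tz_norm N w r f \<le> C" by (auto simp: tz_bounded_def)
  have "(\<Sum>x\<in>F. tz_weight w r x * norm (tz_coeff f x)) \<le> C" if "finite F" for F
  proof -
    define N where "N = Max ((\<lambda>(n, i, j). n + i + j) ` F)"
    have "n + i + j \<le> N" if "(n, i, j) \<in> F" for n i j
      unfolding N_def using \<open>finite F\<close> that by (intro Max_ge) force+
    then have "F \<subseteq> {..N} \<times> {..N} \<times> {..N}" by force
    then have "(\<Sum>x\<in>F. tz_weight w r x * norm (tz_coeff f x)) \<le> tz_norm N w r f"
      unfolding tz_norm_conv_sum by (intro sum_mono2) (use nn in auto)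
    then show ?thesis using C[of N] by linarith
  qed
  then show "\<exists>C. \<forall>F. finite F \<longrightarrow> (\<Sum>x\<in>F. tz_weight w r x * norm (tz_coeff f x)) \<le> C" by blast
next
  assume "\<exists>C. \<forall>F. finite F \<longrightarrow> (\<Sum>x\<in>F. tz_weight w r x * norm (tz_coeff f x)) \<le> C"
  then show "tz_bounded w r f" unfolding tz_bounded_def tz_norm_conv_sum by (meson finite_SigmaI finite_atMost)
qed

text \<open>Here \<open>\<phi>\<close> sends the exponent of a coefficient of \<open>g\<close> to
  the exponent of the coefficient of \<open>f\<close> that dominates it.\<close>

lemma tz_bounded_transfer:
  assumes "weight w" "0 < r" "tz_bounded w r f" "weight w'" "0 < r'"
    and inj: "inj_on \<phi> A" and c: "c \<ge> 0"
    and le: "\<And>x. x \<in> A \<Longrightarrow> tz_weight w' r' x * norm (tz_coeff g x)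
                \<le> c * (tz_weight w r (\<phi> x) * norm (tz_coeff f (\<phi> x)))"
    and zero: "\<And>x. x \<notin> A \<Longrightarrow> tz_coeff g x = 0"
  shows "tz_bounded w' r' g"
proof -
  obtain C where C: "\<And>F. finite F \<Longrightarrow> (\<Sum>x\<in>F. tz_weight w r x * norm (tz_coeff f x)) \<le> C"
    using assms(1-3) by (auto simp: tz_bounded_iff_finite_sums)
  have "(\<Sum>x\<in>F. tz_weight w' r' x * norm (tz_coeff g x)) \<le> c * C" if "finite F" for F
  proof -
    have "(\<Sum>x\<in>F. tz_weight w' r' x * norm (tz_coeff g x))
        = (\<Sum>x\<in>F \<inter> A. tz_weight w' r' x * norm (tz_coeff g x))"
      using that zero by (intro sum.mono_neutral_right) auto
    also have "\<dots> \<le> (\<Sum>x\<in>F \<inter> A. c * (tz_weight w r (\<phi> x) * norm (tz_coeff f (\<phi> x))))"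
      by (intro sum_mono le) auto
    also have "\<dots> = c * (\<Sum>x\<in>\<phi> ` (F \<inter> A). tz_weight w r x * norm (tz_coeff f x))"
      using inj by (subst sum.reindex) (auto simp: sum_distrib_left inj_on_def)
    also have "\<dots> \<le> c * C" using C that c by (intro mult_left_mono) auto
    finally show ?thesis .
  qed
  then show ?thesis using assms(4,5) by (auto simp: tz_bounded_iff_finite_sums)
qed

lemma tz_bounded_mono:
  fixes w w' :: "nat \<Rightarrow> real"
  assumes "weight w" "0 < r" "tz_bounded w r f" "weight w'" "0 < r'"
    "\<And>n. w' n \<le> w n" "r' \<le> r"
  shows "tz_bounded w' r' f"
proof (rule tz_bounded_transfer[OF assms(1-5), where \<phi> = id and A = UNIV and c = 1])
  fix x :: "nat \<times> nat \<times> nat"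
  obtain n i j where x: "x = (n, i, j)" by (cases x)
  have "w' n * r' ^ i * r' ^ j \<le> w n * r ^ i * r ^ j"
    using assms(1,2,4-7) by (intro mult_mono power_mono) (auto simp: weightD)
  then show "tz_weight w' r' x * norm (tz_coeff f x)
      \<le> 1 * (tz_weight w r (id x) * norm (tz_coeff f (id x)))"
    by (auto simp: x tz_weight_def intro: mult_right_mono)
qed auto

text \<open>In the formal ring the bounds for the coefficients of \<open>z^n\<close> may grow
  arbitrarily with \<open>n\<close>. A weight that beats them with geometric decay makes the whole
  weighted sum finite. The case \<open>n = 0\<close> is left out because every weight is 1
  there.\<close>

lemma ex_weight_below:
  fixes c :: "nat \<Rightarrow> real"
  assumes "\<And>n. 0 \<le> c n"
  shows "\<exists>w. weight w \<and> (\<forall>n\<ge>1. w n * c n \<le> (1/2) ^ n)"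
proof -
  define v where "v n = 2 ^ n * (1 + (\<Sum>k\<le>n. c k))" for n
    \<comment> \<open>since \<open>v\<close> is increasing, \<open>n \<mapsto> v n\<^bsup>-n\<^esup>\<close> is submultiplicative\<close>
  have S: "0 \<le> (\<Sum>k\<le>n. c k)" for n by (simp add: sum_nonneg assms)
  have v1: "1 \<le> v n" for n
    unfolding v_def using S[of n] by (metis add_increasing2 mult_ge1_I order_refl two_realpow_ge_one)
  have v_mono: "v n \<le> v m" if "n \<le> m" for n m
  proof -
    have "(\<Sum>k\<le>n. c k) \<le> (\<Sum>k\<le>m. c k)" using that assms by (intro sum_mono2) auto
    then show ?thesis unfolding v_def using that S[of n] by (intro mult_mono power_increasing) auto
  qed
  define w where "w n = inverse (v n) ^ n" for n
  have vpos: "0 < v n" for n using v1[of n] by linarith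
  have iv: "0 < inverse (v n)" "inverse (v n) \<le> 1" for n
    using v1[of n] vpos[of n] by (auto simp: field_simps)
  have "weight w" unfolding weight_def
  proof (intro conjI allI)
    fix n k :: nat
    have "inverse (v (n + k)) \<le> inverse (v n)" "inverse (v (n + k)) \<le> inverse (v k)"
      using v_mono vpos by (auto intro!: le_imp_inverse_le)
    then show "w (n + k) \<le> w n * w k"
      unfolding w_def power_add using iv by (intro mult_mono power_mono) (auto simp: less_imp_le)
    show "w 0 = 1" "0 < w n" "w n \<le> 1" using iv[of n] by (auto simp: w_def intro!: power_le_one)
  qed
  moreover have "w n * c n \<le> (1/2) ^ n" if "n \<ge> 1" for n
  proof -
    have "w n \<le> inverse (v n)" unfolding w_def
      using iv[of n] that power_decreasing[of 1 n "inverse (v n)"] by auto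
    then have "w n * c n \<le> inverse (v n) * c n" using assms by (rule mult_right_mono)
    also have "c n \<le> (\<Sum>k\<le>n. c k)" using assms by (intro member_le_sum) auto
    then have "2 ^ n * c n \<le> v n" unfolding v_def by (intro mult_left_mono) auto
    then have "inverse (v n) * c n \<le> (1/2) ^ n"
      using vpos[of n] by (simp add: field_simps)
    finally show ?thesis .
  qed
  ultimately show ?thesis by blast
qed

section \<open>Comparison with convergence on polydiscs\<close>

lemma summable_on_complex_iff_bounded:
  fixes f :: "'i \<Rightarrow> complex"
  shows "f summable_on UNIV \<longleftrightarrow> (\<exists>C. \<forall>F. finite F \<longrightarrow> (\<Sum>x\<in>F. norm (f x)) \<le> C)"
  unfolding summable_on_iff_abs_summable_on_complex abs_summable_iff_bdd_above bdd_above_def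
  by auto

text \<open>For fixed \<open>n\<close> the weight \<open>w n\<close> is a positive constant and can
  be divided out. It affects the bound but not the polydisc, which is the same for all
  \<open>n\<close>.\<close>

lemma tz_bounded_imp_converges_t:
  assumes w: "weight w" and r: "0 < r" and b: "tz_bounded w r f"
  shows "converges_t r (fps_nth f n)"
  unfolding converges_t_def
proof (intro allI impI, elim conjE)
  fix t1 t2 :: complex assume t: "norm t1 < r" "norm t2 < r"
  obtain C where C: "\<And>F. finite F \<Longrightarrow> (\<Sum>x\<in>F. tz_weight w r x * norm (tz_coeff f x)) \<le> C"
    using b w r by (auto simp: tz_bounded_iff_finite_sums)
  note W = weightD[OF w]
  have "(\<Sum>x\<in>F. norm (case x of (i, j) \<Rightarrow> fps_nth (fps_nth (fps_nth f n) i) j * t1 ^ i * t2 ^ j))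
      \<le> C / w n" if "finite F" for F
  proof -
    have "w n * (\<Sum>x\<in>F. norm (case x of (i, j) \<Rightarrow> fps_nth (fps_nth (fps_nth f n) i) j * t1 ^ i * t2 ^ j))
        \<le> (\<Sum>x\<in>F. tz_weight w r (n, x) * norm (tz_coeff f (n, x)))"
      unfolding sum_distrib_left
    proof (rule sum_mono)
      fix x :: "nat \<times> nat"
      obtain i j where x: "x = (i, j)" by (cases x)
      have "norm t1 ^ i * norm t2 ^ j \<le> r ^ i * r ^ j"
        using t r by (intro mult_mono power_mono) auto
      then have "(w n * norm (fps_nth (fps_nth (fps_nth f n) i) j)) * (norm t1 ^ i * norm t2 ^ j)
          \<le> (w n * norm (fps_nth (fps_nth (fps_nth f n) i) j)) * (r ^ i * r ^ j)"
        using W by (intro mult_left_mono) auto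
      then show "w n * norm (case x of (i, j) \<Rightarrow> fps_nth (fps_nth (fps_nth f n) i) j * t1 ^ i * t2 ^ j)
          \<le> tz_weight w r (n, x) * norm (tz_coeff f (n, x))"
        by (simp add: x tz_weight_def tz_coeff_def norm_mult norm_power ac_simps)
    qed
    also have "\<dots> = (\<Sum>x\<in>Pair n ` F. tz_weight w r x * norm (tz_coeff f x))"
      by (subst sum.reindex) (auto simp: inj_on_def)
    also have "\<dots> \<le> C" using C that by auto
    finally show ?thesis using W(2)[of n] by (simp add: field_simps)
  qed
  then show "(\<lambda>(i, j). fps_nth (fps_nth (fps_nth f n) i) j * t1 ^ i * t2 ^ j) summable_on UNIV"
    unfolding summable_on_complex_iff_bounded by blast
qed

text \<open>Summability at the single point \<open>t1 = t2 = s\<close> is absolute, and that is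
  exactly the weighted bound.\<close>

lemma converges_t_imp_bounded:
  assumes "converges_t r a" "0 < s" "s < r"
  shows "\<exists>C\<ge>0. \<forall>N. fps_trunc_norm N (\<lambda>i. s ^ i) (fps_trunc_norm N (\<lambda>j. s ^ j) norm) a \<le> C"
proof -
  have "(\<lambda>(i, j). fps_nth (fps_nth a i) j * of_real s ^ i * of_real s ^ j) summable_on UNIV"
    using assms unfolding converges_t_def by auto
  then obtain C where C: "\<And>F. finite F \<Longrightarrow>
      (\<Sum>x\<in>F. norm (case x of (i, j) \<Rightarrow> fps_nth (fps_nth a i) j * of_real s ^ i * of_real s ^ j)) \<le> C"
    unfolding summable_on_complex_iff_bounded by blast
  have "fps_trunc_norm N (\<lambda>i. s ^ i) (fps_trunc_norm N (\<lambda>j. s ^ j) norm) a \<le> C" for N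
  proof -
    have "fps_trunc_norm N (\<lambda>i. s ^ i) (fps_trunc_norm N (\<lambda>j. s ^ j) norm) a =
      (\<Sum>x\<in>{..N} \<times> {..N}. norm (case x of (i, j) \<Rightarrow>
          fps_nth (fps_nth a i) j * of_real s ^ i * of_real s ^ j))"
      unfolding fps_trunc_norm_def sum_distrib_left sum.cartesian_product'
      using assms by (intro sum.cong refl) (auto simp: norm_mult norm_power)
    then show ?thesis using C by auto
  qed
  moreover have "C \<ge> 0" using C[of "{}"] by simp
  ultimately show ?thesis by blast
qed

lemma converges_tz_imp_bounded:
  assumes "converges_tz r f" "0 < s" "s < r"
  shows "tz_bounded (\<lambda>n. s ^ n) s f"
proof -
  have "(\<lambda>(n, i, j). fps_nth (fps_nth (fps_nth f n) i) j * of_real s ^ n * of_real s ^ i * of_real s ^ j)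
      summable_on UNIV"
    using assms unfolding converges_tz_def by auto
  then obtain C where C: "\<And>F. finite F \<Longrightarrow>
      (\<Sum>x\<in>F. norm (case x of (n, i, j) \<Rightarrow>
        fps_nth (fps_nth (fps_nth f n) i) j * of_real s ^ n * of_real s ^ i * of_real s ^ j)) \<le> C"
    unfolding summable_on_complex_iff_bounded by blast
  have "tz_norm N (\<lambda>n. s ^ n) s f = (\<Sum>x\<in>{..N} \<times> {..N} \<times> {..N}. norm (case x of (n, i, j) \<Rightarrow>
        fps_nth (fps_nth (fps_nth f n) i) j * of_real s ^ n * of_real s ^ i * of_real s ^ j))" for N
    unfolding tz_norm_conv_sum using assms
    by (intro sum.cong) (auto simp: tz_weight_def tz_coeff_def norm_mult norm_power)
  then have "tz_norm N (\<lambda>n. s ^ n) s f \<le> C" for N using C[of "{..N} \<times> {..N} \<times> {..N}"] by simp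
  then show ?thesis unfolding tz_bounded_def by blast
qed

lemma tz_bounded_power_imp_converges_tz:
  assumes "0 < v" "v \<le> 1" "0 < r" "tz_bounded (\<lambda>n. v ^ n) r f"
  shows "converges_tz (min v r) f"
  unfolding converges_tz_def
proof (intro allI impI, elim conjE)
  fix t1 t2 z :: complex assume t: "norm t1 < min v r" "norm t2 < min v r" "norm z < min v r"
  obtain C where C: "\<And>F. finite F \<Longrightarrow>
      (\<Sum>x\<in>F. tz_weight (\<lambda>n. v ^ n) r x * norm (tz_coeff f x)) \<le> C"
    using assms by (auto simp: tz_bounded_iff_finite_sums weight_power)
  have "(\<Sum>x\<in>F. norm (case x of (n, i, j) \<Rightarrow>
        fps_nth (fps_nth (fps_nth f n) i) j * z ^ n * t1 ^ i * t2 ^ j)) \<le> C" if "finite F" for F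
  proof -
    have "(\<Sum>x\<in>F. norm (case x of (n, i, j) \<Rightarrow>
        fps_nth (fps_nth (fps_nth f n) i) j * z ^ n * t1 ^ i * t2 ^ j))
        \<le> (\<Sum>x\<in>F. tz_weight (\<lambda>n. v ^ n) r x * norm (tz_coeff f x))"
    proof (rule sum_mono)
      fix x :: "nat \<times> nat \<times> nat"
      obtain n i j where x: "x = (n, i, j)" by (cases x)
      have "norm z ^ n * norm t1 ^ i * norm t2 ^ j \<le> v ^ n * r ^ i * r ^ j"
        using t assms by (intro mult_mono power_mono) auto
      then have "(norm (fps_nth (fps_nth (fps_nth f n) i) j)) * (norm z ^ n * norm t1 ^ i * norm t2 ^ j)
          \<le> (norm (fps_nth (fps_nth (fps_nth f n) i) j)) * (v ^ n * r ^ i * r ^ j)"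
        by (intro mult_left_mono) auto
      then show "norm (case x of (n, i, j) \<Rightarrow>
          fps_nth (fps_nth (fps_nth f n) i) j * z ^ n * t1 ^ i * t2 ^ j)
          \<le> tz_weight (\<lambda>n. v ^ n) r x * norm (tz_coeff f x)"
        by (simp add: x tz_weight_def tz_coeff_def norm_mult norm_power ac_simps)
    qed
    with C[OF that] show ?thesis by linarith
  qed
  then show "(\<lambda>(n, i, j). fps_nth (fps_nth (fps_nth f n) i) j * z ^ n * t1 ^ i * t2 ^ j)
      summable_on UNIV"
    unfolding summable_on_complex_iff_bounded by blast
qed

section \<open>Rings of series cut out by families of weights\<close>

text \<open>Geometric weights give \<open>\<complex>{t,z}\<close>. Arbitrary submultiplicative weights, which may decay as
  fast as one likes in the power of \<open>z\<close>, give \<open>\<complex>{t,z]]\<close>.\<close>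

definition series_ring :: "(nat \<Rightarrow> real) set \<Rightarrow> tzser set" where
  "series_ring W = {f. \<exists>w\<in>W. \<exists>r. 0 < r \<and> r \<le> 1 \<and> tz_bounded w r f}"

lemma Ctz_eq_series_ring: "Ctz = series_ring {w. \<exists>v. 0 < v \<and> v \<le> 1 \<and> w = (\<lambda>n. v ^ n)}"
proof (intro equalityI subsetI)
  fix f assume "f \<in> Ctz"
  then obtain r where r: "r > 0" "converges_tz r f" by (auto simp: Ctz_def)
  define s where "s = min (1/2) (r/2)"
  have "0 < s" "s < r" "s \<le> 1" using r by (auto simp: s_def)
  moreover from this have "tz_bounded (\<lambda>n. s ^ n) s f" using converges_tz_imp_bounded[of r f s] r by simp
  ultimately show "f \<in> series_ring {w. \<exists>v. 0 < v \<and> v \<le> 1 \<and> w = (\<lambda>n. v ^ n)}"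
    unfolding series_ring_def by auto
next
  fix f assume "f \<in> series_ring {w. \<exists>v. 0 < v \<and> v \<le> 1 \<and> w = (\<lambda>n. v ^ n)}"
  then obtain v r where "0 < v" "v \<le> 1" "0 < r" "tz_bounded (\<lambda>n. v ^ n) r f"
    unfolding series_ring_def by auto
  then show "f \<in> Ctz"
    using tz_bounded_power_imp_converges_tz[of v r f]
    unfolding Ctz_def by (intro CollectI exI[of _ "min v r"]) simp
qed

text \<open>A common polydisc gives a bound \<open>c n\<close> for each coefficient, and
  \<open>ex_weight_below\<close> absorbs all these bounds into one weight. The converse is
  \<open>tz_bounded_imp_converges_t\<close>.\<close>

lemma Ct_formal_z_eq_series_ring: "Ct_formal_z = series_ring {w. weight w}"
proof (intro equalityI subsetI)
  fix f assume "f \<in> Ct_formal_z"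
  then obtain r where r: "r > 0" "\<And>n. converges_t r (fps_nth f n)" by (auto simp: Ct_formal_z_def)
  define s where "s = min (1/2) (r/2)"
  have s: "0 < s" "s < r" "s \<le> 1" using r by (auto simp: s_def)
  let ?t = "\<lambda>N. fps_trunc_norm N (\<lambda>i. s ^ i) (fps_trunc_norm N (\<lambda>j. s ^ j) norm)"
  have "\<forall>n. \<exists>C\<ge>0. \<forall>N. ?t N (fps_nth f n) \<le> C"
    using converges_t_imp_bounded[OF r(2) s(1,2)] by blast
  then obtain c where c: "\<And>n. 0 \<le> c n" "\<And>n N. ?t N (fps_nth f n) \<le> c n" by metis
  obtain w where w: "weight w" "\<And>n. n \<ge> 1 \<Longrightarrow> w n * c n \<le> (1/2) ^ n"
    using ex_weight_below[of c] c(1) by blast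
  have "tz_norm N w s f \<le> c 0 + 2" for N
  proof -
    \<comment> \<open>The term \<open>n = 0\<close> keeps its full size \<open>c 0\<close>, since
      the weight cannot damp it.\<close>
    have "w n * ?t N (fps_nth f n) \<le> (if n = 0 then c 0 else 0) + (1/2) ^ n" for n
    proof -
      have "w n * ?t N (fps_nth f n) \<le> w n * c n"
        using c weightD[OF w(1)] by (intro mult_left_mono) auto
      also have "\<dots> \<le> (if n = 0 then c 0 else 0) + (1/2) ^ n"
        using w(2)[of n] weightD(1)[OF w(1)] by (cases "n = 0") auto
      finally show ?thesis .
    qed
    then have "tz_norm N w s f \<le> (\<Sum>n\<le>N. (if n = 0 then c 0 else 0) + (1/2) ^ n)"
      unfolding tz_norm_def fps_trunc_norm_def[of N w] by (rule sum_mono)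
    also have "\<dots> = c 0 + (2 - (1/2) ^ N)" by (induction N) (auto simp: field_simps)
    also have "\<dots> \<le> c 0 + 2" by simp
    finally show ?thesis .
  qed
  then have "tz_bounded w s f" unfolding tz_bounded_def by blast
  then show "f \<in> series_ring {w. weight w}" using w(1) s by (auto simp: series_ring_def)
next
  fix f assume "f \<in> series_ring {w. weight w}"
  then obtain w r where "weight w" "0 < r" "tz_bounded w r f" unfolding series_ring_def by auto
  then have "\<forall>n. converges_t r (fps_nth f n)" using tz_bounded_imp_converges_t by simp
  with \<open>0 < r\<close> show "f \<in> Ct_formal_z" by (auto simp: Ct_formal_z_def)
qed

text \<open>What the two rings share: \<open>mult_closed\<close> provides a common weight for
  finitely many series, \<open>geometric\<close> allows rescaling of \<open>z\<close>, and
  \<open>shift_dominated\<close> makes the ring closed under division by \<open>z\<close>.\<close>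

locale weight_family =
  fixes W :: "(nat \<Rightarrow> real) set"
  assumes weight: "w \<in> W \<Longrightarrow> weight w"
    and mult_closed: "v \<in> W \<Longrightarrow> w \<in> W \<Longrightarrow> (\<lambda>n. v n * w n) \<in> W"
    and geometric: "0 < s \<Longrightarrow> s \<le> 1 \<Longrightarrow> (\<lambda>n. s ^ n) \<in> W"
    and shift_dominated: "w \<in> W \<Longrightarrow> \<exists>v\<in>W. \<exists>c. \<forall>n. v n \<le> c * w (Suc n)"

lemma weight_family_Ctz: "weight_family {w. \<exists>v. 0 < v \<and> v \<le> 1 \<and> w = (\<lambda>n. v ^ n)}"
proof (unfold_locales, goal_cases)
  case (2 v w)
  then obtain a b where "0 < a" "a \<le> 1" "v = (\<lambda>n. a ^ n)" "0 < b" "b \<le> 1" "w = (\<lambda>n. b ^ n)"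
    by auto
  then show ?case by (auto intro!: exI[of _ "a * b"] simp: power_mult_distrib mult_le_one)
next
  case (4 w)
  then obtain v where "0 < v" "w = (\<lambda>n. v ^ n)" by auto
  then have "\<forall>n. w n \<le> (1 / v) * w (Suc n)" by simp
  then show ?case by (rule bexI[OF exI 4])
qed (auto intro: weight_power)

text \<open>The delicate axiom is \<open>shift_dominated\<close>: the ratio
  \<open>w (Suc n) / w n\<close> may tend to zero, so \<open>v\<close> has to be a new weight. It is
  obtained by applying \<open>ex_weight_below\<close> to the reciprocals of the shifted
  weight.\<close>

lemma weight_family_formal: "weight_family {w. weight w}"
proof (unfold_locales, goal_cases)
  case (4 w)
  note W = weightD[of w]
  have "0 \<le> 1 / w (Suc n)" for n using 4 W(2) by (simp add: less_imp_le)
  from ex_weight_below[of "\<lambda>n. 1 / w (Suc n)", OF this] obtain v where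
    v: "weight v" "\<And>n. n \<ge> 1 \<Longrightarrow> v n * (1 / w (Suc n)) \<le> (1/2) ^ n" by blast
  \<comment> \<open>The summand \<open>1 / w 1\<close> serves \<open>n = 0\<close>, where
    \<open>v 0 = 1\<close>; for all other \<open>n\<close> the factor 1 is enough.\<close>
  have "v n \<le> (1 + 1 / w 1) * w (Suc n)" for n
  proof (cases "n = 0")
    case True
    have "0 < w 1" using 4 W(2) by simp
    then show ?thesis using True weightD(1)[OF v(1)] by (simp add: field_simps)
  next
    case False
    have p: "0 < w (Suc n)" "0 < w 1" using 4 W(2) by auto
    have "v n * (1 / w (Suc n)) \<le> 1"
      using v(2)[of n] False power_le_one[of "1/2 :: real" n] by auto
    then have "v n \<le> 1 * w (Suc n)" using p by (simp add: field_simps)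
    also have "\<dots> \<le> (1 + 1 / w 1) * w (Suc n)" using p by (intro mult_right_mono) auto
    finally show ?thesis .
  qed
  then show ?case using v(1) by blast
qed (auto intro: weight_power weight_mult)

section \<open>Linear equations\<close>

definition tdeg :: "nat \<times> nat \<times> nat \<Rightarrow> nat" where
  "tdeg = (\<lambda>(n, i, j). n + i + j)"

lemma tz_coeff_simps:
  "tz_coeff (f + g) x = tz_coeff f x + tz_coeff g x"
  "tz_coeff (\<Sum>k\<in>A. h k) x = (\<Sum>k\<in>A. tz_coeff (h k) x)"
  by (auto simp: tz_coeff_def fps_sum_nth split: prod.splits)

lemma tz_coeff_mult:
  "tz_coeff (f * g) (n, i, j) = (\<Sum>a=0..n. \<Sum>b=0..i. \<Sum>c=0..j.
     tz_coeff f (a, b, c) * tz_coeff g (n - a, i - b, j - c))"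
  by (simp add: tz_coeff_def fps_mult_nth fps_sum_nth)

lemma tz_coeff_mult_cong:
  assumes "\<And>y. tdeg y \<le> tdeg x \<Longrightarrow> tz_coeff g y = tz_coeff h y"
  shows "tz_coeff (f * g) x = tz_coeff (f * h) x"
proof (cases x)
  case (fields n i j)
  show ?thesis unfolding fields tz_coeff_mult
    by (intro sum.cong refl arg_cong2[where f = "(*)"] assms) (auto simp: tdeg_def fields)
qed

lemma tz_coeff_mult_cong_strict:
  assumes "\<And>y. tdeg y < tdeg x \<Longrightarrow> tz_coeff g y = tz_coeff h y" "tz_coeff f (0, 0, 0) = 0"
  shows "tz_coeff (f * g) x = tz_coeff (f * h) x"
proof (cases x)
  case (fields n i j)
  have "tz_coeff f (a, b, c) * tz_coeff g (n - a, i - b, j - c)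
      = tz_coeff f (a, b, c) * tz_coeff h (n - a, i - b, j - c)"
    if "a \<in> {0..n}" "b \<in> {0..i}" "c \<in> {0..j}" for a b c
  proof (cases "a = 0 \<and> b = 0 \<and> c = 0")
    case False
    then have "tz_coeff g (n - a, i - b, j - c) = tz_coeff h (n - a, i - b, j - c)"
      using that by (intro assms(1)) (auto simp: tdeg_def fields)
    then show ?thesis by simp
  qed (simp add: assms(2))
  then show ?thesis unfolding fields tz_coeff_mult by (intro sum.cong refl)
qed

text \<open>Causal operators make linear equations \<open>u = u0 + J (B u)\<close> uniquely solvable by recursion on
  the total degree. Integration is causal, and so is multiplication by a series without constant
  term, so the same argument gives solutions of linear differential equations and inverses.\<close>

definition causal :: "(tzser \<Rightarrow> tzser) \<Rightarrow> bool" where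
  "causal J \<longleftrightarrow> (\<forall>f g x. (\<forall>y. tdeg y < tdeg x \<longrightarrow> tz_coeff f y = tz_coeff g y) \<longrightarrow>
     tz_coeff (J f) x = tz_coeff (J g) x)"

definition tz_of_coeff :: "(nat \<times> nat \<times> nat \<Rightarrow> complex) \<Rightarrow> tzser" where
  "tz_of_coeff c = Abs_fps (\<lambda>n. Abs_fps (\<lambda>i. Abs_fps (\<lambda>j. c (n, i, j))))"

lemma tz_coeff_of_coeff [simp]: "tz_coeff (tz_of_coeff c) = c"
  by (auto simp: tz_of_coeff_def tz_coeff_def)

lemma causal_system_step:
  assumes J: "causal J"
    and xy: "\<And>l y. tdeg y < tdeg z \<Longrightarrow> tz_coeff (u l) y = tz_coeff (v l) y"
  shows "tz_coeff (u0 + J (\<Sum>l\<in>A. B l * u l)) z = tz_coeff (u0 + J (\<Sum>l\<in>A. B l * v l)) z"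
proof -
  have "tz_coeff (\<Sum>l\<in>A. B l * u l) y = tz_coeff (\<Sum>l\<in>A. B l * v l) y" if "tdeg y < tdeg z" for y
    unfolding tz_coeff_simps using that
    by (intro sum.cong refl tz_coeff_mult_cong xy) auto
  then have "tz_coeff (J (\<Sum>l\<in>A. B l * u l)) z = tz_coeff (J (\<Sum>l\<in>A. B l * v l)) z"
    using J unfolding causal_def by blast
  then show ?thesis unfolding tz_coeff_simps(1) by simp
qed

text \<open>The coefficients of all components form one family indexed by \<open>(k, x)\<close>, and
  the recursion on the total degree of \<open>x\<close> runs for all \<open>k\<close> at once. The
  index type \<open>unit\<close> gives scalar equations.\<close>

lemma causal_system_ex:
  fixes B :: "'k::finite \<Rightarrow> 'k \<Rightarrow> tzser"
  assumes "causal J"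
  shows "\<exists>u. \<forall>k. u k = u0 k + J (\<Sum>l\<in>UNIV. B k l * u l)"
proof -
  define F where "F c = (\<lambda>(k, x). tz_coeff (u0 k + J (\<Sum>l\<in>UNIV. B k l * tz_of_coeff (\<lambda>y. c (l, y)))) x)"
    for c :: "'k \<times> nat \<times> nat \<times> nat \<Rightarrow> complex"
  have "\<exists>c. F c = c"
  proof (rule causal_fixpoint_ex[where \<delta> = "\<lambda>(k, x). tdeg x"])
    fix c d :: "'k \<times> nat \<times> nat \<times> nat \<Rightarrow> complex"
      and i :: "'k \<times> nat \<times> nat \<times> nat"
    assume eq: "\<And>j. (case j of (k, x) \<Rightarrow> tdeg x) < (case i of (k, x) \<Rightarrow> tdeg x) \<Longrightarrow> c j = d j"
    show "F c i = F d i"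
    proof -
      obtain k x where i: "i = (k, x)" by (metis surj_pair)
      show ?thesis unfolding F_def i prod.case
        by (rule causal_system_step[OF assms]) (use eq i in auto)
    qed
  qed
  then obtain c where c: "F c = c" by blast
  define u where "u k = tz_of_coeff (\<lambda>y. c (k, y))" for k
  have "u k = u0 k + J (\<Sum>l\<in>UNIV. B k l * u l)" for k
  proof (rule tz_eqI)
    fix x
    have "tz_coeff (u k) x = F c (k, x)" by (simp add: u_def c)
    then show "tz_coeff (u k) x = tz_coeff (u0 k + J (\<Sum>l\<in>UNIV. B k l * u l)) x"
      by (simp add: F_def u_def)
  qed
  then show ?thesis by blast
qed

text \<open>Used with \<open>u0 = 0\<close>: the \<open>t1\<close>-derivative of a solution with
  data free of \<open>t1\<close> solves the homogeneous equation and hence vanishes.\<close>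

lemma causal_equation_unique:
  assumes J: "causal J" and u: "u = u0 + J (b * u)" and v: "v = u0 + J (b * v)"
  shows "u = v"
proof (rule tz_eqI)
  fix x show "tz_coeff u x = tz_coeff v x"
  proof (induction x rule: measure_induct_rule[of tdeg])
    case (less x)
    have "tz_coeff (u0 + J (\<Sum>l\<in>{()}. b * u)) x = tz_coeff (u0 + J (\<Sum>l\<in>{()}. b * v)) x"
      by (rule causal_system_step[OF J]) (use less in auto)
    then show ?case using u v by simp
  qed
qed

text \<open>Since \<open>u\<close> already exists and \<open>p\<close> takes real values, the
  right-hand term is at most half of the left-hand side and can be absorbed there. The resulting
  bound involves only \<open>u0\<close>, so it is uniform in the truncation.\<close>

lemma causal_system_bound:
  fixes B :: "'k::finite \<Rightarrow> 'k \<Rightarrow> tzser"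
  assumes u: "\<And>k. u k = u0 k + J (\<Sum>l\<in>UNIV. B k l * u l)"
    and p: "submult_seminorm p" and J: "\<And>f. p (J f) \<le> q * p f" and "q \<ge> 0"
    and B: "(\<Sum>k\<in>UNIV. \<Sum>l\<in>UNIV. p (B k l)) \<le> \<beta>" and q: "q * \<beta> \<le> 1/2"
  shows "(\<Sum>k\<in>UNIV. p (u k)) \<le> 2 * (\<Sum>k\<in>UNIV. p (u0 k))"
proof -
  note P = submult_seminormD[OF p]
  let ?U = "\<Sum>k\<in>UNIV. p (u k)"
  have U: "?U \<ge> 0" by (simp add: sum_nonneg P)
  have "p (u k) \<le> p (u0 k) + q * ((\<Sum>l\<in>UNIV. p (B k l)) * ?U)" for k
  proof -
    have "p (\<Sum>l\<in>UNIV. B k l * u l) \<le> (\<Sum>l\<in>UNIV. p (B k l * u l))"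
      by (rule submult_seminorm_sum[OF p])
    also have "\<dots> \<le> (\<Sum>l\<in>UNIV. p (B k l) * ?U)"
    proof (rule sum_mono)
      fix l
      have "p (u l) \<le> ?U" by (rule member_le_sum) (auto simp: P)
      then show "p (B k l * u l) \<le> p (B k l) * ?U"
        using P(5)[of "B k l" "u l"] P(2)[of "B k l"] by (meson mult_left_mono order_trans)
    qed
    finally have "p (J (\<Sum>l\<in>UNIV. B k l * u l)) \<le> q * ((\<Sum>l\<in>UNIV. p (B k l)) * ?U)"
      using J[of "\<Sum>l\<in>UNIV. B k l * u l"] \<open>q \<ge> 0\<close> unfolding sum_distrib_right
      by (elim order_trans) (intro mult_left_mono)
    then show ?thesis using u[of k] P(4)[of "u0 k" "J (\<Sum>l\<in>UNIV. B k l * u l)"] by simp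
  qed
  then have "?U \<le> (\<Sum>k\<in>UNIV. p (u0 k) + q * ((\<Sum>l\<in>UNIV. p (B k l)) * ?U))"
    by (rule sum_mono)
  also have "\<dots> = (\<Sum>k\<in>UNIV. p (u0 k)) + q * (\<Sum>k\<in>UNIV. \<Sum>l\<in>UNIV. p (B k l)) * ?U"
  proof -
    have "(\<Sum>k\<in>A. a k + q * (b k * U)) = (\<Sum>k\<in>A. a k) + q * (\<Sum>k\<in>A. b k) * U"
      for a b and U :: real and A :: "'k set"
      by (simp add: sum.distrib sum_distrib_left sum_distrib_right mult.assoc)
    then show ?thesis .
  qed
  also have "q * (\<Sum>k\<in>UNIV. \<Sum>l\<in>UNIV. p (B k l)) * ?U \<le> (1/2) * ?U"
    using B q U \<open>q \<ge> 0\<close> by (intro mult_right_mono) (meson mult_left_mono order_trans)+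
  finally show ?thesis by simp
qed

text \<open>The antiderivative that vanishes at \<open>t1 = 0\<close>. With \<open>u0\<close> free
  of \<open>t1\<close>, the equation \<open>u = u0 + int1 g\<close> encodes a differential equation
  together with its initial value.\<close>

definition int1 :: "tzser \<Rightarrow> tzser" where
  "int1 f = Abs_fps (\<lambda>n. Abs_fps (\<lambda>i. if i = 0 then 0
     else fps_const (1 / of_nat i) * fps_nth (fps_nth f n) (i - 1)))"

definition int2 :: "tzser \<Rightarrow> tzser" where
  "int2 f = Abs_fps (\<lambda>n. Abs_fps (\<lambda>i. Abs_fps (\<lambda>j. if j = 0 then 0
     else fps_nth (fps_nth (fps_nth f n) i) (j - 1) / of_nat j)))"

lemma causal_int1: "causal int1"
  unfolding causal_def
proof (intro allI impI)
  fix f g x assume eq: "\<forall>y. tdeg y < tdeg x \<longrightarrow> tz_coeff f y = tz_coeff g y"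
  obtain n i j where x: "x = (n, i, j)" by (cases x)
  show "tz_coeff (int1 f) x = tz_coeff (int1 g) x"
    using eq[rule_format, of "(n, i - 1, j)"]
    by (cases i) (auto simp: x tdeg_def tz_coeff_def int1_def)
qed

lemma causal_int2: "causal int2"
  unfolding causal_def
proof (intro allI impI)
  fix f g x assume eq: "\<forall>y. tdeg y < tdeg x \<longrightarrow> tz_coeff f y = tz_coeff g y"
  obtain n i j where x: "x = (n, i, j)" by (cases x)
  show "tz_coeff (int2 f) x = tz_coeff (int2 g) x"
    using eq[rule_format, of "(n, i, j - 1)"]
    by (cases j) (auto simp: x tdeg_def tz_coeff_def int2_def)
qed

lemma fps_trunc_norm_cmult_le:
  assumes "norm c \<le> 1" "0 \<le> r"
  shows "fps_trunc_norm N (\<lambda>j. r ^ j) norm (fps_const c * a)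
    \<le> fps_trunc_norm N (\<lambda>j. r ^ j) norm (a :: complex fps)"
proof -
  have "norm c * norm (fps_nth a j) \<le> norm (fps_nth a j)" for j
    using assms mult_right_mono[of "norm c" 1 "norm (fps_nth a j)"] by simp
  then show ?thesis unfolding fps_trunc_norm_def using assms
    by (intro sum_mono mult_left_mono) (auto simp: norm_mult)
qed

lemma tz_norm_int1:
  assumes "weight w" "0 < r" "r \<le> 1"
  shows "tz_norm N w r (int1 f) \<le> r * tz_norm N w r f"
  unfolding tz_norm_def
proof (rule fps_trunc_norm_mono)
  fix n
  note P = submult_seminormD[OF submult_seminorm_fps_trunc_norm[OF submult_seminorm_norm
      weight_power[OF assms(2,3)]]]
  have "fps_trunc_norm N (\<lambda>i. r ^ i) (fps_trunc_norm N (\<lambda>j. r ^ j) norm) (fps_nth (int1 f) n)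
      \<le> r * fps_trunc_norm N (\<lambda>i. r ^ i) (fps_trunc_norm N (\<lambda>j. r ^ j) norm) (fps_nth f n)"
  proof (rule fps_trunc_norm_shift_le)
    fix i
    have "norm (1 / of_nat (Suc i) :: complex) \<le> 1"
      by (simp add: norm_divide del: of_nat_Suc)
    then show "fps_trunc_norm N (\<lambda>j. r ^ j) norm (fps_nth (fps_nth (int1 f) n) (Suc i))
        \<le> fps_trunc_norm N (\<lambda>j. r ^ j) norm (fps_nth (fps_nth f n) i)"
      using fps_trunc_norm_cmult_le assms unfolding int1_def by simp
  qed (use assms in \<open>auto simp: P int1_def\<close>)
  then show "w n * fps_trunc_norm N (\<lambda>i. r ^ i) (fps_trunc_norm N (\<lambda>j. r ^ j) norm) (fps_nth (int1 f) n)
      \<le> r * (w n * fps_trunc_norm N (\<lambda>i. r ^ i) (fps_trunc_norm N (\<lambda>j. r ^ j) norm) (fps_nth f n))"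
    using weightD(3)[OF assms(1), of n] by (metis mult.left_commute mult_left_mono)
qed

lemma tz_norm_int2:
  assumes "weight w" "0 < r" "r \<le> 1"
  shows "tz_norm N w r (int2 f) \<le> r * tz_norm N w r f"
  unfolding tz_norm_def
proof (rule fps_trunc_norm_mono)
  fix n
  have 1: "fps_trunc_norm N (\<lambda>j. r ^ j) norm (fps_nth (fps_nth (int2 f) n) i)
      \<le> r * fps_trunc_norm N (\<lambda>j. r ^ j) norm (fps_nth (fps_nth f n) i)" for i
  proof (rule fps_trunc_norm_shift_le)
    fix j
    have "norm (fps_nth (fps_nth (fps_nth f n) i) j) / of_nat (Suc j)
        \<le> norm (fps_nth (fps_nth (fps_nth f n) i) j)"
      using mult_left_mono[of 1 "real (Suc j)" "norm (fps_nth (fps_nth (fps_nth f n) i) j)"]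
      by (simp add: field_simps)
    then show "norm (fps_nth (fps_nth (fps_nth (int2 f) n) i) (Suc j))
        \<le> norm (fps_nth (fps_nth (fps_nth f n) i) j)"
      by (simp add: int2_def norm_divide del: of_nat_Suc)
  qed (use assms in \<open>auto simp: int2_def\<close>)
  have "fps_trunc_norm N (\<lambda>i. r ^ i) (fps_trunc_norm N (\<lambda>j. r ^ j) norm) (fps_nth (int2 f) n)
      \<le> r * fps_trunc_norm N (\<lambda>i. r ^ i) (fps_trunc_norm N (\<lambda>j. r ^ j) norm) (fps_nth f n)"
  proof (rule fps_trunc_norm_mono)
    fix i
    show "r ^ i * fps_trunc_norm N (\<lambda>j. r ^ j) norm (fps_nth (fps_nth (int2 f) n) i)
        \<le> r * (r ^ i * fps_trunc_norm N (\<lambda>j. r ^ j) norm (fps_nth (fps_nth f n) i))"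
      using 1[of i] assms by (metis mult.left_commute mult_left_mono less_imp_le zero_le_power)
  qed
  then show "w n * fps_trunc_norm N (\<lambda>i. r ^ i) (fps_trunc_norm N (\<lambda>j. r ^ j) norm) (fps_nth (int2 f) n)
      \<le> r * (w n * fps_trunc_norm N (\<lambda>i. r ^ i) (fps_trunc_norm N (\<lambda>j. r ^ j) norm) (fps_nth f n))"
    using weightD(3)[OF assms(1), of n] by (metis mult.left_commute mult_left_mono)
qed

text \<open>Substitution of \<open>t1 = 0\<close>, with the value kept in the ring of all
  series.\<close>

definition restrict1 :: "tzser \<Rightarrow> tzser" where
  "restrict1 f = Abs_fps (\<lambda>n. fps_const (fps_nth (fps_nth f n) 0))"

section \<open>Closure properties of the rings\<close>

context weight_family
begin

abbreviation R :: "tzser set" where "R \<equiv> series_ring W"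

lemma R_I: "w \<in> W \<Longrightarrow> 0 < r \<Longrightarrow> r \<le> 1 \<Longrightarrow> tz_bounded w r f \<Longrightarrow> f \<in> R"
  by (auto simp: series_ring_def)

text \<open>Multiplying the weights and taking the smaller radius preserves the bounds already
  achieved, so ring operations can be estimated in a single norm.\<close>

lemma R_common_weight:
  assumes "finite A" "A \<subseteq> R"
  shows "\<exists>w\<in>W. \<exists>r. 0 < r \<and> r \<le> 1 \<and> (\<forall>f\<in>A. tz_bounded w r f)"
  using assms
proof (induction rule: finite_induct)
  case empty
  show ?case using geometric[of 1] by (auto intro!: bexI[of _ "\<lambda>n. 1 ^ n"] exI[of _ "1::real"])
next
  case (insert f A)
  then obtain w r where 1: "w \<in> W" "0 < r" "r \<le> 1" "\<And>g. g \<in> A \<Longrightarrow> tz_bounded w r g" by auto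
  from insert obtain v s where 2: "v \<in> W" "0 < s" "s \<le> 1" "tz_bounded v s f"
    by (auto simp: series_ring_def)
  let ?w = "\<lambda>n. w n * v n" and ?r = "min r s"
  note W = weightD[OF weight[OF 1(1)]] weightD[OF weight[OF 2(1)]]
  have w: "?w \<in> W" using mult_closed 1 2 by blast
  have le: "?w n \<le> w n" "?w n \<le> v n" for n
    using W(4)[of n] W(9)[of n] W(3)[of n] W(8)[of n]
    by (auto simp: mult_left_le mult_left_le_one_le)
  have "tz_bounded ?w ?r g" if "g \<in> insert f A" for g
  proof (cases "g = f")
    case True
    then show ?thesis using tz_bounded_mono[of v s f ?w ?r] weight w 1 2 le by auto
  next
    case False
    then show ?thesis using tz_bounded_mono[of w r g ?w ?r] weight w 1 2 le that by auto
  qed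
  then show ?case using w 1 2 by (intro bexI[OF _ w] exI[of _ ?r]) auto
qed

lemma R_common2:
  assumes "f \<in> R" "g \<in> R"
  obtains w r C D where "w \<in> W" "0 < r" "r \<le> 1" "\<And>N. submult_seminorm (tz_norm N w r)" "\<And>N. tz_norm N w r f \<le> C" "\<And>N. tz_norm N w r g \<le> D"
proof -
  obtain w r where *: "w \<in> W" "0 < r" "r \<le> 1" "tz_bounded w r f" "tz_bounded w r g"
    using R_common_weight[of "{f, g}"] assms by auto
  then show ?thesis using that tz_norm_seminorm[OF weight] unfolding tz_bounded_def by metis
qed

lemma R_add [intro]: assumes "f \<in> R" "g \<in> R" shows "f + g \<in> R"
proof -
  obtain w r C D where *: "w \<in> W" "0 < r" "r \<le> 1" "\<And>N. submult_seminorm (tz_norm N w r)"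
    "\<And>N. tz_norm N w r f \<le> C" "\<And>N. tz_norm N w r g \<le> D" using R_common2[OF assms] by metis
  have "tz_norm N w r (f + g) \<le> C + D" for N
    using submult_seminormD(4)[OF *(4), of N f g] *(5,6)[of N] by linarith
  then show ?thesis using * by (intro R_I[of w r]) (auto simp: tz_bounded_def)
qed

lemma R_mult [intro]: assumes "f \<in> R" "g \<in> R" shows "f * g \<in> R"
proof -
  obtain w r C D where *: "w \<in> W" "0 < r" "r \<le> 1" "\<And>N. submult_seminorm (tz_norm N w r)"
    "\<And>N. tz_norm N w r f \<le> C" "\<And>N. tz_norm N w r g \<le> D" using R_common2[OF assms] by metis
  have "tz_norm N w r (f * g) \<le> C * D" for N
  proof -
    note P = submult_seminormD[OF *(4)[of N]]
    have "tz_norm N w r f * tz_norm N w r g \<le> C * D"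
      using *(5,6)[of N] P(2)[of f] P(2)[of g] by (intro mult_mono) auto
    then show ?thesis using P(5)[of f g] by linarith
  qed
  then show ?thesis using * by (intro R_I[of w r]) (auto simp: tz_bounded_def)
qed

lemma R_uminus [intro]: assumes "f \<in> R" shows "- f \<in> R"
proof -
  obtain w r C where *: "w \<in> W" "0 < r" "r \<le> 1" "\<And>N. submult_seminorm (tz_norm N w r)"
    "\<And>N. tz_norm N w r f \<le> C" using R_common2[OF assms assms] by metis
  then have "tz_norm N w r (- f) \<le> C" for N using submult_seminormD(3) by metis
  then show ?thesis using * by (intro R_I[of w r]) (auto simp: tz_bounded_def)
qed

lemma R_diff [intro]: "f \<in> R \<Longrightarrow> g \<in> R \<Longrightarrow> f - g \<in> R"
  using R_add[of f "- g"] R_uminus by simp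

text \<open>Common core of the closure under \<open>d2\<close>, \<open>restrict1\<close> and
  \<open>fps_shift\<close>. Halving the radius pays for the numerical factor of a derivative, and
  \<open>1 / r\<close> pays for the shifted exponent.\<close>

lemma R_transfer:
  assumes "f \<in> R" "inj_on \<phi> A"
    "\<And>w. w \<in> W \<Longrightarrow> \<exists>v\<in>W. \<exists>c\<ge>0. \<forall>r x. 0 < r \<longrightarrow> r \<le> 1 \<longrightarrow> x \<in> A \<longrightarrow>
       tz_weight v (r / 2) x * norm (tz_coeff g x) \<le> (c / r) * (tz_weight w r (\<phi> x) * norm (tz_coeff f (\<phi> x)))"
    "\<And>x. x \<notin> A \<Longrightarrow> tz_coeff g x = 0"
  shows "g \<in> R"
proof -
  obtain w r where 1: "w \<in> W" "0 < r" "r \<le> 1" "tz_bounded w r f"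
    using assms(1) by (auto simp: series_ring_def)
  then obtain v c where 2: "v \<in> W" "c \<ge> 0"
    "\<And>x. x \<in> A \<Longrightarrow> tz_weight v (r / 2) x * norm (tz_coeff g x)
        \<le> (c / r) * (tz_weight w r (\<phi> x) * norm (tz_coeff f (\<phi> x)))"
    using assms(3)[of w] by blast
  have "tz_bounded v (r / 2) g"
    by (rule tz_bounded_transfer[of w r f v "r / 2" \<phi> A "c / r"])
      (use 1 2 assms weight in auto)
  then show ?thesis using 1 2 by (intro R_I[of v "r / 2"]) auto
qed

lemma R_d2 [intro]: assumes "f \<in> R" shows "d2 f \<in> R"
proof (rule R_transfer[where \<phi> = "\<lambda>(n, i, j). (n, i, Suc j)" and A = UNIV, OF assms])
  fix w assume w: "w \<in> W"
  have "tz_weight w (r / 2) x * norm (tz_coeff (d2 f) x)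
      \<le> (1 / r) * (tz_weight w r (case x of (n, i, j) \<Rightarrow> (n, i, Suc j))
           * norm (tz_coeff f (case x of (n, i, j) \<Rightarrow> (n, i, Suc j))))"
    if r: "0 < r" "r \<le> 1" for r :: real and x
  proof -
    obtain n i j where x: "x = (n, i, j)" by (cases x)
    \<comment> \<open>The factor \<open>j + 1\<close> from differentiation is outweighed by the
      powers of 2 gained from the halved radius.\<close>
    have "real (Suc j) \<le> 2 ^ j"
      by (induction j) (auto simp: field_simps)
    then have "real (Suc j) \<le> 2 ^ i * 2 ^ j"
      using mult_mono[of 1 "2 ^ i :: real" "real (Suc j)" "2 ^ j"] by simp
    then have "(r / 2) ^ i * (r / 2) ^ j * real (Suc j) \<le> r ^ i * r ^ j"
      using r mult_left_mono[of "real (Suc j)" "2 ^ i * 2 ^ j" "r ^ i * r ^ j"]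
      by (simp add: power_divide divide_le_eq mult_ac del: of_nat_Suc)
    then have "(w n * norm (fps_nth (fps_nth (fps_nth f n) i) (Suc j))) * ((r / 2) ^ i * (r / 2) ^ j * real (Suc j))
        \<le> (w n * norm (fps_nth (fps_nth (fps_nth f n) i) (Suc j))) * (r ^ i * r ^ j)"
      using weightD(3)[OF weight[OF w]] by (intro mult_left_mono) auto
    then show ?thesis using r
      by (simp add: x tz_weight_def tz_coeff_def d2_def norm_mult ac_simps del: of_nat_Suc)
  qed
  then show "\<exists>v\<in>W. \<exists>c\<ge>0. \<forall>r x. 0 < r \<longrightarrow> r \<le> 1 \<longrightarrow> x \<in> UNIV \<longrightarrow>
       tz_weight v (r / 2) x * norm (tz_coeff (d2 f) x)
       \<le> (c / r) * (tz_weight w r (case x of (n, i, j) \<Rightarrow> (n, i, Suc j))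
           * norm (tz_coeff f (case x of (n, i, j) \<Rightarrow> (n, i, Suc j))))"
    using w by (intro bexI[OF _ w] exI[of _ 1]) auto
qed (auto simp: inj_on_def)

lemma half_weight_le:
  assumes "w \<in> W" "0 < r" "r \<le> 1" "0 \<le> a"
  shows "w n * (r / 2) ^ i * (r / 2) ^ j * a \<le> (1 / r) * (w n * r ^ i * r ^ j * a)"
proof -
  have "w n * (r / 2) ^ i * (r / 2) ^ j * a \<le> w n * r ^ i * r ^ j * a"
    using assms weightD(3)[OF weight[OF assms(1)], of n]
    by (intro mult_mono power_mono) (auto intro!: mult_nonneg_nonneg)
  also have "\<dots> \<le> (1 / r) * (w n * r ^ i * r ^ j * a)"
    using assms weightD(3)[OF weight[OF assms(1)], of n]
      mult_right_mono[of 1 "1 / r" "w n * r ^ i * r ^ j * a"] by simp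
  finally show ?thesis .
qed

lemma R_restrict1 [intro]: assumes "f \<in> R" shows "restrict1 f \<in> R"
proof (rule R_transfer[where \<phi> = "\<lambda>x. x" and A = UNIV, OF assms])
  fix w assume w: "w \<in> W"
  have "tz_weight w (r / 2) x * norm (tz_coeff (restrict1 f) x)
      \<le> (1 / r) * (tz_weight w r x * norm (tz_coeff f x))"
    if r: "0 < r" "r \<le> 1" for r :: real and x
  proof -
    obtain n i j where x: "x = (n, i, j)" by (cases x)
    have "norm (tz_coeff (restrict1 f) x) \<le> norm (tz_coeff f x)"
      by (simp add: x restrict1_def tz_coeff_def)
    then have "tz_weight w (r / 2) x * norm (tz_coeff (restrict1 f) x) \<le> tz_weight w (r / 2) x * norm (tz_coeff f x)"
      using r weightD(3)[OF weight[OF w]] by (intro mult_left_mono) (auto simp: x tz_weight_def)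
    also have "\<dots> \<le> (1 / r) * (tz_weight w r x * norm (tz_coeff f x))"
      using half_weight_le[OF w r, of "norm (tz_coeff f x)" n i j] by (simp add: x tz_weight_def)
    finally show ?thesis .
  qed
  then show "\<exists>v\<in>W. \<exists>c\<ge>0. \<forall>r x. 0 < r \<longrightarrow> r \<le> 1 \<longrightarrow> x \<in> UNIV \<longrightarrow>
      tz_weight v (r / 2) x * norm (tz_coeff (restrict1 f) x)
      \<le> (c / r) * (tz_weight w r x * norm (tz_coeff f x))"
    by (intro bexI[OF _ w] exI[of _ 1]) auto
qed (auto simp: inj_on_def)

lemma R_shift [intro]: assumes "f \<in> R" shows "fps_shift 1 f \<in> R"
proof (rule R_transfer[where \<phi> = "\<lambda>(n, i, j). (Suc n, i, j)" and A = UNIV, OF assms])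
  fix w assume w: "w \<in> W"
  then obtain v c where v: "v \<in> W" "\<And>n. v n \<le> c * w (Suc n)" using shift_dominated by blast
  have "0 < v 0" "0 < w (Suc 0)" using v w weightD(2)[OF weight] by auto
  then have c: "c \<ge> 0" using v(2)[of 0] by (smt (verit) mult_nonpos_nonneg)
  have "tz_weight v (r / 2) x * norm (tz_coeff (fps_shift 1 f) x)
      \<le> (c / r) * (tz_weight w r (case x of (n, i, j) \<Rightarrow> (Suc n, i, j))
           * norm (tz_coeff f (case x of (n, i, j) \<Rightarrow> (Suc n, i, j))))"
    if r: "0 < r" "r \<le> 1" for r :: real and x
  proof -
    obtain n i j where x: "x = (n, i, j)" by (cases x)
    let ?a = "norm (tz_coeff f (Suc n, i, j))"
    have "v n * (r / 2) ^ i * (r / 2) ^ j * ?a \<le> (1 / r) * (v n * r ^ i * r ^ j * ?a)"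
      by (rule half_weight_le[OF v(1) r]) auto
    also have "\<dots> \<le> (1 / r) * (c * w (Suc n) * r ^ i * r ^ j * ?a)"
      using v(2)[of n] r by (intro mult_left_mono mult_right_mono) auto
    finally show ?thesis by (simp add: x tz_weight_def tz_coeff_def mult_ac)
  qed
  then show "\<exists>v\<in>W. \<exists>c\<ge>0. \<forall>r x. 0 < r \<longrightarrow> r \<le> 1 \<longrightarrow> x \<in> UNIV \<longrightarrow>
       tz_weight v (r / 2) x * norm (tz_coeff (fps_shift 1 f) x)
       \<le> (c / r) * (tz_weight w r (case x of (n, i, j) \<Rightarrow> (Suc n, i, j))
           * norm (tz_coeff f (case x of (n, i, j) \<Rightarrow> (Suc n, i, j))))"
    using c by (intro bexI[OF _ v(1)] exI[of _ c]) auto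
qed (auto simp: inj_on_def)

lemma R_nth_0: "f \<in> R \<Longrightarrow> fps_nth f 0 \<in> Ct"
  unfolding series_ring_def Ct_def using tz_bounded_imp_converges_t weight by blast

lemma R_fps_const [intro]: assumes "a \<in> Ct" shows "fps_const a \<in> R"
proof -
  obtain r where r: "r > 0" "converges_t r a" using assms by (auto simp: Ct_def)
  define s where "s = min (1/2) (r/2)"
  have s: "0 < s" "s < r" "s \<le> 1" using r by (auto simp: s_def)
  obtain C where "C \<ge> 0"
    and C: "\<And>N. fps_trunc_norm N (\<lambda>i. s ^ i) (fps_trunc_norm N (\<lambda>j. s ^ j) norm) a \<le> C"
    using converges_t_imp_bounded[OF r(2) s(1,2)] by blast
  have "tz_norm N (\<lambda>n. 1 ^ n) s (fps_const a) \<le> C" for N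
  proof -
    have z: "fps_trunc_norm N (\<lambda>i. s ^ i) (fps_trunc_norm N (\<lambda>j. s ^ j) norm) (0 :: tser) = 0"
      by (simp add: fps_trunc_norm_def)
    have "tz_norm N (\<lambda>n. 1 ^ n) s (fps_const a)
      = (\<Sum>n\<le>N. if n = 0 then fps_trunc_norm N (\<lambda>i. s ^ i) (fps_trunc_norm N (\<lambda>j. s ^ j) norm) a else 0)"
      unfolding tz_norm_def fps_trunc_norm_def[of N "\<lambda>n. 1 ^ n"] using z by (intro sum.cong) auto
    then show ?thesis using C[of N] by simp
  qed
  then show ?thesis using geometric[of 1] s by (intro R_I[of "\<lambda>n. 1 ^ n" s]) (auto simp: tz_bounded_def)
qed

end

lemma tz_norm_mono:
  assumes "weight w" "0 < r'" "r' \<le> r"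
  shows "tz_norm N w r' f \<le> tz_norm N w r f"
  unfolding tz_norm_conv_sum
proof (rule sum_mono)
  fix x :: "nat \<times> nat \<times> nat"
  obtain n i j where x: "x = (n, i, j)" by (cases x)
  show "tz_weight w r' x * norm (tz_coeff f x) \<le> tz_weight w r x * norm (tz_coeff f x)"
    unfolding x tz_weight_def prod.case using assms weightD(3)[OF assms(1)]
    by (intro mult_right_mono mult_mono power_mono mult_nonneg_nonneg zero_le_power) auto
qed

lemma converges_t_fps_const:
  assumes "ereal r \<le> fps_conv_radius a"
  shows "converges_t r (fps_const a)"
  unfolding converges_t_def
proof (intro allI impI, elim conjE)
  fix t1 t2 :: complex assume t: "norm t2 < r"
  have "ereal (norm t2) < fps_conv_radius a" using t assms by (metis less_ereal.simps(1) order_less_le_trans)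
  then have s: "summable (\<lambda>j. norm (fps_nth a j * t2 ^ j))"
    unfolding fps_conv_radius_def by (rule abs_summable_in_conv_radius)
  let ?f = "\<lambda>(i, j). fps_nth (fps_nth (fps_const a) i) j * t1 ^ i * t2 ^ j"
  have "(\<Sum>x\<in>F. norm (?f x)) \<le> (\<Sum>j. norm (fps_nth a j * t2 ^ j))" if "finite F" for F
  proof -
    have "(\<Sum>x\<in>F. norm (?f x)) = (\<Sum>x\<in>F \<inter> {0} \<times> UNIV. norm (?f x))"
      using that by (intro sum.mono_neutral_right) (auto split: if_splits)
    also have "\<dots> = (\<Sum>j\<in>snd ` (F \<inter> {0} \<times> UNIV). norm (fps_nth a j * t2 ^ j))"
      by (subst sum.reindex) (auto simp: inj_on_def intro!: sum.cong)
    also have "\<dots> \<le> (\<Sum>j. norm (fps_nth a j * t2 ^ j))"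
      using s that by (intro sum_le_suminf) auto
    finally show ?thesis .
  qed
  then show "?f summable_on UNIV" unfolding summable_on_complex_iff_bounded by blast
qed

lemma fps_const_in_Ct:
  assumes "fps_conv_radius a > 0" shows "fps_const a \<in> Ct"
proof -
  obtain r where "0 < ereal r" "ereal r < fps_conv_radius a" using ereal_dense2[OF assms] by blast
  then show ?thesis using converges_t_fps_const[of r a] by (auto simp: Ct_def)
qed

section \<open>Linear systems and inverses inside the rings\<close>

definition cst :: "complex \<Rightarrow> tzser" where
  "cst c = fps_const (fps_const (fps_const c))"

context weight_family
begin

lemma R_cst [intro]: "cst c \<in> R"
  unfolding cst_def by (intro R_fps_const fps_const_in_Ct) simp

lemma R_1 [intro]: "1 \<in> R" using R_cst[of 1] by (simp add: cst_def)

lemma R_0 [intro]: "0 \<in> R" using R_cst[of 0] by (simp add: cst_def)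

lemma R_X [intro]: "fps_X \<in> R"
proof -
  have "tz_norm N (\<lambda>n. 1 ^ n) 1 fps_X \<le> 1" for N
  proof -
    have "tz_norm N (\<lambda>n. 1 ^ n) 1 fps_X = (\<Sum>x\<in>{..N} \<times> {..N} \<times> {..N}. if x = (1, 0, 0) then 1 else 0)"
      unfolding tz_norm_conv_sum by (intro sum.cong) (auto simp: tz_weight_def tz_coeff_def fps_X_def split: if_splits)
    then show ?thesis by simp
  qed
  then show ?thesis using geometric[of 1] by (intro R_I[of "\<lambda>n. 1 ^ n" 1]) (auto simp: tz_bounded_def)
qed

text \<open>Shrinking the radius in \<open>t\<close> makes \<open>J\<close> as small as desired
  while the bounds on \<open>B\<close> persist, so the system becomes contracting. The weight in
  \<open>z\<close> stays untouched, which is why the argument does not distinguish the two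
  rings.\<close>

lemma R_linear_system:
  fixes B :: "'k::finite \<Rightarrow> 'k \<Rightarrow> tzser"
  assumes J: "causal J"
    "\<And>N w r f. weight w \<Longrightarrow> 0 < r \<Longrightarrow> r \<le> 1 \<Longrightarrow> tz_norm N w r (J f) \<le> r * tz_norm N w r f"
    and R: "\<And>k. u0 k \<in> R" "\<And>k l. B k l \<in> R"
  shows "\<exists>u. (\<forall>k. u k \<in> R) \<and> (\<forall>k. u k = u0 k + J (\<Sum>l\<in>UNIV. B k l * u l))"
proof -
  obtain u where u: "\<And>k. u k = u0 k + J (\<Sum>l\<in>UNIV. B k l * u l)"
    using causal_system_ex[OF J(1)] by metis
  let ?A = "range u0 \<union> range (\<lambda>(k, l). B k l)"
  obtain w r where w: "w \<in> W" "0 < r" "r \<le> 1" "\<And>f. f \<in> ?A \<Longrightarrow> tz_bounded w r f"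
    using R_common_weight[of ?A] R by fastforce
  then obtain c where c: "\<And>f N. f \<in> ?A \<Longrightarrow> tz_norm N w r f \<le> c f"
    unfolding tz_bounded_def by metis
  have c0: "0 \<le> c f" if "f \<in> ?A" for f
    using c[OF that, of 0] submult_seminormD(2)[OF tz_norm_seminorm[OF weight[OF w(1)] w(2,3)], of 0 f]
    by linarith
  define \<beta> where "\<beta> = (\<Sum>k\<in>UNIV. \<Sum>l\<in>UNIV. c (B k l))"
  have "\<beta> \<ge> 0" unfolding \<beta>_def by (intro sum_nonneg c0) force
  \<comment> \<open>Adding 1 in the denominator covers \<open>\<beta> = 0\<close> and still gives
    \<open>s * \<beta> \<le> 1/2\<close>.\<close>
  define s where "s = min r (1 / (2 * \<beta> + 1))"
  have s: "0 < s" "s \<le> r" "s \<le> 1" using w \<open>\<beta> \<ge> 0\<close> by (auto simp: s_def)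
  have "s * \<beta> \<le> 1 / (2 * \<beta> + 1) * \<beta>" using \<open>\<beta> \<ge> 0\<close> by (intro mult_right_mono) (auto simp: s_def)
  also have "\<dots> \<le> 1 / 2" using \<open>\<beta> \<ge> 0\<close> by (simp add: field_simps)
  finally have sb: "s * \<beta> \<le> 1 / 2" .
  have le: "tz_norm N w s f \<le> c f" if "f \<in> ?A" for N f
    using tz_norm_mono[OF weight[OF w(1)] s(1,2), of N f] c[OF that, of N] by linarith
  have "tz_norm N w s (u k) \<le> 2 * (\<Sum>k\<in>UNIV. c (u0 k))" for N k
  proof -
    have p: "submult_seminorm (tz_norm N w s)" by (rule tz_norm_seminorm[OF weight[OF w(1)] s(1,3)])
    have "tz_norm N w s (u k) \<le> (\<Sum>k\<in>UNIV. tz_norm N w s (u k))"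
      by (rule member_le_sum) (auto simp: submult_seminormD[OF p])
    also have "\<dots> \<le> 2 * (\<Sum>k\<in>UNIV. tz_norm N w s (u0 k))"
    proof (rule causal_system_bound[where J = J and B = B, OF u p _ _ _ sb])
      show "tz_norm N w s (J f) \<le> s * tz_norm N w s f" for f
        by (rule J(2)[OF weight[OF w(1)] s(1,3)])
      show "(\<Sum>k\<in>UNIV. \<Sum>l\<in>UNIV. tz_norm N w s (B k l)) \<le> \<beta>"
        unfolding \<beta>_def by (intro sum_mono le) force
    qed (use s in auto)
    also have "\<dots> \<le> 2 * (\<Sum>k\<in>UNIV. c (u0 k))" by (intro mult_left_mono sum_mono le) auto
    finally show ?thesis .
  qed
  then have "u k \<in> R" for k using w(1) s by (intro R_I[of w s]) (auto simp: tz_bounded_def)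
  then show ?thesis using u by blast
qed

text \<open>Scaling \<open>t1\<close>, \<open>t2\<close> and \<open>z\<close> by \<open>s\<close>
  multiplies every coefficient of positive total degree by at most \<open>s\<close>, and the
  constant term is absent.\<close>

lemma R_small_norm:
  assumes "u \<in> R" "tz_coeff u (0, 0, 0) = 0"
  obtains w r where "w \<in> W" "0 < r" "r \<le> 1" "\<And>N. tz_norm N w r u \<le> 1 / 2"
proof -
  obtain w r C where w: "w \<in> W" "0 < r" "r \<le> 1" "\<And>N. submult_seminorm (tz_norm N w r)"
    "\<And>N. tz_norm N w r u \<le> C" using R_common2[OF assms(1) assms(1)] by metis
  have C: "C \<ge> 0" using w(5)[of 0] submult_seminormD(2)[OF w(4), of 0 u] by linarith
  define s where "s = 1 / (2 * C + 1)"
  have s: "0 < s" "s \<le> 1" using C by (auto simp: s_def)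
  let ?w = "\<lambda>n. s ^ n * w n"
  have "tz_norm N ?w (s * r) u \<le> 1 / 2" for N
  proof -
    have "tz_norm N ?w (s * r) u \<le> s * tz_norm N w r u"
      unfolding tz_norm_conv_sum sum_distrib_left
    proof (rule sum_mono)
      fix x :: "nat \<times> nat \<times> nat"
      obtain n i j where x: "x = (n, i, j)" by (cases x)
      show "tz_weight ?w (s * r) x * norm (tz_coeff u x) \<le> s * (tz_weight w r x * norm (tz_coeff u x))"
      proof (cases "x = (0, 0, 0)")
        case True
        then show ?thesis using assms(2) by simp
      next
        case False
        then have "s ^ (n + i + j) \<le> s ^ 1" using s x by (intro power_decreasing) auto
        then have "s ^ (n + i + j) * (w n * r ^ i * r ^ j * norm (tz_coeff u x))
            \<le> s ^ 1 * (w n * r ^ i * r ^ j * norm (tz_coeff u x))"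
          using w weightD(3)[OF weight[OF w(1)]] by (intro mult_right_mono) auto
        then show ?thesis by (simp add: x tz_weight_def power_add power_mult_distrib mult_ac)
      qed
    qed
    also have "\<dots> \<le> s * C" using s w(5) by (intro mult_left_mono) auto
    also have "\<dots> \<le> 1 / 2" using C by (simp add: s_def field_simps)
    finally show ?thesis .
  qed
  moreover have "?w \<in> W" using mult_closed[OF geometric[OF s] w(1)] .
  ultimately show ?thesis using that[of ?w "s * r"] s w by (auto simp: mult_le_one)
qed

text \<open>With \<open>c * f = 1 - u\<close> the inverse is a geometric series in \<open>u\<close>.
  It arises as the solution of the causal equation \<open>v = 1 + u * v\<close> and is bounded in a
  norm in which \<open>u\<close> has size at most 1/2.\<close>

lemma R_inverse:
  assumes f: "f \<in> R" "tz_coeff f (0, 0, 0) \<noteq> 0"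
  shows "\<exists>g\<in>R. f * g = 1"
proof -
  define c where "c = cst (1 / tz_coeff f (0, 0, 0))"
  define u where "u = 1 - c * f"
  have uR: "u \<in> R" unfolding u_def c_def using f by auto
  have u0: "tz_coeff u (0, 0, 0) = 0" using f(2) by (simp add: u_def c_def cst_def tz_coeff_def)
  have J: "causal (\<lambda>g. u * g)" unfolding causal_def using tz_coeff_mult_cong_strict u0 by blast
  obtain v where "\<forall>k::unit. v k = 1 + u * (\<Sum>l\<in>UNIV. 1 * v l)"
    using causal_system_ex[OF J, of "\<lambda>_. 1" "\<lambda>_ _. 1"] by blast
  then have v: "v () = 1 + u * v ()" by (simp add: UNIV_unit)
  obtain w r where w: "w \<in> W" "0 < r" "r \<le> 1" "\<And>N. tz_norm N w r u \<le> 1 / 2"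
    using R_small_norm[OF uR u0] by metis
  have "tz_norm N w r (v ()) \<le> 2 * tz_norm 0 w r 1" for N
  proof -
    note P = submult_seminormD[OF tz_norm_seminorm[OF weight[OF w(1)] w(2,3), of N]]
    have "tz_norm N w r (u * v ()) \<le> 1 / 2 * tz_norm N w r (v ())"
      using P(5)[of u "v ()"] w(4)[of N] P(2)[of "v ()"] by (meson mult_right_mono order_trans)
    moreover have "tz_norm N w r 1 = tz_norm 0 w r 1"
    proof -
      have "tz_norm N w r 1 = (\<Sum>x\<in>{(0, 0, 0)}. tz_weight w r x * norm (tz_coeff 1 x))"
        unfolding tz_norm_conv_sum by (intro sum.mono_neutral_right) (auto simp: tz_coeff_def split: if_splits)
      then show ?thesis by (simp add: tz_norm_conv_sum)
    qed
    ultimately show ?thesis using P(4)[of 1 "u * v ()"] v by simp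
  qed
  then have "v () \<in> R" using w by (intro R_I[of w r]) (auto simp: tz_bounded_def)
  then have "c * v () \<in> R" unfolding c_def by auto
  moreover have "f * (c * v ()) = 1"
  proof -
    have "f * (c * v ()) = v () - u * v ()" by (simp add: u_def algebra_simps)
    then show ?thesis using v by (metis add_diff_cancel_right')
  qed
  ultimately show ?thesis by blast
qed

end

section \<open>The partial derivatives\<close>

definition derivation :: "('a::comm_ring_1 \<Rightarrow> 'a) \<Rightarrow> bool" where
  "derivation D \<longleftrightarrow> (\<forall>a b. D (a + b) = D a + D b) \<and> (\<forall>a b. D (a * b) = D a * b + a * D b)"

lemma derivation_fps_map:
  assumes "derivation D"
  shows "derivation (\<lambda>f. Abs_fps (\<lambda>n. D (fps_nth f n)))"
proof -
  have D: "D (a + b) = D a + D b" "D (a * b) = D a * b + a * D b" for a b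
    using assms by (auto simp: derivation_def)
  have "D 0 = 0" using D(1)[of 0 0] by simp
  then have "D (\<Sum>i\<in>A. h i) = (\<Sum>i\<in>A. D (h i))" for h :: "nat \<Rightarrow> 'a" and A
    by (induction A rule: infinite_finite_induct) (auto simp: D)
  then show ?thesis unfolding derivation_def
    by (auto simp: fps_eq_iff fps_mult_nth D sum.distrib)
qed

lemma derivation_fps_deriv: "derivation (fps_deriv :: 'a::comm_ring_1 fps \<Rightarrow> _)"
  by (auto simp: derivation_def)

lemma derivationD:
  assumes "derivation D"
  shows "D (a + b) = D a + D b" "D (a * b) = D a * b + a * D b" "D 0 = 0" "D 1 = 0"
    "D (- a) = - D a" "D (a - b) = D a - D b"
proof -
  show 1: "D (a + b) = D a + D b" "D (a * b) = D a * b + a * D b" for a b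
    using assms by (auto simp: derivation_def)
  show 0: "D 0 = 0" using 1(1)[of 0 0] by simp
  show "D 1 = 0" using 1(2)[of 1 1] by simp
  show m: "D (- a) = - D a" for a using 1(1)[of a "- a"] 0 by (simp add: eq_neg_iff_add_eq_0 add.commute)
  show "D (a - b) = D a - D b" using 1(1)[of a "- b"] m by simp
qed

lemma derivation_numeral: "derivation D \<Longrightarrow> D (numeral k) = 0"
  by (induction k) (simp_all only: numeral.simps derivationD add_0_right)

lemma derivation_d1: "derivation d1"
  unfolding d1_def by (intro derivation_fps_map derivation_fps_deriv)

lemma derivation_d2: "derivation d2"
  unfolding d2_def using derivation_fps_map[OF derivation_fps_map[OF derivation_fps_deriv]] by simp

lemmas d1_simps = derivationD[OF derivation_d1]
lemmas d2_simps = derivationD[OF derivation_d2]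

lemmas d_numeral [simp] = derivation_numeral[OF derivation_d1] derivation_numeral[OF derivation_d2]

lemma d1_X [simp]: "d1 fps_X = 0" "d2 fps_X = 0"
  by (auto simp: d1_def d2_def fps_eq_iff fps_X_def)

lemma d_cst [simp]: "d1 (cst c) = 0" "d2 (cst c) = 0"
  by (auto simp: d1_def d2_def cst_def fps_eq_iff)

lemma d1_d2_commute: "d1 (d2 f) = d2 (d1 f)"
  by (auto simp: d1_def d2_def fps_eq_iff algebra_simps simp flip: fps_of_nat)

lemma d1_int1: "d1 (int1 f) = f"
  by (auto simp: d1_def int1_def fps_eq_iff simp del: of_nat_Suc simp flip: fps_of_nat)

lemma d2_int2: "d2 (int2 f) = f"
  by (auto simp: d2_def int2_def fps_eq_iff simp del: of_nat_Suc)

lemma d1_int2: "d1 (int2 f) = int2 (d1 f)"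
  by (auto simp: d1_def int2_def fps_eq_iff simp del: of_nat_Suc simp flip: fps_of_nat)

lemma d1_restrict1 [simp]: "d1 (restrict1 f) = 0"
  by (simp add: d1_def restrict1_def fps_eq_iff)

lemma restrict1_id: assumes "d1 f = 0" shows "restrict1 f = f"
proof -
  have "fps_nth (fps_nth f n) (Suc i) = 0" for n i
  proof -
    have "fps_nth (fps_nth (d1 f) n) i = 0" using assms by simp
    then have "of_nat (Suc i) * fps_nth (fps_nth f n) (Suc i) = 0" by (simp add: d1_def)
    moreover have "(of_nat (Suc i) :: complex fps) \<noteq> 0" by (simp del: of_nat_Suc)
    ultimately show ?thesis by (simp only: mult_eq_0_iff) simp
  qed
  then have "fps_nth (fps_nth f n) i = (if i = 0 then fps_nth (fps_nth f n) 0 else 0)" for n i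
    by (cases i) auto
  then have "fps_const (fps_nth (fps_nth f n) 0) = fps_nth f n" for n
    by (intro fps_ext) (metis fps_nth_fps_const)
  then show ?thesis unfolding restrict1_def by (intro fps_ext) (simp only: fps_nth_Abs_fps)
qed

lemma fps_shift_X: "fps_nth f 0 = 0 \<Longrightarrow> fps_X * fps_shift 1 f = f" for f :: "'a::comm_ring_1 fps"
  by (rule fps_ext) (simp add: fps_X_mult_nth)

section \<open>Gauge transformations\<close>

lemma mat2_eqI:
  fixes A B :: "'a ^ 2 ^ 2"
  assumes "A $ 1 $ 1 = B $ 1 $ 1" "A $ 1 $ 2 = B $ 1 $ 2" "A $ 2 $ 1 = B $ 2 $ 1" "A $ 2 $ 2 = B $ 2 $ 2"
  shows "A = B"
  using assms by (simp add: vec_eq_iff forall_2)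

lemma mat2_mult_nth:
  "((A :: 'a::semiring_1 ^ 2 ^ 2) ** B) $ i $ j = A $ i $ 1 * B $ 1 $ j + A $ i $ 2 * B $ 2 $ j"
  by (simp add: matrix_matrix_mult_def sum_2)

lemma mat2_vec_nth:
  "((A :: 'a::semiring_1 ^ 2 ^ 2) *v x) $ i = A $ i $ 1 * x $ 1 + A $ i $ 2 * x $ 2"
  by (simp add: matrix_vector_mult_def sum_2)

lemma mat2_1_nth [simp]:
  "(mat 1 :: 'a::semiring_1 ^ 2 ^ 2) $ 1 $ 1 = 1" "(mat 1 :: 'a::semiring_1 ^ 2 ^ 2) $ 1 $ 2 = 0"
  "(mat 1 :: 'a::semiring_1 ^ 2 ^ 2) $ 2 $ 1 = 0" "(mat 1 :: 'a::semiring_1 ^ 2 ^ 2) $ 2 $ 2 = 1"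
  by (auto simp: mat_def)

lemma mat2_left_inverse:
  fixes A B :: "'a::idom ^ 2 ^ 2"
  assumes "A ** B = mat 1"
  shows "B ** A = mat 1"
proof -
  obtain a b c d where A: "a = A $ 1 $ 1" "b = A $ 1 $ 2" "c = A $ 2 $ 1" "d = A $ 2 $ 2" by blast
  obtain e f g h where B: "e = B $ 1 $ 1" "f = B $ 1 $ 2" "g = B $ 2 $ 1" "h = B $ 2 $ 2" by blast
  have "a * e + b * g = 1" "a * f + b * h = 0" "c * e + d * g = 0" "c * f + d * h = 1"
    using arg_cong[OF assms, of "\<lambda>M. M $ 1 $ 1"] arg_cong[OF assms, of "\<lambda>M. M $ 1 $ 2"]
      arg_cong[OF assms, of "\<lambda>M. M $ 2 $ 1"] arg_cong[OF assms, of "\<lambda>M. M $ 2 $ 2"]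
    by (simp_all add: A B mat2_mult_nth)
  then have "e * a + f * c = 1" "e * b + f * d = 0" "g * a + h * c = 0" "g * b + h * d = 1"
    by algebra+
  then show ?thesis by (intro mat2_eqI) (simp_all add: A B mat2_mult_nth)
qed

lemma map_matrix_nth [simp]: "map_matrix h A $ i $ j = h (A $ i $ j)"
  by (simp add: map_matrix_def)

lemma map_matrix_mult2:
  fixes A B :: "'a::semiring_1 ^ 2 ^ 2" and h :: "'a \<Rightarrow> 'b::semiring_1"
  assumes "\<And>a b. h (a + b) = h a + h b" "\<And>a b. h (a * b) = h a * h b"
  shows "map_matrix h (A ** B) = map_matrix h A ** map_matrix h B"
  by (intro mat2_eqI) (simp_all add: mat2_mult_nth assms)

lemma matrix2_diff_ldistrib: "A ** (B - C) = A ** B - A ** C" for A B C :: "'a::ring_1 ^ 2 ^ 2"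
  by (intro mat2_eqI) (simp_all add: mat2_mult_nth algebra_simps)

lemma matrix2_diff_rdistrib: "(B - C) ** A = B ** A - C ** A" for A B C :: "'a::ring_1 ^ 2 ^ 2"
  by (intro mat2_eqI) (simp_all add: mat2_mult_nth algebra_simps)

lemma matrix2_add_rdistrib: "(B + C) ** A = B ** A + C ** A" for A B C :: "'a::semiring_1 ^ 2 ^ 2"
  by (intro mat2_eqI) (simp_all add: mat2_mult_nth algebra_simps)

lemma mat_over2I:
  assumes "A $ 1 $ 1 \<in> S" "A $ 1 $ 2 \<in> S" "A $ 2 $ 1 \<in> S" "A $ 2 $ 2 \<in> S"
  shows "A \<in> mat_over S"
  using assms by (auto simp: mat_over_def forall_2)

lemma zd_nth [simp]:
  "zd1 A $ i $ j = fps_X * d1 (A $ i $ j)" "zd2 A $ i $ j = fps_X * d2 (A $ i $ j)"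
  by (simp_all add: zd1_def zd2_def)

lemma at_z0_nth [simp]: "at_z0 A $ i $ j = fps_nth (A $ i $ j) 0"
  by (simp add: at_z0_def)

lemma at_z0_mult: "at_z0 (A ** B) = at_z0 A ** at_z0 B"
  unfolding at_z0_def by (rule map_matrix_mult2) simp_all

lemma zd_add: "zd1 (A + B) = zd1 A + zd1 B" "zd2 (A + B) = zd2 A + zd2 B"
  by (simp_all add: vec_eq_iff d1_simps d2_simps distrib_left)

lemma zd_diff: "zd1 (A - B) = zd1 A - zd1 B" "zd2 (A - B) = zd2 A - zd2 B"
  by (simp_all add: vec_eq_iff d1_simps d2_simps right_diff_distrib)

lemma zd_mult:
  "zd1 (A ** B) = zd1 A ** B + A ** zd1 B" "zd2 (A ** B) = zd2 A ** B + A ** zd2 B"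
  by (intro mat2_eqI; simp add: mat2_mult_nth d1_simps d2_simps algebra_simps)+

lemma zd_commute: "zd1 (zd2 A) = zd2 (zd1 A)"
  by (simp add: vec_eq_iff d1_simps d2_simps d1_d2_commute)

lemma C1_nth [simp]: "C1 $ 1 $ 1 = 1" "C1 $ 1 $ 2 = 0" "C1 $ 2 $ 1 = 0" "C1 $ 2 $ 2 = 1"
  by (simp_all add: C1_def)

lemma C2_nth [simp]: "C2 m $ 1 $ 1 = 0" "C2 m $ 1 $ 2 = fps_const (t2 ^ (m - 2))"
  "C2 m $ 2 $ 1 = 1" "C2 m $ 2 $ 2 = 0"
  by (simp_all add: C2_def)

lemma form_A2_nth [simp]: "form_A2 m f $ 1 $ 1 = 0"
  "form_A2 m f $ 1 $ 2 = fps_const (t2 ^ (m - 2)) + fps_X * f"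
  "form_A2 m f $ 2 $ 1 = 1" "form_A2 m f $ 2 $ 2 = 0"
  by (simp_all add: form_A2_def E_def)

lemma d1_t2_power [simp]: "d1 (fps_const (t2 ^ k)) = 0"
  unfolding t2_def fps_const_power by (auto simp: d1_def fps_eq_iff)

lemma fps_X_mult_cancel0: "fps_X * f = 0 \<Longrightarrow> f = 0" for f :: tzser
  by simp

lemma d1_shift0: "d1 f = 0 \<Longrightarrow> d1 (fps_shift 1 f) = 0"
  by (simp add: d1_def fps_eq_iff)

section \<open>Gauge isomorphisms over a ring and the reduction to the form with
  \<open>f\<close>\<close>

context weight_family
begin

lemma R_matrix_mult: "A \<in> mat_over R \<Longrightarrow> B \<in> mat_over R \<Longrightarrow> A ** B \<in> mat_over R"
  by (auto simp: mat_over_def mat2_mult_nth intro!: R_add R_mult)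

lemma R_matrix_add: "A \<in> mat_over R \<Longrightarrow> B \<in> mat_over R \<Longrightarrow> A + B \<in> mat_over R"
  by (auto simp: mat_over_def)

lemma R_matrix_zd2: "A \<in> mat_over R \<Longrightarrow> zd2 A \<in> mat_over R"
  by (auto simp: mat_over_def)

lemma R_t2_power [intro]: "fps_const (t2 ^ k) \<in> R"
  unfolding t2_def fps_const_power by (intro R_fps_const fps_const_in_Ct) (simp flip: fps_of_poly_monom')

lemma R_matrix_inverse:
  assumes T: "T \<in> mat_over R" and det: "tz_coeff (det T) (0, 0, 0) \<noteq> 0"
  shows "\<exists>S\<in>mat_over R. T ** S = mat 1 \<and> S ** T = mat 1"
proof -
  have ent: "T $ i $ j \<in> R" for i j using T by (auto simp: mat_over_def)
  have "det T \<in> R" unfolding det_2 using ent by auto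
  then obtain \<delta> where \<delta>: "\<delta> \<in> R" "det T * \<delta> = 1" using R_inverse det by blast
  define S :: "tzser ^ 2 ^ 2" where
    "S = vector [vector [T $ 2 $ 2 * \<delta>, - (T $ 1 $ 2 * \<delta>)], vector [- (T $ 2 $ 1 * \<delta>), T $ 1 $ 1 * \<delta>]]"
  have "S \<in> mat_over R" by (rule mat_over2I) (use ent \<delta> in \<open>auto simp: S_def\<close>)
  moreover have "T ** S = mat 1"
    using \<delta>(2) by (intro mat2_eqI) (simp_all add: mat2_mult_nth S_def det_2 algebra_simps)
  ultimately show ?thesis using mat2_left_inverse by blast
qed

text \<open>Invertibility of \<open>T(0)\<close> over the convergent series reduces to one complex
  number: if \<open>det T\<close> is nonzero at the origin, Cramer's rule inverts \<open>T\<close>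
  over the ring, and the inverse is then taken at \<open>z = 0\<close>.\<close>

lemma gauge_isomorphicI:
  assumes "T \<in> mat_over R" "tz_coeff (det T) (0, 0, 0) \<noteq> 0"
    "zd1 T + A1 ** T - T ** B1 = 0" "zd2 T + A2 ** T - T ** B2 = 0"
  shows "gauge_isomorphic R A1 A2 B1 B2"
proof -
  obtain S where S: "S \<in> mat_over R" "T ** S = mat 1" "S ** T = mat 1"
    using R_matrix_inverse[OF assms(1,2)] by blast
  have 1: "at_z0 (mat 1) = mat 1" by (intro mat2_eqI) simp_all
  have "at_z0 S \<in> mat_over Ct" using S(1) R_nth_0 by (auto simp: mat_over_def)
  moreover have "at_z0 T ** at_z0 S = mat 1" "at_z0 S ** at_z0 T = mat 1"
    unfolding at_z0_mult[symmetric] S(2,3) 1 by simp_all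
  ultimately show ?thesis using assms unfolding gauge_isomorphic_def by blast
qed

lemma gauge_isomorphic_trans:
  assumes "gauge_isomorphic R A1 A2 B1 B2" "gauge_isomorphic R B1 B2 D1 D2"
  shows "gauge_isomorphic R A1 A2 D1 D2"
proof -
  obtain T S where T: "T \<in> mat_over R" "S \<in> mat_over Ct" "at_z0 T ** S = mat 1" "S ** at_z0 T = mat 1"
    "zd1 T + A1 ** T = T ** B1" "zd2 T + A2 ** T = T ** B2"
    using assms(1) by (auto simp: gauge_isomorphic_def)
  obtain T' S' where T': "T' \<in> mat_over R" "S' \<in> mat_over Ct" "at_z0 T' ** S' = mat 1" "S' ** at_z0 T' = mat 1"
    "zd1 T' + B1 ** T' = T' ** D1" "zd2 T' + B2 ** T' = T' ** D2"
    using assms(2) by (auto simp: gauge_isomorphic_def)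
  have "at_z0 (T ** T') ** (S' ** S) = at_z0 T ** (at_z0 T' ** S') ** S"
    "(S' ** S) ** at_z0 (T ** T') = S' ** (S ** at_z0 T) ** at_z0 T'"
    by (simp_all add: at_z0_mult matrix_mul_assoc)
  then have inv: "at_z0 (T ** T') ** (S' ** S) = mat 1" "(S' ** S) ** at_z0 (T ** T') = mat 1"
    using T(3,4) T'(3,4) by simp_all
  \<comment> \<open>\<open>Ct\<close> inherits its closure properties from \<open>R\<close>: its
    elements are embedded as series constant in \<open>z\<close> and recovered as coefficients of
    \<open>z^0\<close>.\<close>
  have lift: "fps_const (M $ i $ j) \<in> R" if "M \<in> mat_over Ct" for M i j
    using that by (auto simp: mat_over_def)
  have "S' ** S \<in> mat_over Ct"
  proof -
    have "fps_const ((S' ** S) $ i $ j) \<in> R" for i j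
      unfolding mat2_mult_nth fps_const_add[symmetric] fps_const_mult[symmetric]
      by (intro R_add R_mult lift T T')
    from R_nth_0[OF this] show ?thesis by (auto simp: mat_over_def)
  qed
  moreover have "zd1 (T ** T') + A1 ** (T ** T') - T ** T' ** D1 = 0"
  proof -
    have "zd1 (T ** T') + A1 ** (T ** T') = (zd1 T + A1 ** T) ** T' + T ** zd1 T'"
      by (simp add: zd_mult matrix2_add_rdistrib matrix_mul_assoc)
    also have "\<dots> = T ** (zd1 T' + B1 ** T')"
      by (simp add: T matrix_add_ldistrib matrix_mul_assoc add.commute)
    finally show ?thesis by (simp add: T' matrix_mul_assoc)
  qed
  moreover have "zd2 (T ** T') + A2 ** (T ** T') - T ** T' ** D2 = 0"
  proof -
    have "zd2 (T ** T') + A2 ** (T ** T') = (zd2 T + A2 ** T) ** T' + T ** zd2 T'"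
      by (simp add: zd_mult matrix2_add_rdistrib matrix_mul_assoc)
    also have "\<dots> = T ** (zd2 T' + B2 ** T')"
      by (simp add: T matrix_add_ldistrib matrix_mul_assoc add.commute)
    finally show ?thesis by (simp add: T' matrix_mul_assoc)
  qed
  ultimately show ?thesis using inv R_matrix_mult[OF T(1) T'(1)]
    unfolding gauge_isomorphic_def by blast
qed

lemma T_structure_form:
  assumes "f \<in> R" "d1 f = 0"
  shows "T_structure R C1 (form_A2 m f)"
  unfolding T_structure_def
proof (intro conjI)
  show "C1 \<in> mat_over R" by (rule mat_over2I) auto
  show "form_A2 m f \<in> mat_over R" by (rule mat_over2I) (use assms in auto)
  show "zd1 (form_A2 m f) - zd2 C1 + (C1 ** form_A2 m f - form_A2 m f ** C1) = 0"
    by (intro mat2_eqI) (simp_all add: mat2_mult_nth d1_simps d2_simps assms)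
qed

text \<open>The gauge has columns \<open>v = g e\<^sub>1\<close> and \<open>z\<nabla>\<^sub>2 v\<close>; the equation \<open>\<partial>\<^sub>2 g = h g\<close> makes the
  \<open>z\<nabla>\<^sub>2 v\<close>-component of \<open>(z\<nabla>\<^sub>2)\<^sup>2 v\<close> vanish.\<close>

lemma cyclic_reduction:
  assumes B: "B \<in> mat_over R" "\<And>i j. d1 (B $ i $ j) = 0" "at_z0 B = at_z0 (C2 m)"
  shows "\<exists>f\<in>R. d1 f = 0 \<and> gauge_isomorphic R C1 B C1 (form_A2 m f)"
proof -
  define p q s u where "p = B $ 1 $ 1" "q = B $ 1 $ 2" "s = B $ 2 $ 1" "u = B $ 2 $ 2"
  note defs = this
  have R: "p \<in> R" "q \<in> R" "s \<in> R" "u \<in> R" using B(1) by (auto simp: defs mat_over_def)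
  have d1: "d1 p = 0" "d1 q = 0" "d1 s = 0" "d1 u = 0" using B(2) by (auto simp: defs)
  have z0: "fps_nth p 0 = 0" "fps_nth q 0 = t2 ^ (m - 2)" "fps_nth s 0 = 1" "fps_nth u 0 = 0"
    using arg_cong[OF B(3), of "\<lambda>M. M $ 1 $ 1"] arg_cong[OF B(3), of "\<lambda>M. M $ 1 $ 2"]
      arg_cong[OF B(3), of "\<lambda>M. M $ 2 $ 1"] arg_cong[OF B(3), of "\<lambda>M. M $ 2 $ 2"]
    by (simp_all add: defs)
  obtain si where si: "si \<in> R" "s * si = 1"
    using R_inverse[OF R(3)] z0(3) by (auto simp: tz_coeff_def)
  \<comment> \<open>The trace of \<open>B\<close> divided by \<open>z\<close>; both diagonal entries
    vanish at \<open>z = 0\<close>.\<close>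
  define e where "e = fps_shift 1 (p + u)"
  have e: "fps_X * e = p + u" unfolding e_def by (rule fps_shift_X) (simp add: z0)
  \<comment> \<open>The \<open>(2, 2)\<close> entry of the gauge equation turns out to be
    \<open>fps_X * g\<close> times \<open>s * (h + h) + d2 s + s * e\<close>; this \<open>h\<close>
    makes the last factor vanish.\<close>
  define h where "h = cst (- 1 / 2) * (d2 s * si + e)"
  have hR: "h \<in> R" unfolding h_def e_def by (intro R_mult R_add R_cst R_d2 R_shift R si)
  have half: "cst (- 1 / 2) + cst (- 1 / 2) = - 1" by (simp add: cst_def flip: fps_const_neg)
  have h: "s * (h + h) + d2 s + s * e = 0"
  proof -
    have "s * (h + h) = (cst (- 1 / 2) + cst (- 1 / 2)) * (d2 s * (s * si) + s * e)"
      unfolding h_def by algebra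
    then show ?thesis unfolding half si(2) by simp
  qed
  have d1e: "d1 e = 0" unfolding e_def by (rule d1_shift0) (simp add: d1_simps d1)
  have d1si: "d1 si = 0"
  proof -
    have "s * d1 si = 0" using arg_cong[OF si(2), of d1] by (simp add: d1_simps d1)
    moreover have "s \<noteq> 0" using si(2) by auto
    ultimately show ?thesis by simp
  qed
  have d1h: "d1 h = 0" by (simp add: h_def d1_simps d1 d1e d1si d1_d2_commute d2_simps)
  obtain g' where g': "\<And>k::unit. g' k \<in> R" "\<And>k::unit. g' k = 1 + int2 (\<Sum>l\<in>UNIV. h * g' l)"
    using R_linear_system[OF causal_int2 tz_norm_int2, of "\<lambda>_. 1" "\<lambda>_ _. h"] R_1 hR by blast
  have "(\<Sum>l\<in>UNIV. h * g' l) = h * g' ()" by (simp add: UNIV_unit)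
  from g'(2)[of "()", unfolded this] g'(1)[of "()"] obtain g
    where gR: "g \<in> R" and g: "g = 1 + int2 (h * g)" by blast
  have d2g: "d2 g = h * g" using arg_cong[OF g, of d2] by (simp add: d2_simps d2_int2)
  have d1g: "d1 g = 0"
  proof (rule causal_equation_unique[OF causal_int2, of _ 0 h])
    show "d1 g = 0 + int2 (h * d1 g)"
      using arg_cong[OF g, of d1] by (simp add: d1_simps d1_int2 d1h)
    show "0 = 0 + int2 (h * 0)" by (simp add: int2_def fps_eq_iff)
  qed
  \<comment> \<open>The product \<open>g * \<alpha>\<close> is the first coordinate of
    \<open>(z\<nabla>\<^sub>2)\<^sup>2 v\<close>. At \<open>z = 0\<close> only \<open>q * s\<close>
    survives, so \<open>\<alpha>\<close> and \<open>t2^(m-2)\<close> differ by a multiple of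
    \<open>z\<close>, which defines \<open>f\<close>.\<close>
  define \<alpha> where "\<alpha> = fps_X * fps_X * (h * h + d2 h) + fps_X * (h * p + h * p) + fps_X * d2 p + p * p + q * s"
  have \<alpha>R: "\<alpha> \<in> R" unfolding \<alpha>_def by (intro R_add R_mult R_d2 R_X R hR)
  define f where "f = fps_shift 1 (\<alpha> - fps_const (t2 ^ (m - 2)))"
  have fR: "f \<in> R" unfolding f_def by (intro R_shift R_diff \<alpha>R R_t2_power)
  have "fps_nth \<alpha> 0 = t2 ^ (m - 2)" by (simp add: \<alpha>_def z0 mult.assoc)
  then have f: "fps_X * f = \<alpha> - fps_const (t2 ^ (m - 2))"
    unfolding f_def by (intro fps_shift_X) simp
  have d1f: "d1 f = 0" unfolding f_def
    by (rule d1_shift0) (simp add: \<alpha>_def d1_simps d1h d1 d1_d2_commute d2_simps)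
  define T :: "tzser ^ 2 ^ 2" where "T = vector [vector [g, g * (fps_X * h + p)], vector [0, s * g]]"
  have "gauge_isomorphic R C1 B C1 (form_A2 m f)"
  proof (rule gauge_isomorphicI)
    show "T \<in> mat_over R" by (rule mat_over2I) (simp_all add: T_def R_add R_mult R_X R_0 R hR gR)
    have g0: "tz_coeff g (0, 0, 0) = 1"
      using arg_cong[OF g, of "\<lambda>f. tz_coeff f (0, 0, 0)"] by (simp add: tz_coeff_def int2_def)
    show "tz_coeff (det T) (0, 0, 0) \<noteq> 0"
      using g0 z0 by (simp add: det_2 T_def tz_coeff_def)
    show "zd1 T + C1 ** T - T ** C1 = 0"
      by (intro mat2_eqI) (simp_all add: mat2_mult_nth T_def d1_simps d1 d1g d1h)
    show "zd2 T + B ** T - T ** form_A2 m f = 0"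
    proof (rule mat2_eqI)
      show "(zd2 T + B ** T - T ** form_A2 m f) $ 1 $ 1 = (0 :: tzser ^ 2 ^ 2) $ 1 $ 1"
        by (simp add: mat2_mult_nth T_def d2g defs[symmetric] algebra_simps)
      show "(zd2 T + B ** T - T ** form_A2 m f) $ 1 $ 2 = (0 :: tzser ^ 2 ^ 2) $ 1 $ 2"
        by (simp add: mat2_mult_nth T_def d2g d2_simps f defs[symmetric] \<alpha>_def algebra_simps)
      show "(zd2 T + B ** T - T ** form_A2 m f) $ 2 $ 1 = (0 :: tzser ^ 2 ^ 2) $ 2 $ 1"
        by (simp add: mat2_mult_nth T_def d2g d2_simps defs[symmetric] algebra_simps)
      have "fps_X * d2 (s * g) + (s * (g * (fps_X * h + p)) + u * (s * g))
          = fps_X * g * (s * (h + h) + d2 s) + s * g * (p + u)"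
        by (simp add: d2_simps d2g algebra_simps)
      also have "\<dots> = fps_X * g * (s * (h + h) + d2 s + s * e)"
        by (simp add: e[symmetric] algebra_simps)
      also have "\<dots> = 0" unfolding h by simp
      finally show "(zd2 T + B ** T - T ** form_A2 m f) $ 2 $ 2 = (0 :: tzser ^ 2 ^ 2) $ 2 $ 2"
        by (simp add: mat2_mult_nth T_def defs[symmetric])
    qed
  qed
  then show ?thesis using fR d1f by blast
qed

text \<open>At \<open>z = 0\<close> the frame \<open>(\<zeta>, C\<^sub>2 \<zeta>)\<close> already
  has the required Higgs field. Only its value at \<open>t1 = 0\<close> is prescribed for the gauge;
  flatness carries the result to all \<open>t1\<close>.\<close>

lemma normalize_A1:
  assumes "T_structure_over_I2 R m A1 A2"
  shows "\<exists>B\<in>mat_over R. (\<forall>i j. d1 (B $ i $ j) = 0) \<and> at_z0 B = at_z0 (C2 m)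
    \<and> gauge_isomorphic R A1 A2 C1 B"
proof -
  have A: "A1 \<in> mat_over R" "A2 \<in> mat_over R" and flat: "zd1 A2 - zd2 A1 + (A1 ** A2 - A2 ** A1) = 0"
    using assms by (auto simp: T_structure_over_I2_def T_structure_def)
  obtain \<zeta> where unf: "unfolding_section A1 A2 \<zeta>"
    and mult: "\<And>X Y. X \<in> vec_over Ct \<Longrightarrow> Y \<in> vec_over Ct \<Longrightarrow>
      higgs A1 A2 (I2_mult m X Y) \<zeta> = higgs A1 A2 X (higgs A1 A2 Y \<zeta>)"
    and unit: "higgs A1 A2 I2_unit \<zeta> = \<zeta>"
    using assms by (auto simp: T_structure_over_I2_def)
  define c1 c2 where "c1 = at_z0 A1" "c2 = at_z0 A2"
  note c = this
  define v where "v = c2 *v \<zeta>"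
  have Ct01: "0 \<in> Ct" "1 \<in> Ct" using R_nth_0[OF R_0] R_nth_0[OF R_1] by auto
  define e1 e2 :: "tser ^ 2" where "e1 = vector [1, 0]" "e2 = vector [0, 1]"
  note e = this
  have eCt: "e1 \<in> vec_over Ct" "e2 \<in> vec_over Ct"
    using Ct01 by (auto simp: e vec_over_def forall_2)
  have higgs_e: "higgs A1 A2 e1 x = c1 *v x" "higgs A1 A2 e2 x = c2 *v x" for x
    by (simp_all add: higgs_def e c vec_eq_iff forall_2)
  have 1: "c1 *v \<zeta> = \<zeta>" using unit higgs_e(1) by (simp add: I2_unit_def e)
  have "I2_mult m e2 e2 = vector [t2 ^ (m - 2), 0]" by (simp add: I2_mult_def e)
  then have 2: "c2 *v v = t2 ^ (m - 2) *s \<zeta>"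
    using mult[OF eCt(2) eCt(2)] 1 unfolding higgs_e v_def[symmetric]
    by (simp add: higgs_def c[symmetric] vec_eq_iff forall_2)
  have "I2_mult m e1 e2 = e2" by (simp add: I2_mult_def e)
  then have 3: "c1 *v v = v" using mult[OF eCt(1) eCt(2)] by (simp add: higgs_e v_def)
  have "\<zeta> \<in> vec_over Ct" using unf by (simp add: unfolding_section_def)
  have "e1 \<in> (\<lambda>X. higgs A1 A2 X \<zeta>) ` vec_over Ct" "e2 \<in> (\<lambda>X. higgs A1 A2 X \<zeta>) ` vec_over Ct"
    using unf eCt by (auto simp: unfolding_section_def bij_betw_def)
  then obtain X Y where X: "higgs A1 A2 X \<zeta> = e1" and Y: "higgs A1 A2 Y \<zeta> = e2" by blast
  have higgs: "higgs A1 A2 Z \<zeta> = Z $ 1 *s \<zeta> + Z $ 2 *s v" for Z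
    by (simp add: higgs_def c[symmetric] 1 v_def)
  define T0 :: "tser ^ 2 ^ 2" where "T0 = (\<chi> i j. if j = 1 then \<zeta> $ i else v $ i)"
  define S0 :: "tser ^ 2 ^ 2" where "S0 = (\<chi> i j. if j = 1 then X $ i else Y $ i)"
  have T0S0: "T0 ** S0 = mat 1"
    using X Y unfolding higgs
    by (intro mat2_eqI) (simp_all add: mat2_mult_nth T0_def S0_def vec_eq_iff forall_2 e mult.commute)
  have c1T0: "c1 ** T0 = T0" using 1 3
    by (intro mat2_eqI) (simp_all add: mat2_mult_nth T0_def vec_eq_iff forall_2 mat2_vec_nth)
  \<comment> \<open>The unfolding condition makes \<open>T0\<close> invertible, and
    \<open>c1\<close> fixes both of its columns.\<close>
  have c1: "c1 = mat 1"
  proof -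
    have "c1 = c1 ** T0 ** S0" by (simp add: matrix_mul_assoc[symmetric] T0S0)
    then show ?thesis by (simp add: c1T0 T0S0)
  qed
  have c2T0: "c2 ** T0 = T0 ** at_z0 (C2 m)" using 2 v_def
    by (intro mat2_eqI) (simp_all add: mat2_mult_nth T0_def vec_eq_iff forall_2 mat2_vec_nth mult.commute)
  define B1 :: "tzser ^ 2 ^ 2" where "B1 = map_matrix (fps_shift 1) (A1 - mat 1)"
  have A1B1: "A1 $ i $ j = mat 1 $ i $ j + fps_X * B1 $ i $ j" for i j
  proof -
    have "fps_nth (A1 $ i $ j) 0 = fps_nth (mat 1 $ i $ j) 0"
      using arg_cong[OF c1, of "\<lambda>M. M $ i $ j"] by (simp add: c mat_def)
    then show ?thesis unfolding B1_def map_matrix_nth by (subst fps_shift_X) simp_all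
  qed
  have one: "(mat 1 :: tzser ^ 2 ^ 2) $ i $ j \<in> R" for i j by (auto simp: mat_def)
  have B1R: "B1 $ i $ j \<in> R" for i j
    unfolding B1_def map_matrix_nth vector_minus_component
    using A one by (intro R_shift R_diff) (auto simp: mat_over_def)
  have T0R: "fps_const (T0 $ i $ j) \<in> R" for i j
  proof -
    have "\<zeta> $ i \<in> Ct" for i using \<open>\<zeta> \<in> vec_over Ct\<close> by (auto simp: vec_over_def)
    moreover from this have "v $ i \<in> Ct" for i
    proof -
      have "fps_const (\<zeta> $ i) \<in> R" "fps_const (fps_nth (A2 $ i $ j) 0) \<in> R" for i j
        using \<open>\<And>i. \<zeta> $ i \<in> Ct\<close> A(2) R_nth_0 by (auto simp: mat_over_def)
      then have "fps_const (v $ i) \<in> R"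
        unfolding v_def mat2_vec_nth fps_const_add[symmetric] fps_const_mult[symmetric] c at_z0_nth
        by (intro R_add R_mult)
      from R_nth_0[OF this] show ?thesis by simp
    qed
    ultimately show ?thesis by (auto simp: T0_def)
  qed
  \<comment> \<open>One linear system for each column \<open>j\<close> of the gauge. The initial
    value is free of \<open>t1\<close>, so that differentiation leaves exactly
    \<open>\<partial>\<^sub>1 T = - B1 T\<close>.\<close>
  have "\<exists>u. (\<forall>i. u i \<in> R) \<and> (\<forall>i. u i = restrict1 (fps_const (T0 $ i $ j))
      + int1 (\<Sum>l\<in>UNIV. (- (B1 $ i $ l)) * u l))" for j :: 2
    by (rule R_linear_system[OF causal_int1 tz_norm_int1]) (use T0R B1R in auto)
  then have "\<forall>j. \<exists>u. (\<forall>i. u i \<in> R) \<and> (\<forall>i. u i = restrict1 (fps_const (T0 $ i $ j))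
      + int1 (\<Sum>l\<in>UNIV. (- (B1 $ i $ l)) * u l))" by blast
  from choice[OF this] obtain U where U: "\<And>j i. U j i \<in> R" "\<And>j i. U j i = restrict1 (fps_const (T0 $ i $ j))
      + int1 (\<Sum>l\<in>UNIV. (- (B1 $ i $ l)) * U j l)" by blast
  define T :: "tzser ^ 2 ^ 2" where "T = (\<chi> i j. U j i)"
  have TR: "T \<in> mat_over R" using U(1) by (auto simp: T_def mat_over_def)
  have d1T: "d1 (T $ i $ j) = - (B1 $ i $ 1 * T $ 1 $ j + B1 $ i $ 2 * T $ 2 $ j)" for i j
    using arg_cong[OF U(2)[of j i], of d1] by (simp add: d1_simps d1_int1 T_def sum_2)
  have T_init: "fps_nth (fps_nth (T $ i $ j) 0) 0 = fps_nth (T0 $ i $ j) 0" for i j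
    using arg_cong[OF U(2)[of j i], of "\<lambda>f. fps_nth (fps_nth f 0) 0"]
    by (simp add: T_def restrict1_def int1_def)
  have zd1T: "zd1 T + A1 ** T = T"
    by (intro mat2_eqI) (simp_all add: mat2_mult_nth d1T A1B1 algebra_simps)
  \<comment> \<open>Evaluation at \<open>t1 = 0\<close>, the only place where \<open>T(0)\<close> is
    known to agree with \<open>T0\<close>. It suffices for comparing \<open>B(0)\<close> with
    \<open>C2\<close>, since both are free of \<open>t1\<close>.\<close>
  define ev :: "tser ^ 2 ^ 2 \<Rightarrow> complex fps ^ 2 ^ 2" where "ev = map_matrix (\<lambda>a. fps_nth a 0)"
  have ev_mult: "ev (M ** N) = ev M ** ev N" for M N
    unfolding ev_def by (rule map_matrix_mult2) simp_all
  have ev_T: "ev (at_z0 T) = ev T0" using T_init by (simp add: ev_def vec_eq_iff)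
  have ev_1: "ev (mat 1) = mat 1" by (intro mat2_eqI) (simp_all add: ev_def)
  have evTS: "ev T0 ** ev S0 = mat 1" using T0S0 ev_mult ev_1 by metis
  then have evST: "ev S0 ** ev T0 = mat 1" by (rule mat2_left_inverse)
  have detT: "tz_coeff (det T) (0, 0, 0) \<noteq> 0"
  proof -
    have "det (ev T0) * det (ev S0) = 1" using arg_cong[OF evTS, of det] by (simp add: det_mul)
    then have "fps_nth (det (ev T0)) 0 * fps_nth (det (ev S0)) 0 = 1"
      by (metis fps_mult_nth_0 fps_one_nth)
    moreover have "tz_coeff (det T) (0, 0, 0) = fps_nth (det (ev T0)) 0"
      by (simp add: det_2 tz_coeff_def T_init ev_def)
    ultimately show ?thesis by auto
  qed
  obtain S where S: "S \<in> mat_over R" "T ** S = mat 1" "S ** T = mat 1"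
    using R_matrix_inverse[OF TR detT] by blast
  define B where "B = S ** (zd2 T + A2 ** T)"
  have BR: "B \<in> mat_over R"
    unfolding B_def by (intro R_matrix_mult R_matrix_add R_matrix_zd2 S(1) A TR)
  have TB: "T ** B = zd2 T + A2 ** T" by (simp add: B_def matrix_mul_assoc S(2))
  \<comment> \<open>Applying \<open>zd1\<close> to \<open>TB\<close> and replacing
    \<open>zd1 T\<close> by \<open>T - A1 ** T\<close> turns \<open>T ** zd1 B\<close> into the
    curvature multiplied by \<open>T\<close>.\<close>
  have "T ** zd1 B = 0"
  proof -
    have z: "zd1 T = T - A1 ** T" using zd1T by (simp add: eq_diff_eq)
    have "zd1 T ** B + T ** zd1 B = zd2 (zd1 T) + (zd1 A2 ** T + A2 ** zd1 T)"
      using arg_cong[OF TB, of zd1] by (simp add: zd_mult zd_add zd_commute)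
    then have "T ** B - A1 ** (T ** B) + T ** zd1 B
        = zd2 T - (zd2 A1 ** T + A1 ** zd2 T) + (zd1 A2 ** T + (A2 ** T - A2 ** A1 ** T))"
      unfolding z by (simp add: zd_diff zd_mult matrix2_diff_rdistrib matrix2_diff_ldistrib matrix_mul_assoc)
    then have "T ** zd1 B = (zd1 A2 - zd2 A1 + (A1 ** A2 - A2 ** A1)) ** T"
      unfolding TB by (simp add: matrix2_add_rdistrib matrix2_diff_rdistrib matrix_add_ldistrib
          matrix_mul_assoc algebra_simps)
    then show ?thesis unfolding flat by (simp add: vec_eq_iff forall_2 mat2_mult_nth)
  qed
  then have "S ** T ** zd1 B = 0"
    unfolding matrix_mul_assoc[symmetric] by (simp add: vec_eq_iff forall_2 mat2_mult_nth)
  then have "zd1 B = 0" by (simp add: S(3))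
  then have d1B: "d1 (B $ i $ j) = 0" for i j
    by (metis zd_nth(1) zero_index fps_X_mult_cancel0)
  have "at_z0 B = at_z0 (C2 m)"
  proof -
    have "at_z0 T ** at_z0 B = c2 ** at_z0 T"
      using arg_cong[OF TB, of at_z0] unfolding at_z0_mult[symmetric] c
      by (simp add: vec_eq_iff at_z0_mult[symmetric])
    then have "ev T0 ** ev (at_z0 B) = ev (c2 ** T0)"
      using arg_cong[of _ _ ev] by (metis ev_mult ev_T)
    then have "ev S0 ** ev T0 ** ev (at_z0 B) = ev S0 ** ev T0 ** ev (at_z0 (C2 m))"
      unfolding c2T0 ev_mult by (simp add: matrix_mul_assoc[symmetric])
    then have eq: "ev (at_z0 B) = ev (at_z0 (C2 m))" by (simp add: evST)
    have const: "fps_nth (B $ i $ j) 0 = fps_const (fps_nth (fps_nth (B $ i $ j) 0) 0)" for i j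
      using arg_cong[OF restrict1_id[OF d1B[of i j]], of "\<lambda>f. fps_nth f 0"] by (simp add: restrict1_def)
    have const': "fps_nth (C2 m $ i $ j) 0 = fps_const (fps_nth (fps_nth (C2 m $ i $ j) 0) 0)" for i j
    proof -
      have "d1 (C2 m $ i $ j) = 0"
        using exhaust_2[of i] exhaust_2[of j] by (auto simp: d1_simps)
      from arg_cong[OF restrict1_id[OF this], of "\<lambda>f. fps_nth f 0"] show ?thesis
        by (simp add: restrict1_def)
    qed
    have "fps_nth (B $ i $ j) 0 = fps_nth (C2 m $ i $ j) 0" for i j
      using arg_cong[OF eq, of "\<lambda>M. M $ i $ j"] const[of i j] const'[of i j] by (simp add: ev_def)
    then show ?thesis by (simp add: vec_eq_iff)
  qed
  moreover have "gauge_isomorphic R A1 A2 C1 B"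
    by (rule gauge_isomorphicI[OF TR detT]) (simp_all add: zd1T TB C1_def)
  ultimately show ?thesis using BR d1B by blast
qed

lemma gauge_normal_form:
  assumes "T_structure_over_I2 R m A1 A2"
  shows "\<exists>f\<in>R. d1 f = 0 \<and> T_structure R C1 (form_A2 m f)
    \<and> gauge_isomorphic R A1 A2 C1 (form_A2 m f)"
proof -
  obtain B where B: "B \<in> mat_over R" "\<And>i j. d1 (B $ i $ j) = 0" "at_z0 B = at_z0 (C2 m)"
    "gauge_isomorphic R A1 A2 C1 B"
    using normalize_A1[OF assms] by blast
  obtain f where "f \<in> R" "d1 f = 0" "gauge_isomorphic R C1 B C1 (form_A2 m f)"
    using cyclic_reduction[OF B(1-3)] by blast
  then show ?thesis using T_structure_form gauge_isomorphic_trans[OF B(4)] by blast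
qed

end

section \<open>A regular singular system\<close>

abbreviation trunc_norm :: "nat \<Rightarrow> real \<Rightarrow> complex fps \<Rightarrow> real" where
  "trunc_norm M r \<equiv> fps_trunc_norm M (\<lambda>j. r ^ j) norm"

lemma trunc_norm_bounded_of_radius:
  assumes "ereal r < fps_conv_radius f" "0 < r"
  shows "\<exists>C. \<forall>M. trunc_norm M r f \<le> C"
proof -
  have "summable (\<lambda>j. norm (fps_nth f j * of_real r ^ j))"
    using assms unfolding fps_conv_radius_def by (intro abs_summable_in_conv_radius) auto
  then have s: "summable (\<lambda>j. r ^ j * norm (fps_nth f j))"
    using assms by (simp add: norm_mult norm_power mult.commute)
  have "trunc_norm M r f \<le> (\<Sum>j. r ^ j * norm (fps_nth f j))" for M
    unfolding fps_trunc_norm_def using assms by (intro sum_le_suminf s) auto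
  then show ?thesis by blast
qed

lemma radius_geI:
  assumes "\<And>r. 0 < r \<Longrightarrow> r < \<rho> \<Longrightarrow> \<exists>C. \<forall>M. trunc_norm M r f \<le> C"
  shows "ereal \<rho> \<le> fps_conv_radius f"
  unfolding fps_conv_radius_def
proof (rule conv_radius_geI_ex')
  fix r :: real assume r: "0 < r" "ereal r < ereal \<rho>"
  then obtain C where C: "\<And>M. trunc_norm M r f \<le> C" using assms[of r] by auto
  have "summable (\<lambda>j. norm (fps_nth f j * of_real r ^ j))"
  proof (rule bounded_imp_summable)
    show "(\<Sum>j\<le>M. norm (fps_nth f j * of_real r ^ j)) \<le> C" for M
      using C[of M] r by (simp add: fps_trunc_norm_def norm_mult norm_power mult.commute)
  qed auto
  then show "summable (\<lambda>j. fps_nth f j * of_real r ^ j)" by (rule summable_norm_cancel)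
qed

lemma radius_ge_cong:
  fixes f g :: "complex fps"
  assumes "ereal \<rho> \<le> fps_conv_radius g" "\<And>j. norm (fps_nth f j) \<le> norm (fps_nth g j)"
  shows "ereal \<rho> \<le> fps_conv_radius f"
proof (rule radius_geI)
  fix r :: real assume r: "0 < r" "r < \<rho>"
  then have "ereal r < fps_conv_radius g" using assms(1) by (metis less_ereal.simps(1) order_less_le_trans)
  then obtain C where C: "\<And>M. trunc_norm M r g \<le> C" using trunc_norm_bounded_of_radius r by metis
  have "trunc_norm M r f \<le> trunc_norm M r g" for M
    unfolding fps_trunc_norm_def using assms(2) r by (intro sum_mono mult_left_mono) auto
  then show "\<exists>C. \<forall>M. trunc_norm M r f \<le> C" using C order_trans by blast
qed

lemma radius_ge_add: "R \<le> fps_conv_radius f \<Longrightarrow> R \<le> fps_conv_radius g \<Longrightarrow> R \<le> fps_conv_radius (f + g)"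
  for f g :: "complex fps"
  using fps_conv_radius_add[of f g] by (meson min.boundedI order_trans)

lemma radius_ge_diff: "R \<le> fps_conv_radius f \<Longrightarrow> R \<le> fps_conv_radius g \<Longrightarrow> R \<le> fps_conv_radius (f - g)"
  for f g :: "complex fps"
  using fps_conv_radius_diff[of f g] by (meson min.boundedI order_trans)

lemma radius_ge_mult: "R \<le> fps_conv_radius f \<Longrightarrow> R \<le> fps_conv_radius g \<Longrightarrow> R \<le> fps_conv_radius (f * g)"
  for f g :: "complex fps"
  using fps_conv_radius_mult[of f g] by (meson min.boundedI order_trans)

lemma radius_ge_deriv: "R \<le> fps_conv_radius f \<Longrightarrow> R \<le> fps_conv_radius (fps_deriv f)"
  for f :: "complex fps"
  using fps_conv_radius_deriv order_trans by blast

lemma radius_ge_sum: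
  assumes "\<And>i. i \<in> A \<Longrightarrow> R \<le> fps_conv_radius (f i)"
  shows "R \<le> fps_conv_radius (\<Sum>i\<in>A. f i :: complex fps)"
  using assms by (induction A rule: infinite_finite_induct) (auto intro: radius_ge_add)

lemma radius_ge_shift:
  assumes "R \<le> fps_conv_radius (f :: complex fps)"
  shows "R \<le> fps_conv_radius (fps_shift n f)"
  using assms unfolding fps_conv_radius_def by (simp add: conv_radius_shift)

lemma fps_mult_nth_cong:
  assumes "\<And>j. j \<le> n \<Longrightarrow> fps_nth f j = fps_nth g j"
  shows "fps_nth (h * f) n = fps_nth (h * g) n"
  unfolding fps_mult_nth by (intro sum.cong refl arg_cong2[where f = "(*)"] assms) auto

lemma fps_X_power_mult_shift:
  assumes "\<And>j. j < n \<Longrightarrow> fps_nth f j = 0"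
  shows "fps_X ^ n * fps_shift n f = (f :: complex fps)"
  by (rule fps_ext) (use assms in \<open>simp add: fps_X_power_mult_nth\<close>)

text \<open>The eigenvalues \<open>2 j + N + 1\<close> on monomials never vanish, so the singular
  point has no resonances among power series.\<close>

lemma euler_operator_nth:
  "fps_nth (2 * (fps_X * fps_deriv \<eta>) + of_nat (N + 1) * \<eta>) j = of_nat (2 * j + N + 1) * fps_nth \<eta> j"
  for \<eta> :: "complex fps"
  by (cases j) (simp_all add: numeral_fps_const fps_of_nat[symmetric] algebra_simps)

lemma euler_operator_solve:
  fixes N :: nat and f :: "complex fps"
  defines "\<eta> \<equiv> Abs_fps (\<lambda>j. fps_nth f j / of_nat (2 * j + N + 1))"
  shows "2 * (fps_X * fps_deriv \<eta>) + of_nat (N + 1) * \<eta> = f"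
proof (rule fps_ext)
  fix j
  have "fps_nth (2 * (fps_X * fps_deriv \<eta>) + of_nat (N + 1) * \<eta>) j = of_nat (2 * j + N + 1) * fps_nth \<eta> j"
    by (rule euler_operator_nth)
  also have "\<dots> = fps_nth f j" unfolding \<eta>_def by (simp del: of_nat_add of_nat_Suc of_nat_mult)
  finally show "fps_nth (2 * (fps_X * fps_deriv \<eta>) + of_nat (N + 1) * \<eta>) j = fps_nth f j" .
qed

text \<open>Inverting the Euler operator eliminates \<open>\<eta>\<close> without enlarging
  coefficients, and integration gains a factor \<open>r\<close> for \<open>\<xi>\<close>. The
  threshold \<open>\<rho>0\<close> depends on \<open>k\<close> alone and not on \<open>p\<close>,
  \<open>q\<close>, \<open>c\<close>, which makes one disc serve infinitely many right-hand
  sides.\<close>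

lemma regular_singular_system:
  fixes k :: "complex fps" and N :: nat
  assumes k: "0 < fps_conv_radius k"
  shows "\<exists>\<rho>0>0. \<forall>\<rho> p q c. 0 < \<rho> \<longrightarrow> \<rho> \<le> \<rho>0 \<longrightarrow> ereal \<rho> \<le> fps_conv_radius p \<longrightarrow> ereal \<rho> \<le> fps_conv_radius q \<longrightarrow>
    (\<exists>\<xi> \<eta>. ereal \<rho> \<le> fps_conv_radius \<xi> \<and> ereal \<rho> \<le> fps_conv_radius \<eta> \<and> fps_nth \<xi> 0 = c \<and>
       2 * (fps_X * fps_deriv \<eta>) + of_nat (N + 1) * \<eta> + k * \<xi> = p \<and>
       2 * fps_deriv \<xi> + fps_X ^ N * k * \<eta> = q)"
proof -
  obtain r1 where r1: "0 < ereal r1" "ereal r1 < fps_conv_radius k" using ereal_dense2[OF k] by blast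
  define r0 where "r0 = min 1 r1"
  have r0: "0 < r0" "r0 \<le> 1" using r1 by (auto simp: r0_def)
  have "ereal r0 \<le> ereal r1" by (simp add: r0_def)
  then have r0k: "ereal r0 < fps_conv_radius k" using r1(2) by (rule order_le_less_trans)
  obtain K where K: "\<And>M. trunc_norm M r0 k \<le> K" using trunc_norm_bounded_of_radius[OF r0k r0(1)] by blast
  have snorm: "submult_seminorm (trunc_norm M r)" if "0 < r" "r \<le> 1" for M r
    by (intro submult_seminorm_fps_trunc_norm submult_seminorm_norm weight_power that)
  have K0: "0 \<le> K" using K[of 0] submult_seminormD(2)[OF snorm[OF r0], of 0 k] by linarith
  \<comment> \<open>Each round trip through the two equations multiplies by \<open>k\<close> twice,
    so the contraction factor is \<open>r * (K * K)\<close>; this choice keeps it at most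
    1/2.\<close>
  define \<rho>0 where "\<rho>0 = min r0 (1 / (2 * (K * K) + 1))"
  have \<rho>0: "0 < \<rho>0" using r0 K0 by (simp add: \<rho>0_def add_nonneg_pos)
  have main: "\<exists>\<xi> \<eta>. ereal \<rho> \<le> fps_conv_radius \<xi> \<and> ereal \<rho> \<le> fps_conv_radius \<eta> \<and> fps_nth \<xi> 0 = c \<and>
       2 * (fps_X * fps_deriv \<eta>) + of_nat (N + 1) * \<eta> + k * \<xi> = p \<and>
       2 * fps_deriv \<xi> + fps_X ^ N * k * \<eta> = q"
    if \<rho>: "0 < \<rho>" "\<rho> \<le> \<rho>0" and p: "ereal \<rho> \<le> fps_conv_radius p" and q: "ereal \<rho> \<le> fps_conv_radius q"
    for \<rho> p q c
  proof -
    define L :: "complex fps \<Rightarrow> complex fps" where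
      "L f = Abs_fps (\<lambda>j. fps_nth f j / of_nat (2 * j + N + 1))" for f
    define J :: "complex fps \<Rightarrow> complex fps" where
      "J f = Abs_fps (\<lambda>j. if j = 0 then 0 else fps_nth f (j - 1) / of_nat (2 * j))" for f
    \<comment> \<open>The first equation gives \<open>\<eta> = L (p - k * \<xi>)\<close>. Inserted
      into the second, which is integrated from \<open>c\<close> by \<open>J\<close> with the factor
      1/2 included, it leaves an equation for \<open>\<xi>\<close> alone.\<close>
    define \<Phi> where "\<Phi> \<xi> = fps_const c + J (q - fps_X ^ N * k * L (p - k * \<xi>))" for \<xi>
    have "\<exists>x. fps_nth (\<Phi> (Abs_fps x)) = x"
    proof (rule causal_fixpoint_ex[where \<delta> = id and F = "\<lambda>x. fps_nth (\<Phi> (Abs_fps x))"])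
      fix x y :: "nat \<Rightarrow> complex" and i
      assume xy: "\<And>j. id j < id i \<Longrightarrow> x j = y j"
      show "fps_nth (\<Phi> (Abs_fps x)) i = fps_nth (\<Phi> (Abs_fps y)) i"
      proof (cases i)
        case (Suc l)
        have "fps_nth (fps_X ^ N * k * L (p - k * Abs_fps x)) l = fps_nth (fps_X ^ N * k * L (p - k * Abs_fps y)) l"
        proof (rule fps_mult_nth_cong)
          fix j assume "j \<le> l"
          then have "fps_nth (k * Abs_fps x) j = fps_nth (k * Abs_fps y) j"
            using xy Suc by (intro fps_mult_nth_cong) auto
          then show "fps_nth (L (p - k * Abs_fps x)) j = fps_nth (L (p - k * Abs_fps y)) j"
            by (simp add: L_def)
        qed
        then show ?thesis by (simp add: \<Phi>_def J_def Suc)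
      qed (simp add: \<Phi>_def J_def)
    qed
    then obtain x where "fps_nth (\<Phi> (Abs_fps x)) = x" by blast
    then have fix': "\<Phi> (Abs_fps x) = Abs_fps x" by (simp add: fps_eq_iff)
    define \<xi> where "\<xi> = Abs_fps x"
    have \<xi>: "\<xi> = fps_const c + J (q - fps_X ^ N * k * L (p - k * \<xi>))"
      using fix' by (simp add: \<xi>_def \<Phi>_def)
    define \<eta> where "\<eta> = L (p - k * \<xi>)"
    have "\<rho> \<le> r0" using \<rho> by (simp add: \<rho>0_def)
    then have \<rho>k: "ereal \<rho> \<le> fps_conv_radius k" using r0k by (meson ereal_less_eq(3) less_imp_le order_trans)
    have \<xi>_rad: "ereal \<rho> \<le> fps_conv_radius \<xi>"
    proof (rule radius_geI)
      fix r :: real assume r: "0 < r" "r < \<rho>"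
      have r1: "r \<le> 1" "r \<le> r0" using r \<open>\<rho> \<le> r0\<close> r0 by auto
      obtain P Q where P: "\<And>M. trunc_norm M r p \<le> P" and Q: "\<And>M. trunc_norm M r q \<le> Q"
        using trunc_norm_bounded_of_radius r p q
        by (metis less_ereal.simps(1) order_less_le_trans)
      have rK: "r * (K * K) \<le> 1 / 2"
      proof -
        have aux: "1 / (2 * a + 1) * a \<le> 1 / 2" if "0 \<le> a" for a :: real
          using that by (simp add: field_simps)
        have "r \<le> 1 / (2 * (K * K) + 1)" using r \<rho> by (simp add: \<rho>0_def)
        then have "r * (K * K) \<le> 1 / (2 * (K * K) + 1) * (K * K)" using K0 by (intro mult_right_mono) auto
        also have "\<dots> \<le> 1 / 2" by (rule aux) (use K0 in simp)
        finally show ?thesis .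
      qed
      have "trunc_norm M r \<xi> \<le> 2 * (norm c + r * (Q + K * P))" for M
      proof -
        let ?p = "trunc_norm M r"
        note S = submult_seminormD[OF snorm[OF r(1) r1(1), of M]]
        have pk: "?p k \<le> K"
        proof -
          have "?p k \<le> trunc_norm M r0 k"
            unfolding fps_trunc_norm_def using r r1 by (intro sum_mono mult_right_mono power_mono) auto
          then show ?thesis using K[of M] by linarith
        qed
        have pX: "?p (fps_X ^ N) \<le> 1"
        proof -
          have "?p (fps_X ^ N) = (\<Sum>j\<le>M. if j = N then r ^ N else 0)"
            unfolding fps_trunc_norm_def by (intro sum.cong) (auto simp: fps_X_power_iff)
          then show ?thesis using r r1 by (simp add: power_le_one)
        qed
        have pXk: "?p (fps_X ^ N * k) \<le> K"
          using S(5)[of "fps_X ^ N" k] mult_right_mono[OF pX S(2)[of k]] pk by simp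
        have pL: "?p (L f) \<le> ?p f" for f
        proof -
          have "norm (fps_nth f j) / real (2 * j + N + 1) \<le> norm (fps_nth f j)" for j
            using mult_left_mono[of 1 "real (2 * j + N + 1)" "norm (fps_nth f j)"]
            by (subst divide_le_eq) auto
          then show ?thesis
            unfolding fps_trunc_norm_def L_def fps_nth_Abs_fps norm_divide norm_of_nat
            using r by (intro sum_mono mult_left_mono) auto
        qed
        have pJ: "?p (J f) \<le> r * ?p f" for f
        proof (rule fps_trunc_norm_shift_le)
          fix n
          have "norm (fps_nth f n) / real (2 * Suc n) \<le> norm (fps_nth f n)"
            using mult_left_mono[of 1 "real (2 * Suc n)" "norm (fps_nth f n)"]
            by (subst divide_le_eq) auto
          then show "norm (fps_nth (J f) (Suc n)) \<le> norm (fps_nth f n)"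
            by (simp add: J_def norm_divide del: of_nat_Suc of_nat_mult)
        qed (use r in \<open>auto simp: J_def\<close>)
        have "?p (L (p - k * \<xi>)) \<le> ?p p + ?p k * ?p \<xi>"
          using pL[of "p - k * \<xi>"] S(4)[of p "- (k * \<xi>)"] S(3)[of "k * \<xi>"] S(5)[of k \<xi>] by simp
        also have "\<dots> \<le> P + K * ?p \<xi>" using P[of M] pk S(2)[of \<xi>] by (intro add_mono mult_right_mono)
        finally have 1: "?p (L (p - k * \<xi>)) \<le> P + K * ?p \<xi>" .
        have 2: "?p (fps_X ^ N * k * L (p - k * \<xi>)) \<le> K * (P + K * ?p \<xi>)"
          using S(5)[of "fps_X ^ N * k" "L (p - k * \<xi>)"]
            mult_mono[OF pXk 1 K0 S(2)[of "L (p - k * \<xi>)"]] by linarith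
        have "?p (J (q - fps_X ^ N * k * L (p - k * \<xi>))) \<le> r * (Q + K * (P + K * ?p \<xi>))"
        proof -
          have "?p (q - fps_X ^ N * k * L (p - k * \<xi>)) \<le> Q + K * (P + K * ?p \<xi>)"
            using S(4)[of q "- (fps_X ^ N * k * L (p - k * \<xi>))"] S(3)[of "fps_X ^ N * k * L (p - k * \<xi>)"]
              2 Q[of M] by simp
          then show ?thesis using pJ r by (meson less_imp_le mult_left_mono order_trans)
        qed
        moreover have "?p (fps_const c) = norm c"
        proof -
          have "?p (fps_const c) = (\<Sum>j\<le>M. if j = 0 then norm c else 0)"
            unfolding fps_trunc_norm_def by (intro sum.cong) auto
          then show ?thesis by simp
        qed
        ultimately have "?p \<xi> \<le> norm c + r * (Q + K * (P + K * ?p \<xi>))"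
          using S(4)[of "fps_const c" "J (q - fps_X ^ N * k * L (p - k * \<xi>))"] \<xi> by simp
        also have "\<dots> = norm c + r * (Q + K * P) + (r * (K * K)) * ?p \<xi>" by (simp add: algebra_simps)
        \<comment> \<open>The truncated norm is finite, so half of it moves to the left and leaves a
          bound free of \<open>M\<close>.\<close>
        also have "\<dots> \<le> norm c + r * (Q + K * P) + (1 / 2) * ?p \<xi>"
          using rK S(2)[of \<xi>] by (intro add_left_mono mult_right_mono) auto
        finally show ?thesis by simp
      qed
      then show "\<exists>C. \<forall>M. trunc_norm M r \<xi> \<le> C" by blast
    qed
    have \<eta>_rad: "ereal \<rho> \<le> fps_conv_radius \<eta>"
    proof (rule radius_ge_cong)
      show "ereal \<rho> \<le> fps_conv_radius (p - k * \<xi>)"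
        by (intro radius_ge_diff radius_ge_mult p \<rho>k \<xi>_rad)
      fix j
      show "norm (fps_nth \<eta> j) \<le> norm (fps_nth (p - k * \<xi>) j)"
        using mult_left_mono[of 1 "real (2 * j + N + 1)" "norm (fps_nth (p - k * \<xi>) j)"]
        unfolding \<eta>_def L_def fps_nth_Abs_fps norm_divide norm_of_nat
        by (subst divide_le_eq) auto
    qed
    have "2 * (fps_X * fps_deriv \<eta>) + of_nat (N + 1) * \<eta> = p - k * \<xi>"
      unfolding \<eta>_def L_def by (rule euler_operator_solve)
    moreover have "2 * fps_deriv \<xi> = q - fps_X ^ N * k * \<eta>"
    proof (rule fps_ext)
      fix j
      have "fps_nth \<xi> (Suc j) = fps_nth (q - fps_X ^ N * k * \<eta>) j / of_nat (2 * Suc j)"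
        using arg_cong[OF \<xi>, of "\<lambda>f. fps_nth f (Suc j)"] unfolding \<eta>_def[symmetric]
        by (simp add: J_def del: of_nat_Suc of_nat_mult)
      then have "of_nat (2 * Suc j) * fps_nth \<xi> (Suc j) = fps_nth (q - fps_X ^ N * k * \<eta>) j"
        by (simp del: of_nat_Suc of_nat_mult)
      then show "fps_nth (2 * fps_deriv \<xi>) j = fps_nth (q - fps_X ^ N * k * \<eta>) j"
        by (simp add: numeral_fps_const algebra_simps)
    qed
    moreover have "fps_nth \<xi> 0 = c"
      using arg_cong[OF \<xi>, of "\<lambda>f. fps_nth f 0"] by (simp add: J_def)
    ultimately show ?thesis using \<xi>_rad \<eta>_rad by - (rule exI[of _ \<xi>], rule exI[of _ \<eta>], simp)
  qed
  then show ?thesis using \<rho>0 by blast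
qed

section \<open>Gauge equations between normal forms\<close>

definition t1_free :: "(nat \<Rightarrow> complex fps) \<Rightarrow> tzser" where
  "t1_free x = Abs_fps (\<lambda>n. fps_const (x n))"

lemma t1_free_nth [simp]: "fps_nth (t1_free x) n = fps_const (x n)"
  by (simp add: t1_free_def)

lemma t1_free_eq_iff: "t1_free x = t1_free y \<longleftrightarrow> (\<forall>n. x n = y n)"
  by (simp add: fps_eq_iff[of "t1_free x"])

lemma t1_free_eq_0_iff: "t1_free x = 0 \<longleftrightarrow> (\<forall>n. x n = 0)"
  by (simp add: fps_eq_iff[of "t1_free x"])

lemma fps_const_sum: "fps_const (\<Sum>i\<in>A. f i) = (\<Sum>i\<in>A. fps_const (f i))"
  by (induction A rule: infinite_finite_induct) (simp_all flip: fps_const_add)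

lemma t1_free_arith:
  "t1_free x + t1_free y = t1_free (\<lambda>n. x n + y n)"
  "t1_free x - t1_free y = t1_free (\<lambda>n. x n - y n)"
  "t1_free x * t1_free y = t1_free (\<lambda>n. \<Sum>k\<le>n. x k * y (n - k))"
  "2 * t1_free x = t1_free (\<lambda>n. 2 * x n)"
  "fps_X * t1_free x = t1_free (\<lambda>n. if n = 0 then 0 else x (n - 1))"
  "d2 (t1_free x) = t1_free (\<lambda>n. fps_deriv (x n))"
proof -
  show "t1_free x + t1_free y = t1_free (\<lambda>n. x n + y n)"
    "t1_free x - t1_free y = t1_free (\<lambda>n. x n - y n)"
    "fps_X * t1_free x = t1_free (\<lambda>n. if n = 0 then 0 else x (n - 1))"
    by (auto intro!: fps_ext[where 'a = tser] simp flip: fps_const_add fps_const_sub)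
  show "2 * t1_free x = t1_free (\<lambda>n. 2 * x n)"
    unfolding mult_2 by (auto intro!: fps_ext[where 'a = tser] simp flip: fps_const_add)
  show "t1_free x * t1_free y = t1_free (\<lambda>n. \<Sum>k\<le>n. x k * y (n - k))"
    by (rule fps_ext) (simp add: fps_mult_nth fps_const_sum atLeast0AtMost flip: fps_const_mult)
  show "d2 (t1_free x) = t1_free (\<lambda>n. fps_deriv (x n))"
    by (auto simp: d2_def fps_eq_iff)
qed

lemma t1_free_exists: "d1 f = 0 \<Longrightarrow> \<exists>x. f = t1_free x"
  using restrict1_id[of f] unfolding restrict1_def t1_free_def by metis

lemma d1_t1_free [simp]: "d1 (t1_free x) = 0"
  by (simp add: d1_def fps_eq_iff)

text \<open>The \<open>z\<close>-coefficients of \<open>t2\<^bsup>m-2\<^esup> + z f\<close>.\<close>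

definition principal_seq :: "nat \<Rightarrow> (nat \<Rightarrow> complex fps) \<Rightarrow> nat \<Rightarrow> complex fps" where
  "principal_seq m \<phi> k = (if k = 0 then fps_X ^ (m - 2) else \<phi> (k - 1))"

lemma principal_seq: "fps_const (t2 ^ (m - 2)) + fps_X * t1_free \<phi> = t1_free (principal_seq m \<phi>)"
proof -
  have "fps_const (t2 ^ (m - 2)) = t1_free (\<lambda>n. if n = 0 then fps_X ^ (m - 2) else 0)"
    unfolding t2_def fps_const_power by (rule fps_ext) simp
  from arg_cong[OF this, of "\<lambda>c. c + fps_X * t1_free \<phi>"] show ?thesis
    unfolding t1_free_arith by (simp add: t1_free_eq_iff principal_seq_def)
qed

text \<open>The first column of \<open>form_A2 m g\<close> is the second unit vector, so the second
  column of \<open>T\<close> is \<open>z\<nabla>\<^sub>2\<close> applied to the first. After this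
  substitution the other two entries are divisible by \<open>z\<close>, because \<open>a m f\<close>
  and \<open>a m g\<close> differ by \<open>fps_X * (f - g)\<close>.\<close>

lemma gauge_equation_iff:
  defines "a \<equiv> (\<lambda>m f. fps_const (t2 ^ (m - 2)) + fps_X * f)"
  shows "zd2 T + form_A2 m f ** T - T ** form_A2 m g = 0 \<longleftrightarrow>
    T $ 1 $ 2 = fps_X * d2 (T $ 1 $ 1) + a m f * T $ 2 $ 1 \<and>
    T $ 2 $ 2 = fps_X * d2 (T $ 2 $ 1) + T $ 1 $ 1 \<and>
    fps_X * d2 (d2 (T $ 1 $ 1)) + d2 (a m f) * T $ 2 $ 1 + 2 * (a m f * d2 (T $ 2 $ 1))
      + (f - g) * T $ 1 $ 1 = 0 \<and>
    2 * d2 (T $ 1 $ 1) + (f - g) * T $ 2 $ 1 + fps_X * d2 (d2 (T $ 2 $ 1)) = 0"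
proof -
  define x y u v where "x = T $ 1 $ 1" "y = T $ 2 $ 1" "u = T $ 1 $ 2" "v = T $ 2 $ 2"
  note xs = this
  let ?E = "zd2 T + form_A2 m f ** T - T ** form_A2 m g"
  have b: "a m g = a m f - fps_X * (f - g)" by (simp add: a_def algebra_simps)
  have E: "?E = 0 \<longleftrightarrow> ?E $ 1 $ 1 = 0 \<and> ?E $ 2 $ 1 = 0 \<and> ?E $ 1 $ 2 = 0 \<and> ?E $ 2 $ 2 = 0"
    by (auto simp: vec_eq_iff forall_2)
  have 1: "?E $ 1 $ 1 = 0 \<longleftrightarrow> u = fps_X * d2 x + a m f * y"
    by (auto simp: mat2_mult_nth xs[symmetric] a_def)
  have 2: "?E $ 2 $ 1 = 0 \<longleftrightarrow> v = fps_X * d2 y + x"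
    by (auto simp: mat2_mult_nth xs[symmetric])
  have e12: "?E $ 1 $ 2 = fps_X * d2 u + a m f * v - x * a m g"
    by (simp add: mat2_mult_nth xs[symmetric] a_def)
  have e22: "?E $ 2 $ 2 = fps_X * d2 v + u - y * a m g"
    by (simp add: mat2_mult_nth xs[symmetric] a_def)
  have 3: "?E $ 1 $ 2 = fps_X * (fps_X * d2 (d2 x) + d2 (a m f) * y + 2 * (a m f * d2 y) + (f - g) * x)"
    if "u = fps_X * d2 x + a m f * y" "v = fps_X * d2 y + x"
    unfolding e12 that b by (simp add: d2_simps algebra_simps)
  have 4: "?E $ 2 $ 2 = fps_X * (2 * d2 x + (f - g) * y + fps_X * d2 (d2 y))"
    if "u = fps_X * d2 x + a m f * y" "v = fps_X * d2 y + x"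
    unfolding e22 that b by (simp add: d2_simps algebra_simps)
  show ?thesis unfolding E 1 2 xs[symmetric] using 3 4 by auto
qed

text \<open>The coefficients of \<open>z\<^sup>n\<close> in the last two equations of \<open>gauge_equation_iff\<close>.\<close>

definition gauge_eq1 :: "nat \<Rightarrow> (nat \<Rightarrow> complex fps) \<Rightarrow> (nat \<Rightarrow> complex fps) \<Rightarrow> (nat \<Rightarrow> complex fps)
    \<Rightarrow> (nat \<Rightarrow> complex fps) \<Rightarrow> nat \<Rightarrow> bool" where
  "gauge_eq1 m \<phi> \<gamma> x y n \<longleftrightarrow> (if n = 0 then 0 else fps_deriv (fps_deriv (x (n - 1))))
     + (\<Sum>k\<le>n. fps_deriv (principal_seq m \<phi> k) * y (n - k))
     + 2 * (\<Sum>k\<le>n. principal_seq m \<phi> k * fps_deriv (y (n - k)))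
     + (\<Sum>k\<le>n. (\<phi> k - \<gamma> k) * x (n - k)) = 0"

definition gauge_eq2 :: "(nat \<Rightarrow> complex fps) \<Rightarrow> (nat \<Rightarrow> complex fps) \<Rightarrow> (nat \<Rightarrow> complex fps)
    \<Rightarrow> (nat \<Rightarrow> complex fps) \<Rightarrow> nat \<Rightarrow> bool" where
  "gauge_eq2 \<phi> \<gamma> x y n \<longleftrightarrow> 2 * fps_deriv (x n) + (\<Sum>k\<le>n. (\<phi> k - \<gamma> k) * y (n - k))
     + (if n = 0 then 0 else fps_deriv (fps_deriv (y (n - 1)))) = 0"

lemma gauge_equation_t1_free_iff:
  assumes "T $ 1 $ 1 = t1_free x" "T $ 2 $ 1 = t1_free y"
  shows "zd2 T + form_A2 m (t1_free \<phi>) ** T - T ** form_A2 m (t1_free \<gamma>) = 0 \<longleftrightarrow>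
    T $ 1 $ 2 = fps_X * d2 (t1_free x) + t1_free (principal_seq m \<phi>) * t1_free y \<and>
    T $ 2 $ 2 = fps_X * d2 (t1_free y) + t1_free x \<and>
    (\<forall>n. gauge_eq1 m \<phi> \<gamma> x y n) \<and> (\<forall>n. gauge_eq2 \<phi> \<gamma> x y n)"
proof -
  have 1: "fps_X * d2 (d2 (t1_free x)) + d2 (t1_free (principal_seq m \<phi>)) * t1_free y
      + 2 * (t1_free (principal_seq m \<phi>) * d2 (t1_free y)) + (t1_free \<phi> - t1_free \<gamma>) * t1_free x = 0
    \<longleftrightarrow> (\<forall>n. gauge_eq1 m \<phi> \<gamma> x y n)"
    unfolding t1_free_arith t1_free_eq_0_iff gauge_eq1_def by simp
  have 2: "2 * d2 (t1_free x) + (t1_free \<phi> - t1_free \<gamma>) * t1_free y + fps_X * d2 (d2 (t1_free y)) = 0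
    \<longleftrightarrow> (\<forall>n. gauge_eq2 \<phi> \<gamma> x y n)"
    unfolding t1_free_arith t1_free_eq_0_iff gauge_eq2_def by simp
  show ?thesis unfolding gauge_equation_iff principal_seq assms 1 2 ..
qed

lemma fps_deriv_X_power_Suc:
  "fps_deriv (fps_X ^ Suc N) = (of_nat (Suc N) * fps_X ^ N :: complex fps)"
  by (rule fps_ext) (simp add: fps_X_power_iff fps_of_nat[symmetric] del: power_Suc of_nat_Suc)

lemma radius_finite_support:
  assumes "\<And>j. N \<le> j \<Longrightarrow> fps_nth f j = 0"
  shows "fps_conv_radius (f :: complex fps) = \<infinity>"
proof -
  have "fps_conv_radius f = conv_radius (\<lambda>_. 0 :: complex)"
    unfolding fps_conv_radius_def using assms
    by (intro conv_radius_cong eventually_mono[OF eventually_ge_at_top[of N]]) auto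
  then show ?thesis by simp
qed

lemma sum_eq_single:
  fixes f :: "nat \<Rightarrow> 'a::comm_monoid_add"
  assumes "i \<le> n" "\<And>k. k \<le> n \<Longrightarrow> k \<noteq> i \<Longrightarrow> f k = 0"
  shows "(\<Sum>k\<le>n. f k) = f i"
  using assms by (subst sum.remove[of _ i]) (auto intro!: sum.neutral)

text \<open>By induction, order \<open>n\<close> reads: \<open>t2^N\<close> times the Euler operator
  on \<open>y n\<close>, plus \<open>(\<phi> n - \<gamma> n) * x 0\<close>, is zero. As
  \<open>x 0\<close> is a unit, \<open>t2^N\<close> divides \<open>\<phi> n - \<gamma> n\<close>,
  whose degree is below \<open>N\<close>; so it vanishes. Injectivity of the Euler operator and the
  second equation give the rest.\<close>

lemma gauge_seq_unique:
  assumes m: "m \<ge> 3"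
    and eq1: "\<And>n. gauge_eq1 m \<phi> \<gamma> x y n" and eq2: "\<And>n. gauge_eq2 \<phi> \<gamma> x y n"
    and x0: "fps_nth (x 0) 0 \<noteq> 0"
    and low: "\<And>n j. m - 3 \<le> j \<Longrightarrow> fps_nth (\<phi> n) j = 0" "\<And>n j. m - 3 \<le> j \<Longrightarrow> fps_nth (\<gamma> n) j = 0"
  shows "\<phi> n = \<gamma> n \<and> y n = 0 \<and> fps_deriv (x n) = 0"
proof (induction n rule: less_induct)
  case (less n)
  define N where "N = m - 3"
  have mN: "m - 2 = Suc N" using m by (simp add: N_def)
  have h: "\<phi> k - \<gamma> k = 0" "y k = 0" "fps_deriv (x k) = 0" if "k < n" for k using less[OF that] by auto
  have 1: "(if n = 0 then 0 else fps_deriv (fps_deriv (x (n - 1)))) = 0"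
  proof (cases "n = 0")
    case False
    then have "fps_deriv (fps_deriv (x (n - 1))) = fps_deriv 0" by (intro arg_cong[where f = fps_deriv] h(3)) simp
    then show ?thesis by simp
  qed simp
  have "(\<Sum>k\<le>n. fps_deriv (principal_seq m \<phi> k) * y (n - k)) = fps_deriv (principal_seq m \<phi> 0) * y (n - 0)"
    using h(2) by (intro sum_eq_single) auto
  moreover have "(\<Sum>k\<le>n. principal_seq m \<phi> k * fps_deriv (y (n - k))) = principal_seq m \<phi> 0 * fps_deriv (y (n - 0))"
    using h(2) by (intro sum_eq_single) auto
  moreover have "(\<Sum>k\<le>n. (\<phi> k - \<gamma> k) * x (n - k)) = (\<phi> n - \<gamma> n) * x (n - n)"
    using h(1) by (intro sum_eq_single) auto
  ultimately have A: "fps_X ^ N * (2 * (fps_X * fps_deriv (y n)) + of_nat (Suc N) * y n)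
      + (\<phi> n - \<gamma> n) * x 0 = 0"
    using eq1[of n] unfolding gauge_eq1_def 1
    by (simp add: principal_seq_def mN fps_deriv_X_power_Suc del: power_Suc) (simp add: algebra_simps)
  have inv: "x 0 * inverse (x 0) = 1" using x0 by (simp add: inverse_mult_eq_1')
  have "\<phi> n - \<gamma> n = fps_X ^ N * (- ((2 * (fps_X * fps_deriv (y n)) + of_nat (Suc N) * y n) * inverse (x 0)))"
  proof -
    have "\<phi> n - \<gamma> n = (\<phi> n - \<gamma> n) * x 0 * inverse (x 0)" by (simp add: mult.assoc inv)
    also have "(\<phi> n - \<gamma> n) * x 0 = - (fps_X ^ N * (2 * (fps_X * fps_deriv (y n)) + of_nat (Suc N) * y n))"
      using A by (simp add: eq_neg_iff_add_eq_0 add.commute)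
    finally show ?thesis by (simp only: mult.assoc mult_minus_left mult_minus_right)
  qed
  then have "fps_nth (\<phi> n - \<gamma> n) j = 0" if "j < N" for j
    using that by (simp only: fps_X_power_mult_nth) simp
  moreover have "fps_nth (\<phi> n - \<gamma> n) j = 0" if "N \<le> j" for j using low that by (simp add: N_def)
  ultimately have \<phi>\<gamma>: "\<phi> n - \<gamma> n = 0" by (intro fps_ext) (metis fps_zero_nth not_less)
  with A have "2 * (fps_X * fps_deriv (y n)) + of_nat (Suc N) * y n = 0" by simp
  then have yj: "of_nat (2 * j + Suc N) * fps_nth (y n) j = 0" for j
    using euler_operator_nth[of "y n" N j] by (simp only: Suc_eq_plus1 add.assoc fps_zero_nth)
  have "fps_nth (y n) j = 0" for j
  proof -
    have "(of_nat (2 * j + Suc N) :: complex) \<noteq> 0" by (simp only: of_nat_eq_0_iff)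
    then show ?thesis using yj[of j] by (metis mult_eq_0_iff)
  qed
  then have y: "y n = 0" by (simp add: fps_eq_iff)
  have 2: "(if n = 0 then 0 else fps_deriv (fps_deriv (y (n - 1)))) = 0" using h(2)[of "n - 1"] by simp
  have "(\<Sum>k\<le>n. (\<phi> k - \<gamma> k) * y (n - k)) = 0"
    using h(1) \<phi>\<gamma> by (intro sum.neutral) (metis atMost_iff le_neq_implies_less mult_zero_left)
  then have "2 * fps_deriv (x n) = 0" using eq2[of n] unfolding gauge_eq2_def 2 by simp
  then show ?case using \<phi>\<gamma> y by simp
qed

text \<open>Dependent choice for a condition that may inspect the whole initial segment
  \<open>s 0, ..., s n\<close>.\<close>

lemma sequence_by_extension:
  fixes P :: "nat \<Rightarrow> (nat \<Rightarrow> 'b) \<Rightarrow> bool"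
  assumes ext: "\<And>n s. (\<And>k. k < n \<Longrightarrow> P k s) \<Longrightarrow> \<exists>t. P n (s(n := t))"
    and local: "\<And>n s s'. (\<And>k. k \<le> n \<Longrightarrow> s k = s' k) \<Longrightarrow> P n s \<Longrightarrow> P n s'"
  shows "\<exists>s. \<forall>n. P n s"
proof -
  define F where "F s n = (SOME t. P n (\<lambda>k. if k < n then s k else t))" for s n
  have "\<exists>s. F s = s"
  proof (rule causal_fixpoint_ex[where \<delta> = id])
    fix s s' :: "nat \<Rightarrow> 'b" and n
    assume "\<And>k. id k < id n \<Longrightarrow> s k = s' k"
    then have "(\<lambda>k. if k < n then s k else t) = (\<lambda>k. if k < n then s' k else t)" for t by auto
    then show "F s n = F s' n" by (simp add: F_def)
  qed
  then obtain s where s: "F s = s" by blast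
  have "P n s" for n
  proof (induction n rule: less_induct)
    case (less n)
    then obtain t where "P n (s(n := t))" using ext by blast
    then have "P n (\<lambda>k. if k < n then s k else t)" by (rule local[rotated]) auto
    then have "P n (\<lambda>k. if k < n then s k else F s n)" unfolding F_def by (rule someI)
    then show ?case by (rule local[rotated]) (auto simp: s)
  qed
  then show ?thesis by blast
qed

text \<open>Unknowns of order \<open>n\<close> occur only in the two end terms, paired with
  coefficients of order 0.\<close>

lemma convolution_split:
  fixes u v :: "nat \<Rightarrow> complex fps"
  assumes "n \<noteq> 0"
  shows "(\<Sum>k\<le>n. u k * v (n - k)) = u 0 * v n + u n * v 0 + (\<Sum>k\<in>{1..<n}. u k * v (n - k))"
proof -
  have "{..n} = insert 0 (insert n {1..<n})" using assms by auto
  then show ?thesis using assms by (simp add: add.assoc)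
qed

text \<open>At every order the new pair \<open>(x n, y n)\<close> enters through the same operator,
  whose coefficient \<open>\<kappa>\<close> stems from order 0; everything else goes to the
  right-hand side. Hence \<open>\<rho>\<close> is fixed once, before the recursion starts.\<close>

lemma gauge_seq_exists:
  assumes m: "m \<ge> 3" and \<rho>1: "0 < \<rho>1" "\<And>n. ereal \<rho>1 \<le> fps_conv_radius (\<phi> n)"
  shows "\<exists>\<gamma> x y \<rho>. 0 < \<rho> \<and> (\<forall>n. gauge_eq1 m \<phi> \<gamma> x y n) \<and> (\<forall>n. gauge_eq2 \<phi> \<gamma> x y n) \<and>
    (\<forall>n. ereal \<rho> \<le> fps_conv_radius (x n)) \<and> (\<forall>n. ereal \<rho> \<le> fps_conv_radius (y n)) \<and>
    fps_nth (x 0) 0 = 1 \<and> (\<forall>n j. m - 3 \<le> j \<longrightarrow> fps_nth (\<gamma> n) j = 0)"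
proof -
  define N where "N = m - 3"
  have mN: "m - 2 = Suc N" using m by (simp add: N_def)
  define a where "a = principal_seq m \<phi>"
  have a0: "a 0 = fps_X ^ Suc N" by (simp add: a_def principal_seq_def mN)
  define \<kappa> where "\<kappa> = fps_shift N (\<phi> 0)"
  have \<phi>0: "\<phi> 0 - fps_cutoff N (\<phi> 0) = fps_X ^ N * \<kappa>"
    unfolding \<kappa>_def using fps_shift_cutoff'[of N "\<phi> 0"] by (simp add: diff_eq_eq)
  have "0 < ereal \<rho>1" using \<rho>1 by simp
  also have "ereal \<rho>1 \<le> fps_conv_radius \<kappa>" unfolding \<kappa>_def by (intro radius_ge_shift \<rho>1)
  finally obtain \<rho>0 where \<rho>0: "0 < \<rho>0"
    and solve: "\<And>\<rho> p q c. 0 < \<rho> \<Longrightarrow> \<rho> \<le> \<rho>0 \<Longrightarrow> ereal \<rho> \<le> fps_conv_radius p \<Longrightarrow> ereal \<rho> \<le> fps_conv_radius q \<Longrightarrow>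
      \<exists>\<xi> \<eta>. ereal \<rho> \<le> fps_conv_radius \<xi> \<and> ereal \<rho> \<le> fps_conv_radius \<eta> \<and> fps_nth \<xi> 0 = c \<and>
       2 * (fps_X * fps_deriv \<eta>) + of_nat (N + 1) * \<eta> + \<kappa> * \<xi> = p \<and>
       2 * fps_deriv \<xi> + fps_X ^ N * \<kappa> * \<eta> = q"
    using regular_singular_system[of \<kappa> N] by metis
  define \<rho> where "\<rho> = min \<rho>0 \<rho>1"
  have \<rho>: "0 < \<rho>" "\<rho> \<le> \<rho>0" using \<rho>0 \<rho>1 by (auto simp: \<rho>_def)
  have "ereal \<rho> \<le> ereal \<rho>1" by (simp add: \<rho>_def)
  then have \<phi>_rad: "ereal \<rho> \<le> fps_conv_radius (\<phi> n)" for n using \<rho>1(2) order_trans by blast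
  have a_rad: "ereal \<rho> \<le> fps_conv_radius (a n)" for n
    using \<phi>_rad by (simp add: a_def principal_seq_def)
  \<comment> \<open>The order-0 part of the first equation carries a common factor
    \<open>t2^N\<close>; cancelling it leaves the regular singular system.\<close>
  have singular: "fps_deriv (a 0) * \<eta> + 2 * (a 0 * fps_deriv \<eta>) + fps_X ^ N * \<kappa> * \<xi>
      = fps_X ^ N * (2 * (fps_X * fps_deriv \<eta>) + of_nat (N + 1) * \<eta> + \<kappa> * \<xi>)" for \<xi> \<eta>
    unfolding a0 fps_deriv_X_power_Suc by (simp add: algebra_simps)
  define X Y G where "X s = (\<lambda>k. fst (s k))" "Y s = (\<lambda>k. fst (snd (s k)))" "G s = (\<lambda>k. snd (snd (s k)))"
    for s :: "nat \<Rightarrow> complex fps \<times> complex fps \<times> complex fps"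
  note XYG = this
  \<comment> \<open>The clause for \<open>n = 0\<close> makes \<open>x 0\<close> a unit and fixes
    \<open>\<phi> 0 - \<gamma> 0\<close> as \<open>t2^N * \<kappa>\<close>; every later order relies
    on both.\<close>
  define P where "P n s \<longleftrightarrow> gauge_eq1 m \<phi> (G s) (X s) (Y s) n \<and> gauge_eq2 \<phi> (G s) (X s) (Y s) n \<and>
    ereal \<rho> \<le> fps_conv_radius (X s n) \<and> ereal \<rho> \<le> fps_conv_radius (Y s n) \<and>
    (\<forall>j. N \<le> j \<longrightarrow> fps_nth (G s n) j = 0) \<and>
    (n = 0 \<longrightarrow> fps_nth (X s 0) 0 = 1 \<and> G s 0 = fps_cutoff N (\<phi> 0))" for n s
  have "\<exists>s. \<forall>n. P n s"
  proof (rule sequence_by_extension)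
    fix n s s' assume eq: "\<And>k. k \<le> n \<Longrightarrow> s k = s' k" and "P n s"
    have sums: "(\<Sum>k\<le>n. u k * f (Y s (n - k))) = (\<Sum>k\<le>n. u k * f (Y s' (n - k)))"
      "(\<Sum>k\<le>n. (\<phi> k - G s k) * X s (n - k)) = (\<Sum>k\<le>n. (\<phi> k - G s' k) * X s' (n - k))"
      "(\<Sum>k\<le>n. (\<phi> k - G s k) * Y s (n - k)) = (\<Sum>k\<le>n. (\<phi> k - G s' k) * Y s' (n - k))"
      for u :: "nat \<Rightarrow> complex fps" and f :: "complex fps \<Rightarrow> complex fps"
      by (intro sum.cong refl; simp add: XYG eq)+
    have "gauge_eq1 m \<phi> (G s) (X s) (Y s) n \<longleftrightarrow> gauge_eq1 m \<phi> (G s') (X s') (Y s') n"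
      unfolding gauge_eq1_def sums(1)[of _ fps_deriv] sums(1)[of _ "\<lambda>f. f"] sums(2)
      using eq[of "n - 1"] by (simp add: XYG)
    moreover have "gauge_eq2 \<phi> (G s) (X s) (Y s) n \<longleftrightarrow> gauge_eq2 \<phi> (G s') (X s') (Y s') n"
      unfolding gauge_eq2_def sums(3)
      using eq[of "n - 1"] eq[of n] by (simp add: XYG)
    ultimately show "P n s'" using \<open>P n s\<close> eq[of n] eq[of 0] unfolding P_def by (simp add: XYG)
  next
    fix n s assume IH: "\<And>k. k < n \<Longrightarrow> P k s"
    show "\<exists>t. P n (s(n := t))"
    proof (cases "n = 0")
      case True
      have "\<exists>\<xi> \<eta>. ereal \<rho> \<le> fps_conv_radius \<xi> \<and> ereal \<rho> \<le> fps_conv_radius \<eta> \<and> fps_nth \<xi> 0 = 1 \<and>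
        2 * (fps_X * fps_deriv \<eta>) + of_nat (N + 1) * \<eta> + \<kappa> * \<xi> = 0 \<and>
        2 * fps_deriv \<xi> + fps_X ^ N * \<kappa> * \<eta> = 0"
        by (rule solve[OF \<rho>]) simp_all
      then obtain \<xi> \<eta> where S: "ereal \<rho> \<le> fps_conv_radius \<xi>" "ereal \<rho> \<le> fps_conv_radius \<eta>" "fps_nth \<xi> 0 = 1"
        "2 * (fps_X * fps_deriv \<eta>) + of_nat (N + 1) * \<eta> + \<kappa> * \<xi> = 0"
        "2 * fps_deriv \<xi> + fps_X ^ N * \<kappa> * \<eta> = 0" by blast
      let ?s = "s(0 := (\<xi>, \<eta>, fps_cutoff N (\<phi> 0)))"
      have s: "X ?s 0 = \<xi>" "Y ?s 0 = \<eta>" "G ?s 0 = fps_cutoff N (\<phi> 0)" by (simp_all add: XYG)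
      have "gauge_eq1 m \<phi> (G ?s) (X ?s) (Y ?s) 0"
        using singular[of \<eta> \<xi>] unfolding gauge_eq1_def a_def[symmetric] S(4)
        by (simp add: s \<phi>0)
      moreover have "gauge_eq2 \<phi> (G ?s) (X ?s) (Y ?s) 0"
        using S(5) unfolding gauge_eq2_def by (simp add: s \<phi>0)
      ultimately have "P 0 ?s" unfolding P_def using S(1-3) s by simp
      then show ?thesis unfolding True by blast
    next
      case False
      define x y g where "x = X s" "y = Y s" "g = G s"
      note xyg = this
      have P0: "fps_nth (x 0) 0 = 1" "g 0 = fps_cutoff N (\<phi> 0)"
        using IH[of 0] False by (auto simp: P_def xyg)
      have rad: "ereal \<rho> \<le> fps_conv_radius (x k)" "ereal \<rho> \<le> fps_conv_radius (y k)"
        "ereal \<rho> \<le> fps_conv_radius (g k)" if "k < n" for k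
      proof -
        show "ereal \<rho> \<le> fps_conv_radius (x k)" "ereal \<rho> \<le> fps_conv_radius (y k)"
          using IH[OF that] by (auto simp: P_def xyg)
        have "fps_conv_radius (g k) = \<infinity>"
          by (rule radius_finite_support[of N]) (use IH[OF that] in \<open>auto simp: P_def xyg\<close>)
        then show "ereal \<rho> \<le> fps_conv_radius (g k)" by simp
      qed
      \<comment> \<open>All contributions known before order \<open>n\<close>, including the end
        terms in which \<open>a n\<close> meets \<open>y 0\<close>.\<close>
      define c1 where "c1 = fps_deriv (fps_deriv (x (n - 1))) + fps_deriv (a n) * y 0 + 2 * (a n * fps_deriv (y 0))
        + (\<Sum>k\<in>{1..<n}. fps_deriv (a k) * y (n - k)) + 2 * (\<Sum>k\<in>{1..<n}. a k * fps_deriv (y (n - k)))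
        + (\<Sum>k\<in>{1..<n}. (\<phi> k - g k) * x (n - k))"
      define c2 where "c2 = (\<Sum>k\<in>{1..<n}. (\<phi> k - g k) * y (n - k)) + fps_deriv (fps_deriv (y (n - 1)))"
      have c_rad: "ereal \<rho> \<le> fps_conv_radius c1" "ereal \<rho> \<le> fps_conv_radius c2"
        unfolding c1_def c2_def using False
        by (intro radius_ge_add radius_ge_mult radius_ge_sum radius_ge_deriv radius_ge_diff \<phi>_rad a_rad rad; simp)+
      \<comment> \<open>\<open>\<gamma>\<close> makes \<open>(\<phi> n - \<gamma>) x\<^sub>0 + c1\<close> divisible by \<open>t2\<^sup>N\<close>\<close>
      define \<gamma> where "\<gamma> = fps_cutoff N (\<phi> n + c1 * inverse (x 0))"
      \<comment> \<open>As a polynomial \<open>\<gamma>\<close> has infinite radius, although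
        \<open>inverse (x 0)\<close> may converge on a smaller disc only.\<close>
      have \<gamma>_rad: "ereal \<rho> \<le> fps_conv_radius \<gamma>" unfolding \<gamma>_def
        by (subst radius_finite_support[of N]) auto
      define p where "p = fps_shift N ((\<phi> n - \<gamma>) * x 0 + c1)"
      have p: "fps_X ^ N * p = (\<phi> n - \<gamma>) * x 0 + c1"
        unfolding p_def
      proof (rule fps_X_power_mult_shift)
        fix j assume j: "j < N"
        have "x 0 * inverse (x 0) = 1" using P0 by (simp add: inverse_mult_eq_1')
        then have "(\<phi> n - \<gamma>) * x 0 + c1 = x 0 * (\<phi> n + c1 * inverse (x 0) - \<gamma>)" by algebra
        also have "fps_nth \<dots> j = fps_nth (x 0 * 0) j"
          by (rule fps_mult_nth_cong) (use j in \<open>simp add: \<gamma>_def\<close>)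
        finally show "fps_nth ((\<phi> n - \<gamma>) * x 0 + c1) j = 0" by simp
      qed
      have "\<exists>\<xi> \<eta>. ereal \<rho> \<le> fps_conv_radius \<xi> \<and> ereal \<rho> \<le> fps_conv_radius \<eta> \<and> fps_nth \<xi> 0 = 0 \<and>
        2 * (fps_X * fps_deriv \<eta>) + of_nat (N + 1) * \<eta> + \<kappa> * \<xi> = - p \<and>
        2 * fps_deriv \<xi> + fps_X ^ N * \<kappa> * \<eta> = - ((\<phi> n - \<gamma>) * y 0 + c2)"
      proof (rule solve[OF \<rho>])
        show "ereal \<rho> \<le> fps_conv_radius (- p)"
          unfolding p_def fps_conv_radius_uminus using False
          by (intro radius_ge_shift radius_ge_add radius_ge_mult radius_ge_diff \<phi>_rad \<gamma>_rad c_rad rad) simp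
        show "ereal \<rho> \<le> fps_conv_radius (- ((\<phi> n - \<gamma>) * y 0 + c2))"
          unfolding fps_conv_radius_uminus using False
          by (intro radius_ge_add radius_ge_mult radius_ge_diff \<phi>_rad \<gamma>_rad c_rad rad) simp
      qed
      then obtain \<xi> \<eta> where S: "ereal \<rho> \<le> fps_conv_radius \<xi>" "ereal \<rho> \<le> fps_conv_radius \<eta>"
        "2 * (fps_X * fps_deriv \<eta>) + of_nat (N + 1) * \<eta> + \<kappa> * \<xi> = - p"
        "2 * fps_deriv \<xi> + fps_X ^ N * \<kappa> * \<eta> = - ((\<phi> n - \<gamma>) * y 0 + c2)" by blast
      let ?s = "s(n := (\<xi>, \<eta>, \<gamma>))"
      have s: "X ?s n = \<xi>" "Y ?s n = \<eta>" "G ?s n = \<gamma>" by (simp_all add: XYG)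
      have s': "X ?s k = x k" "Y ?s k = y k" "G ?s k = g k" if "k \<noteq> n" for k
        using that by (simp_all add: XYG xyg)
      have mid: "(\<Sum>k\<in>{1..<n}. u k * f (Y ?s (n - k))) = (\<Sum>k\<in>{1..<n}. u k * f (y (n - k)))"
        "(\<Sum>k\<in>{1..<n}. (\<phi> k - G ?s k) * X ?s (n - k)) = (\<Sum>k\<in>{1..<n}. (\<phi> k - g k) * x (n - k))"
        "(\<Sum>k\<in>{1..<n}. (\<phi> k - G ?s k) * Y ?s (n - k)) = (\<Sum>k\<in>{1..<n}. (\<phi> k - g k) * y (n - k))"
        for u :: "nat \<Rightarrow> complex fps" and f :: "complex fps \<Rightarrow> complex fps"
        by (auto intro!: sum.cong simp: s')
      have h0: "\<phi> 0 - g 0 = fps_X ^ N * \<kappa>" using P0 \<phi>0 by simp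
      have "gauge_eq1 m \<phi> (G ?s) (X ?s) (Y ?s) n"
      proof -
        have "fps_deriv (a 0) * \<eta> + 2 * (a 0 * fps_deriv \<eta>) + fps_X ^ N * \<kappa> * \<xi> + (\<phi> n - \<gamma>) * x 0 + c1 = 0"
          unfolding singular S(3) using p by (simp add: add.assoc)
        then show ?thesis
          unfolding gauge_eq1_def a_def[symmetric] convolution_split[OF False, of "\<lambda>k. fps_deriv (a k)" "Y ?s"]
            convolution_split[OF False, of a "\<lambda>k. fps_deriv (Y ?s k)"]
            convolution_split[OF False, of "\<lambda>k. \<phi> k - G ?s k" "X ?s"]
            mid(1)[of _ fps_deriv] mid(1)[of _ "\<lambda>f. f"] mid(2) s
            s'[OF False[symmetric]] h0 c1_def
          using False by (simp add: s' algebra_simps)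
      qed
      moreover have "gauge_eq2 \<phi> (G ?s) (X ?s) (Y ?s) n"
      proof -
        have "2 * fps_deriv \<xi> + fps_X ^ N * \<kappa> * \<eta> + ((\<phi> n - \<gamma>) * y 0 + c2) = 0"
          unfolding S(4) by simp
        then show ?thesis
          unfolding gauge_eq2_def convolution_split[OF False, of "\<lambda>k. \<phi> k - G ?s k" "Y ?s"]
            mid(3) s s'[OF False[symmetric]] h0 c2_def
          using False by (simp add: s' algebra_simps)
      qed
      ultimately have "P n ?s" unfolding P_def using S(1,2) s False by (simp add: \<gamma>_def)
      then show ?thesis by blast
    qed
  qed
  then obtain s where s: "\<And>n. P n s" by blast
  show ?thesis
    by (rule exI[of _ "G s"], rule exI[of _ "X s"], rule exI[of _ "Y s"], rule exI[of _ \<rho>])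
      (use s \<rho>(1) in \<open>auto simp: P_def N_def\<close>)
qed

section \<open>Formal normal forms\<close>

lemma t1_free_in_Ct_formal_z:
  assumes "0 < \<rho>" "\<And>n. ereal \<rho> \<le> fps_conv_radius (x n)"
  shows "t1_free x \<in> Ct_formal_z"
  unfolding Ct_formal_z_def using assms converges_t_fps_const by auto

lemma Ct_formal_z_t1_free_radius:
  assumes "t1_free x \<in> Ct_formal_z"
  shows "\<exists>\<rho>>0. \<forall>n. ereal \<rho> \<le> fps_conv_radius (x n)"
proof -
  obtain r where r: "r > 0" "\<And>n. converges_t r (fps_const (x n))"
    using assms by (auto simp: Ct_formal_z_def)
  have "ereal r \<le> fps_conv_radius (x n)" for n
  proof (rule radius_geI)
    fix s :: real assume s: "0 < s" "s < r"
    have "fps_trunc_norm M (\<lambda>i. s ^ i) (trunc_norm M s) (fps_const (x n)) = trunc_norm M s (x n)" for M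
    proof -
      have "fps_trunc_norm M (\<lambda>i. s ^ i) (trunc_norm M s) (fps_const (x n))
          = (\<Sum>i\<le>M. if i = 0 then trunc_norm M s (x n) else 0)"
        unfolding fps_trunc_norm_def[of M "\<lambda>i. s ^ i" "trunc_norm M s"]
        by (intro sum.cong) (auto simp: fps_trunc_norm_def)
      then show ?thesis by simp
    qed
    then show "\<exists>C. \<forall>M. trunc_norm M s (x n) \<le> C"
      using converges_t_imp_bounded[OF r(2)[of n] s] by auto
  qed
  then show ?thesis using r(1) by blast
qed

lemma fps_of_poly_truncated:
  assumes "\<And>j. k < j \<Longrightarrow> fps_nth (a :: complex fps) j = 0"
  shows "\<exists>p. degree p \<le> k \<and> a = fps_of_poly p"
proof -
  let ?p = "Poly (map (fps_nth a) [0..<Suc k])"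
  have c: "poly.coeff ?p j = fps_nth a j" for j
    unfolding coeff_Poly_eq nth_default_def using assms[of j] by (simp del: upt_Suc)
  have "degree ?p \<le> k" by (rule degree_le) (simp only: c, use assms in blast)
  moreover have "a = fps_of_poly ?p" by (rule fps_ext) (simp only: fps_of_poly_nth c)
  ultimately show ?thesis by blast
qed

text \<open>Vanishing of all coefficients from degree \<open>m - 3\<close> on treats
  \<open>m = 3\<close> and \<open>m \<ge> 4\<close> uniformly and avoids truncated subtraction in
  \<open>m - 4\<close>.\<close>

lemma formal_normal_forms_iff:
  assumes "m \<ge> 3"
  shows "f \<in> formal_normal_forms m \<longleftrightarrow>
    (\<exists>\<gamma>. f = t1_free \<gamma> \<and> (\<forall>n j. m - 3 \<le> j \<longrightarrow> fps_nth (\<gamma> n) j = 0))"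
proof (cases "m = 3")
  case True
  have "(\<forall>n j. fps_nth (\<gamma> n) j = 0) \<longleftrightarrow> (\<forall>n. \<gamma> n = 0)" for \<gamma> :: "nat \<Rightarrow> complex fps"
    by (simp add: fps_eq_iff)
  then show ?thesis
    using True t1_free_eq_0_iff by (auto simp: formal_normal_forms_def intro!: exI[of _ "\<lambda>_. 0"])
next
  case False
  then have m: "m - 3 \<le> j \<longleftrightarrow> m - 4 < j" for j using assms by auto
  show ?thesis
  proof
    assume "f \<in> formal_normal_forms m"
    then have "\<forall>n. \<exists>p. degree p \<le> m - 4 \<and> fps_nth f n = fps_const (fps_of_poly p)"
      using False by (simp add: formal_normal_forms_def Cz_poly_t2_def)
    then obtain p where p: "\<And>n. degree (p n) \<le> m - 4" "\<And>n. fps_nth f n = fps_const (fps_of_poly (p n))"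
      by metis
    have "f = t1_free (\<lambda>n. fps_of_poly (p n))" by (rule fps_ext) (simp add: p(2))
    moreover have "fps_nth (fps_of_poly (p n)) j = 0" if "m - 3 \<le> j" for n j
      unfolding fps_of_poly_nth using p(1)[of n] that unfolding m by (intro coeff_eq_0) simp
    ultimately show "\<exists>\<gamma>. f = t1_free \<gamma> \<and> (\<forall>n j. m - 3 \<le> j \<longrightarrow> fps_nth (\<gamma> n) j = 0)" by blast
  next
    assume "\<exists>\<gamma>. f = t1_free \<gamma> \<and> (\<forall>n j. m - 3 \<le> j \<longrightarrow> fps_nth (\<gamma> n) j = 0)"
    then obtain \<gamma> where \<gamma>: "f = t1_free \<gamma>" "\<And>n j. m - 4 < j \<Longrightarrow> fps_nth (\<gamma> n) j = 0"
      unfolding m by blast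
    have "\<exists>p. degree p \<le> m - 4 \<and> fps_nth f n = fps_const (fps_of_poly p)" for n
      using fps_of_poly_truncated[of "m - 4" "\<gamma> n"] \<gamma> by auto
    then show "f \<in> formal_normal_forms m"
      using False by (simp add: formal_normal_forms_def Cz_poly_t2_def)
  qed
qed

interpretation formal: weight_family "{w. weight w}"
  rewrites "series_ring {w. weight w} = Ct_formal_z"
  by (rule weight_family_formal) (simp add: Ct_formal_z_eq_series_ring)

interpretation hol: weight_family "{w. \<exists>v. 0 < v \<and> v \<le> 1 \<and> w = (\<lambda>n. v ^ n)}"
  rewrites "series_ring {w. \<exists>v. 0 < v \<and> v \<le> 1 \<and> w = (\<lambda>n. v ^ n)} = Ctz"
  by (rule weight_family_Ctz) (simp add: Ctz_eq_series_ring)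

lemma Ctz_subset_Ct_formal_z: "Ctz \<subseteq> Ct_formal_z"
  unfolding Ctz_eq_series_ring Ct_formal_z_eq_series_ring series_ring_def
  using hol.weight by blast

lemma formal_normal_form_exists:
  assumes m: "m \<ge> 3" and f: "f \<in> Ct_formal_z" "d1 f = 0"
  shows "\<exists>g\<in>formal_normal_forms m. T_structure Ct_formal_z C1 (form_A2 m g)
    \<and> gauge_isomorphic Ct_formal_z C1 (form_A2 m f) C1 (form_A2 m g)"
proof -
  obtain \<phi> where \<phi>: "f = t1_free \<phi>" using t1_free_exists[OF f(2)] by blast
  obtain \<rho>1 where "0 < \<rho>1" "\<And>n. ereal \<rho>1 \<le> fps_conv_radius (\<phi> n)"
    using Ct_formal_z_t1_free_radius f(1) unfolding \<phi> by blast
  from gauge_seq_exists[OF m, where \<phi> = \<phi>, OF this] obtain \<gamma> x y \<rho> where \<rho>: "0 < \<rho>"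
    "\<And>n. gauge_eq1 m \<phi> \<gamma> x y n" "\<And>n. gauge_eq2 \<phi> \<gamma> x y n"
    "\<And>n. ereal \<rho> \<le> fps_conv_radius (x n)" "\<And>n. ereal \<rho> \<le> fps_conv_radius (y n)"
    "fps_nth (x 0) 0 = 1" "\<And>n j. m - 3 \<le> j \<Longrightarrow> fps_nth (\<gamma> n) j = 0" by blast
  define g where "g = t1_free \<gamma>"
  have "g \<in> formal_normal_forms m" unfolding formal_normal_forms_iff[OF m] g_def using \<rho>(7) by blast
  have "g \<in> Ct_formal_z" unfolding g_def
    by (rule t1_free_in_Ct_formal_z[of 1]) (auto simp: radius_finite_support[OF \<rho>(7)])
  then have T: "T_structure Ct_formal_z C1 (form_A2 m g)"
    by (rule formal.T_structure_form) (simp add: g_def)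
  define u v where "u = fps_X * d2 (t1_free x) + t1_free (principal_seq m \<phi>) * t1_free y"
    and "v = fps_X * d2 (t1_free y) + t1_free x"
  define T :: "tzser ^ 2 ^ 2" where "T = vector [vector [t1_free x, u], vector [t1_free y, v]]"
  have xy: "t1_free x \<in> Ct_formal_z" "t1_free y \<in> Ct_formal_z"
    using t1_free_in_Ct_formal_z \<rho> by blast+
  have "t1_free (principal_seq m \<phi>) \<in> Ct_formal_z"
    unfolding principal_seq[symmetric] \<phi>[symmetric]
    by (intro formal.R_add formal.R_mult formal.R_X formal.R_t2_power f)
  then have uv: "u \<in> Ct_formal_z" "v \<in> Ct_formal_z"
    unfolding u_def v_def by (intro formal.R_add formal.R_mult formal.R_X formal.R_d2 xy; assumption)+
  have "gauge_isomorphic Ct_formal_z C1 (form_A2 m f) C1 (form_A2 m g)"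
  proof (rule formal.gauge_isomorphicI)
    show "T \<in> mat_over Ct_formal_z"
      by (rule mat_over2I) (simp_all add: T_def xy uv)
    show "zd1 T + C1 ** T - T ** C1 = 0"
      unfolding T_def u_def v_def t1_free_arith by (intro mat2_eqI) (simp_all add: mat2_mult_nth)
    show "zd2 T + form_A2 m f ** T - T ** form_A2 m g = 0"
      unfolding \<phi> g_def
      by (subst gauge_equation_t1_free_iff[of T x y]) (use \<rho>(2,3) in \<open>auto simp: T_def u_def v_def\<close>)
    have "tz_coeff (det T) (0, 0, 0)
        = fps_nth (x 0) 0 * fps_nth (x 0) 0 - fps_nth (principal_seq m \<phi> 0) 0 * fps_nth (y 0) 0 * fps_nth (y 0) 0"
      by (simp add: det_2 T_def u_def v_def tz_coeff_def)
    also have "fps_nth (principal_seq m \<phi> 0) 0 = 0" using m by (simp add: principal_seq_def)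
    finally show "tz_coeff (det T) (0, 0, 0) \<noteq> 0" by (simp add: \<rho>(6))
  qed
  then show ?thesis using T \<open>g \<in> formal_normal_forms m\<close> by blast
qed

lemma formal_normal_form_unique:
  assumes m: "m \<ge> 3" and fg: "f \<in> formal_normal_forms m" "g \<in> formal_normal_forms m"
    and iso: "gauge_isomorphic Ct_formal_z C1 (form_A2 m f) C1 (form_A2 m g)"
  shows "f = g"
proof -
  obtain \<phi> where \<phi>: "f = t1_free \<phi>" "\<And>n j. m - 3 \<le> j \<Longrightarrow> fps_nth (\<phi> n) j = 0"
    using fg(1) unfolding formal_normal_forms_iff[OF m] by blast
  obtain \<gamma> where \<gamma>: "g = t1_free \<gamma>" "\<And>n j. m - 3 \<le> j \<Longrightarrow> fps_nth (\<gamma> n) j = 0"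
    using fg(2) unfolding formal_normal_forms_iff[OF m] by blast
  obtain T S where T: "at_z0 T ** S = mat 1" "zd1 T + C1 ** T - T ** C1 = 0"
    "zd2 T + form_A2 m f ** T - T ** form_A2 m g = 0"
    using iso by (auto simp: gauge_isomorphic_def)
  have "zd1 T = 0" using T(2) by (simp add: C1_def)
  then have "d1 (T $ i $ j) = 0" for i j
    by (metis zd_nth(1) zero_index fps_X_mult_cancel0)
  then obtain x y where x: "T $ 1 $ 1 = t1_free x" and y: "T $ 2 $ 1 = t1_free y"
    using t1_free_exists by metis
  have eqs: "T $ 1 $ 2 = fps_X * d2 (t1_free x) + t1_free (principal_seq m \<phi>) * t1_free y"
    "\<And>n. gauge_eq1 m \<phi> \<gamma> x y n" "\<And>n. gauge_eq2 \<phi> \<gamma> x y n"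
    using T(3) unfolding \<phi>(1) \<gamma>(1) gauge_equation_t1_free_iff[where T = T, OF x y] by auto
  \<comment> \<open>The first row of \<open>T\<close> at the origin is
    \<open>(x\<^sub>0(0), 0)\<close>, because \<open>t2^(m-2)\<close> vanishes there; a zero would
    contradict the invertibility of \<open>T(0)\<close>.\<close>
  have "fps_nth (x 0) 0 \<noteq> 0"
  proof
    assume x0: "fps_nth (x 0) 0 = 0"
    have p0: "fps_nth (principal_seq m \<phi> 0) 0 = 0" using m by (simp add: principal_seq_def)
    have "(at_z0 T ** S) $ 1 $ 1 = 1" using T(1) by simp
    then have "fps_const (x 0) * S $ 1 $ 1 + fps_const (principal_seq m \<phi> 0) * fps_const (y 0) * S $ 2 $ 1 = 1"
      by (simp add: mat2_mult_nth x eqs(1))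
    from arg_cong[OF this, of "\<lambda>a. fps_nth (fps_nth a 0) 0"] show False by (simp add: x0 p0)
  qed
  then have "\<phi> n = \<gamma> n" for n
    using gauge_seq_unique[OF m eqs(2,3) _ \<phi>(2) \<gamma>(2)] by blast
  then show ?thesis by (simp add: \<phi>(1) \<gamma>(1) t1_free_eq_iff)
qed

lemma T_structure_over_I2_mono:
  assumes "T_structure_over_I2 R m A1 A2" "R \<subseteq> R'"
  shows "T_structure_over_I2 R' m A1 A2"
  using assms unfolding T_structure_over_I2_def T_structure_def mat_over_def by auto

theorem theorem16:
  fixes m :: nat
  assumes "m \<ge> 3"
  shows
    "(\<forall>A1 A2. T_structure_over_I2 Ctz m A1 A2 \<longrightarrow>
        (\<exists>f \<in> Ctz. T_structure Ctz C1 (form_A2 m f) \<and>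
           gauge_isomorphic Ctz A1 A2 C1 (form_A2 m f)))
   \<and> (\<forall>A1 A2. T_structure_over_I2 Ct_formal_z m A1 A2 \<longrightarrow>
        (\<exists>f \<in> Ct_formal_z. T_structure Ct_formal_z C1 (form_A2 m f) \<and>
           gauge_isomorphic Ct_formal_z A1 A2 C1 (form_A2 m f)))
   \<and> (\<forall>A1 A2. T_structure_over_I2 Ctz m A1 A2 \<or> T_structure_over_I2 Ct_formal_z m A1 A2 \<longrightarrow>
        (\<exists>f \<in> formal_normal_forms m. T_structure Ct_formal_z C1 (form_A2 m f) \<and>
           gauge_isomorphic Ct_formal_z A1 A2 C1 (form_A2 m f)))
   \<and> (\<forall>f \<in> formal_normal_forms m. \<forall>g \<in> formal_normal_forms m.
        T_structure Ct_formal_z C1 (form_A2 m f) \<longrightarrow>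
        T_structure Ct_formal_z C1 (form_A2 m g) \<longrightarrow>
        gauge_isomorphic Ct_formal_z C1 (form_A2 m f) C1 (form_A2 m g) \<longrightarrow> f = g)"
proof (intro conjI allI impI ballI)
  fix A1 A2 assume "T_structure_over_I2 Ctz m A1 A2"
  then show "\<exists>f\<in>Ctz. T_structure Ctz C1 (form_A2 m f) \<and> gauge_isomorphic Ctz A1 A2 C1 (form_A2 m f)"
    using hol.gauge_normal_form by blast
next
  fix A1 A2 assume "T_structure_over_I2 Ct_formal_z m A1 A2"
  then show "\<exists>f\<in>Ct_formal_z. T_structure Ct_formal_z C1 (form_A2 m f) \<and>
      gauge_isomorphic Ct_formal_z A1 A2 C1 (form_A2 m f)"
    using formal.gauge_normal_form by blast
next
  fix A1 A2 assume "T_structure_over_I2 Ctz m A1 A2 \<or> T_structure_over_I2 Ct_formal_z m A1 A2"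
  then have "T_structure_over_I2 Ct_formal_z m A1 A2"
    using T_structure_over_I2_mono[OF _ Ctz_subset_Ct_formal_z] by blast
  from formal.gauge_normal_form[OF this] obtain f where f: "f \<in> Ct_formal_z" "d1 f = 0"
    "gauge_isomorphic Ct_formal_z A1 A2 C1 (form_A2 m f)" by blast
  from formal_normal_form_exists[OF assms f(1,2)] show "\<exists>f\<in>formal_normal_forms m. T_structure Ct_formal_z C1 (form_A2 m f) \<and>
      gauge_isomorphic Ct_formal_z A1 A2 C1 (form_A2 m f)"
    using formal.gauge_isomorphic_trans[OF f(3)] by blast
next
  fix f g assume "f \<in> formal_normal_forms m" "g \<in> formal_normal_forms m"
    "gauge_isomorphic Ct_formal_z C1 (form_A2 m f) C1 (form_A2 m g)"
  then show "f = g" by (rule formal_normal_form_unique[OF assms])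
qed

end
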